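(* Let $(M,L)$ be a pseudo-Finsler manifold with conic domain $A\subset TM\setminus\mathbf{0}$ and let $\Omega\subset M$ be an open subset endowed with a system of coordinates $\varphi=(x^1,\dots,x^n)$. Let $V$ be an $L$-admissible vector field on $\Omega$, and let $\Gamma^k_{\ ij}(V)$ be the Christoffel symbols of $\nabla^V$ defined by $\nabla^V_{\partial/\partial x^i}\frac{\partial}{\partial x^j}=\Gamma^k_{\ ij}(V)\frac{\partial}{\partial x^k}$. (1) For $x\in\Omega$, the values of the Christoffel symbols $\Gamma^k_{\ ij}(V)$ at $x$ depend only on $v=V(x)$ and not on the extension $V$ of $v$ (so they define functions $\Gamma^k_{\ ij}$ on $A\cap T\Omega$). Moreover, they coincide with the Christoffel symbols of the Chern connection of $L$, i.e. $$\Gamma^s_{\ ji}(v)=\gamma^s_{\ ji}(v)+g^{ks}(v)\left(-N^p_{\ i}C_{pjk}-N^p_{\ j}C_{pki}+N^p_{\ k}C_{pij}\right)(v),\qquad v\in A\cap T\Omega .$$ (2) Let $\gamma:[a,b]\to M$ be a smooth curve and let $W$ be an $L$-admissible vector field along $\gamma$. Then, for $X\in\mathfrak{X}(\gamma)$, the covariant derivative of $X$ along $\gamma$ with reference vector $W$ can be defined by the coordinate expression $$D^W_\gamma X=\frac{dX^i}{dt}\frac{\partial}{\partial x^i}+X^i(t)\dot\gamma^j(t)\Gamma^k_{\ ij}(W(t))\frac{\partial}{\partial x^k},$$ where $(X^1,\dots,X^n)$ and $(\dot\gamma^1,\dots,\dot\gamma^n)$ are the coordinates of $X$ and $\dot\gamma$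 in the coordinate basis of any system of coordinates; that is, this expression does not depend on the coordinates and determines a well-defined element of $\mathfrak{X}(\gamma)$. (3) The covariant derivative is almost $g$-compatible: for all $X,Y\in\mathfrak{X}(\gamma)$, $$\frac{d}{dt}g_W(X,Y)=g_W(D^W_\gamma X,Y)+g_W(X,D^W_\gamma Y)+2C_W(D^W_\gamma W,X,Y).$$
   Context: Let $M$ be a smooth $n$-manifold and $\pi:TM\to M$ its tangent bundle. An open subset $A\subset TM\setminus\mathbf{0}$ is conic if $\lambda v\in A$ for all $v\in A$, $\lambda>0$. A (two-homogeneous, conic) pseudo-Finsler metric is a smooth function $L:A\to\mathbb{R}$ with $L(\lambda v)=\lambda^2L(v)$ for all $v\in A$, $\lambda>0$, such that for every $v\in A$ the fundamental tensor $g_v(u,w)=\frac12\frac{\partial^2}{\partial t\,\partial s}L(v+tu+sw)|_{t=s=0}$, $u,w\in T_{\pi(v)}M$, is non-degenerate. $(M,L)$ is then called a pseudo-Finsler manifold. The Cartan tensor is $C_v(w_1,w_2,w_3)=\frac14\frac{\partial^3}{\partial s_3\partial s_2\partial s_1}L(v+\sum_{i=1}^3s_iw_i)|_{s_1=s_2=s_3=0}$. A vector field $V$ on an open set $\Omega\subset M$ is $L$-admissible if $V(x)\in A\cap T_xM$ for all $x\in\Omega$. For such $V$, $\nabla^V$ is the unique affine connection on $\Omega$ that is torsion-free and almost $g$-compatible, i.e. $\nabla^V_XY-\nabla^V_YX=[X,Y]$ and $X(g_V(Y,Z))=g_V(\nabla^V_XY,Z)+g_V(Y,\nabla^V_XZ)+2C_V(\nabla^V_XV,Y,Z)$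 for all $X,Y,Z\in\mathfrak{X}(\Omega)$. The Einstein summation convention is used. In coordinates $x^1,\dots,x^n$ on $\Omega$, with induced coordinates $x^1,\dots,x^n,y^1,\dots,y^n$ on $T\Omega$, the following functions on $A\cap T\Omega$ are defined: $g_{ij}(v)=g_v(\frac{\partial}{\partial x^i},\frac{\partial}{\partial x^j})$, with inverse matrix $(g^{ij})$; $C_{ijk}(v)=C_v(\frac{\partial}{\partial x^i},\frac{\partial}{\partial x^j},\frac{\partial}{\partial x^k})$; $\gamma_{ijk}=\frac12\left(\frac{\partial g_{ij}}{\partial x^k}-\frac{\partial g_{jk}}{\partial x^i}+\frac{\partial g_{ki}}{\partial x^j}\right)$ and $\gamma^s_{\ jk}=g^{si}\gamma_{ijk}$; and the coefficients of the nonlinear connection, $N^s_{\ j}=y^i\gamma^s_{\ ji}-y^ly^i\gamma^p_{\ li}g^{ks}C_{pjk}$. For a smooth curve $\gamma:[a,b]\to M$, $\mathfrak{X}(\gamma)$ is the set of smooth vector fields along $\gamma$ (smooth sections of $\gamma^*(TM)$); $W\in\mathfrak{X}(\gamma)$ is $L$-admissible if $W(t)\in A$ for all $t\in[a,b]$. *)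

theory Defs
  imports "HOL-Analysis.Analysis"
begin

section \<open>Smooth maps between subsets of normed spaces\<close>

text \<open>
  Derivatives are taken within \<open>S\<close>. For open \<open>S\<close> these are the usual ones; for
  a relatively open subset of a compact interval they are one-sided at the end points.
  In both cases derivatives within \<open>S\<close> are unique. The definition is not meant for other \<open>S\<close>.
\<close>

primrec Ck_on :: "nat \<Rightarrow> ('a::real_normed_vector \<Rightarrow> 'b::real_normed_vector) \<Rightarrow> 'a set \<Rightarrow> bool" where
  "Ck_on 0 f S \<longleftrightarrow> continuous_on S f"
| "Ck_on (Suc k) f S \<longleftrightarrow>
     f differentiable_on S \<and> (\<forall>h. Ck_on k (\<lambda>x. frechet_derivative f (at x within S) h) S)"

definition smooth_on :: "'a set \<Rightarrow> ('a::real_normed_vector \<Rightarrow> 'b::real_normed_vector) \<Rightarrow> bool" where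
  "smooth_on S f \<longleftrightarrow> (\<forall>k. Ck_on k f S)"


section \<open>Smooth manifolds\<close>

type_synonym ('m, 'n) chart = "'m set \<times> ('m \<Rightarrow> real ^ 'n)"

abbreviation cdom :: "('m, 'n) chart \<Rightarrow> 'm set" where
  "cdom c \<equiv> fst c"

abbreviation cmap :: "('m, 'n) chart \<Rightarrow> 'm \<Rightarrow> real ^ 'n" where
  "cmap c \<equiv> snd c"

abbreviation cinv :: "('m, 'n) chart \<Rightarrow> real ^ 'n \<Rightarrow> 'm" where
  "cinv c \<equiv> inv_into (cdom c) (cmap c)"

definition is_chart :: "('m::topological_space, 'n::finite) chart \<Rightarrow> bool" where
  "is_chart c \<longleftrightarrow> open (cdom c) \<and> open (cmap c ` cdom c) \<and>
     homeomorphism (cdom c) (cmap c ` cdom c) (cmap c) (cinv c)"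

definition compatible :: "('m, 'n::finite) chart \<Rightarrow> ('m, 'n) chart \<Rightarrow> bool" where
  "compatible c c' \<longleftrightarrow>
     smooth_on (cmap c ` (cdom c \<inter> cdom c')) (cmap c' \<circ> cinv c) \<and>
     smooth_on (cmap c' ` (cdom c \<inter> cdom c')) (cmap c \<circ> cinv c')"

text \<open>
  A smooth manifold is a Hausdorff second countable space, here the type \<open>'m\<close>,
  with a maximal smooth atlas. The members of the atlas are the systems of coordinates.
\<close>

definition smooth_manifold ::
  "('m::{t2_space, second_countable_topology}, 'n::finite) chart set \<Rightarrow> bool" where
  "smooth_manifold \<A> \<longleftrightarrow>
     (\<forall>c\<in>\<A>. is_chart c) \<and>
     (\<forall>c\<in>\<A>. \<forall>c'\<in>\<A>. compatible c c') \<and>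
     (\<Union>c\<in>\<A>. cdom c) = UNIV \<and>
     (\<forall>c. is_chart c \<and> (\<forall>c'\<in>\<A>. compatible c c') \<longrightarrow> c \<in> \<A>)"

definition smooth_functions ::
  "('m, 'n::finite) chart set \<Rightarrow> 'm set \<Rightarrow> ('m \<Rightarrow> real) set" where
  "smooth_functions \<A> \<Omega> =
     {f. \<forall>c\<in>\<A>. smooth_on (cmap c ` (cdom c \<inter> \<Omega>)) (\<lambda>x. f (cinv c x))}"


section \<open>The tangent bundle\<close>

text \<open>
  A tangent vector at \<open>p\<close> is given by its base point and by one component vector
  for each chart around \<open>p\<close>, related by the Jacobians of the coordinate changes.
  The components in all other charts are set to \<open>0\<close>, so that equality of tangent
  vectors is equality of pairs.
\<close>

type_synonym ('m, 'n) tvec = "'m \<times> (('m, 'n) chart \<Rightarrow> real ^ 'n)"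

abbreviation base :: "('m, 'n) tvec \<Rightarrow> 'm" where
  "base v \<equiv> fst v"

abbreviation vcomp :: "('m, 'n) chart \<Rightarrow> ('m, 'n) tvec \<Rightarrow> real ^ 'n" where
  "vcomp c v \<equiv> snd v c"

definition tangent_bundle :: "('m, 'n::finite) chart set \<Rightarrow> ('m, 'n) tvec set" where
  "tangent_bundle \<A> = {v.
     (\<forall>c\<in>\<A>. \<forall>c'\<in>\<A>. base v \<in> cdom c \<inter> cdom c' \<longrightarrow>
        vcomp c' v = frechet_derivative (cmap c' \<circ> cinv c) (at (cmap c (base v))) (vcomp c v)) \<and>
     (\<forall>c. \<not> (c \<in> \<A> \<and> base v \<in> cdom c) \<longrightarrow> vcomp c v = 0)}"

definition tangent_space :: "('m, 'n::finite) chart set \<Rightarrow> 'm \<Rightarrow> ('m, 'n) tvec set" where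
  "tangent_space \<A> p = {v \<in> tangent_bundle \<A>. base v = p}"

definition tzero :: "'m \<Rightarrow> ('m, 'n::finite) tvec" where
  "tzero p = (p, \<lambda>_. 0)"

text \<open>The linear operations of the fibres; the sum is meant for vectors with the same base point.\<close>

definition tadd :: "('m, 'n::finite) tvec \<Rightarrow> ('m, 'n) tvec \<Rightarrow> ('m, 'n) tvec"
  (infixl "+\<^sub>T" 65) where
  "v +\<^sub>T w = (base v, \<lambda>c. vcomp c v + vcomp c w)"

definition tscale :: "real \<Rightarrow> ('m, 'n::finite) tvec \<Rightarrow> ('m, 'n) tvec"
  (infixr "*\<^sub>T" 75) where
  "r *\<^sub>T v = (base v, \<lambda>c. r *\<^sub>R vcomp c v)"

text \<open>
  The tangent vector at \<open>p\<close> with components \<open>y\<close> in the chart \<open>c\<close>, where \<open>p\<close> is in its domain.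
\<close>

definition coord_vec ::
  "('m, 'n::finite) chart set \<Rightarrow> ('m, 'n) chart \<Rightarrow> 'm \<Rightarrow> real ^ 'n \<Rightarrow> ('m, 'n) tvec" where
  "coord_vec \<A> c p y = (p, \<lambda>c'. if c' \<in> \<A> \<and> p \<in> cdom c'
     then frechet_derivative (cmap c' \<circ> cinv c) (at (cmap c p)) y else 0)"

abbreviation coord_basis ::
  "('m, 'n::finite) chart set \<Rightarrow> ('m, 'n) chart \<Rightarrow> 'n \<Rightarrow> 'm \<Rightarrow> ('m, 'n) tvec" where
  "coord_basis \<A> c i p \<equiv> coord_vec \<A> c p (axis i 1)"

text \<open>Induced coordinates \<open>(x, y)\<close>, which define the topology and smooth structure of the bundle.\<close>

definition induced_coords :: "('m, 'n::finite) chart \<Rightarrow> ('m, 'n) tvec \<Rightarrow> (real ^ 'n) \<times> (real ^ 'n)" where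
  "induced_coords c v = (cmap c (base v), vcomp c v)"

definition tb_open :: "('m, 'n::finite) chart set \<Rightarrow> ('m, 'n) tvec set \<Rightarrow> bool" where
  "tb_open \<A> B \<longleftrightarrow> B \<subseteq> tangent_bundle \<A> \<and>
     (\<forall>c\<in>\<A>. open (induced_coords c ` {v \<in> B. base v \<in> cdom c}))"

definition tb_smooth_on ::
  "('m, 'n::finite) chart set \<Rightarrow> ('m, 'n) tvec set \<Rightarrow> (('m, 'n) tvec \<Rightarrow> real) \<Rightarrow> bool" where
  "tb_smooth_on \<A> B F \<longleftrightarrow>
     (\<forall>c\<in>\<A>. smooth_on (induced_coords c ` {v \<in> B. base v \<in> cdom c})
        (\<lambda>(x, y). F (coord_vec \<A> c (cinv c x) y)))"

text \<open>The derivative of \<open>f\<close> in the direction of \<open>v\<close>, whose value is the same in all charts.\<close>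

definition dir_deriv ::
  "('m, 'n::finite) chart set \<Rightarrow> ('m, 'n) tvec \<Rightarrow> ('m \<Rightarrow> real) \<Rightarrow> real" where
  "dir_deriv \<A> v f = (THE r. \<forall>c\<in>\<A>. base v \<in> cdom c \<longrightarrow>
     r = frechet_derivative (f \<circ> cinv c) (at (cmap c (base v))) (vcomp c v))"


section \<open>Vector fields and affine connections on open subsets\<close>

text \<open>Fields are undefined outside \<open>\<Omega>\<close>, so that equality on \<open>\<Omega>\<close> is equality.\<close>

definition vector_fields ::
  "('m, 'n::finite) chart set \<Rightarrow> 'm set \<Rightarrow> ('m \<Rightarrow> ('m, 'n) tvec) set" where
  "vector_fields \<A> \<Omega> = {X \<in> extensional \<Omega>.
     (\<forall>p\<in>\<Omega>. X p \<in> tangent_space \<A> p) \<and>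
     (\<forall>c\<in>\<A>. smooth_on (cmap c ` (cdom c \<inter> \<Omega>)) (\<lambda>x. vcomp c (X (cinv c x))))}"

definition lie_bracket ::
  "('m, 'n::finite) chart set \<Rightarrow> 'm set \<Rightarrow> ('m \<Rightarrow> ('m, 'n) tvec) \<Rightarrow> ('m \<Rightarrow> ('m, 'n) tvec)
     \<Rightarrow> ('m \<Rightarrow> ('m, 'n) tvec)" where
  "lie_bracket \<A> \<Omega> X Y = (THE Z. Z \<in> vector_fields \<A> \<Omega> \<and>
     (\<forall>f\<in>smooth_functions \<A> \<Omega>. \<forall>p\<in>\<Omega>.
        dir_deriv \<A> (Z p) f =
          dir_deriv \<A> (X p) (\<lambda>q. dir_deriv \<A> (Y q) f)
        - dir_deriv \<A> (Y p) (\<lambda>q. dir_deriv \<A> (X q) f)))"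

text \<open>
  Additivity in the last argument and the Leibniz rule (for constant \<open>f\<close>) give real linearity.
\<close>

definition affine_connection ::
  "('m, 'n::finite) chart set \<Rightarrow> 'm set \<Rightarrow>
     (('m \<Rightarrow> ('m, 'n) tvec) \<Rightarrow> ('m \<Rightarrow> ('m, 'n) tvec) \<Rightarrow> ('m \<Rightarrow> ('m, 'n) tvec)) \<Rightarrow> bool" where
  "affine_connection \<A> \<Omega> D \<longleftrightarrow>
     D \<in> vector_fields \<A> \<Omega> \<rightarrow>\<^sub>E vector_fields \<A> \<Omega> \<rightarrow>\<^sub>E vector_fields \<A> \<Omega> \<and>
     (\<forall>X\<in>vector_fields \<A> \<Omega>. \<forall>X'\<in>vector_fields \<A> \<Omega>. \<forall>Y\<in>vector_fields \<A> \<Omega>. \<forall>p\<in>\<Omega>.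
        D (\<lambda>q\<in>\<Omega>. X q +\<^sub>T X' q) Y p = D X Y p +\<^sub>T D X' Y p) \<and>
     (\<forall>f\<in>smooth_functions \<A> \<Omega>. \<forall>X\<in>vector_fields \<A> \<Omega>. \<forall>Y\<in>vector_fields \<A> \<Omega>. \<forall>p\<in>\<Omega>.
        D (\<lambda>q\<in>\<Omega>. f q *\<^sub>T X q) Y p = f p *\<^sub>T D X Y p) \<and>
     (\<forall>X\<in>vector_fields \<A> \<Omega>. \<forall>Y\<in>vector_fields \<A> \<Omega>. \<forall>Y'\<in>vector_fields \<A> \<Omega>. \<forall>p\<in>\<Omega>.
        D X (\<lambda>q\<in>\<Omega>. Y q +\<^sub>T Y' q) p = D X Y p +\<^sub>T D X Y' p) \<and>
     (\<forall>f\<in>smooth_functions \<A> \<Omega>. \<forall>X\<in>vector_fields \<A> \<Omega>. \<forall>Y\<in>vector_fields \<A> \<Omega>. \<forall>p\<in>\<Omega>.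
        D X (\<lambda>q\<in>\<Omega>. f q *\<^sub>T Y q) p = dir_deriv \<A> (X p) f *\<^sub>T Y p +\<^sub>T f p *\<^sub>T D X Y p)"


section \<open>Pseudo-Finsler metrics\<close>

text \<open>
  Only the values of \<open>L\<close> on its domain \<open>A\<close> matter: \<open>A\<close> is open, so the derivatives below
  at vectors of \<open>A\<close> are determined by them.
\<close>

definition fund_tensor ::
  "(('m, 'n::finite) tvec \<Rightarrow> real) \<Rightarrow> ('m, 'n) tvec \<Rightarrow> ('m, 'n) tvec \<Rightarrow> ('m, 'n) tvec \<Rightarrow> real" where
  "fund_tensor L v u w =
     1/2 * deriv (\<lambda>t. deriv (\<lambda>s. L (v +\<^sub>T t *\<^sub>T u +\<^sub>T s *\<^sub>T w)) 0) 0"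

definition cartan_tensor ::
  "(('m, 'n::finite) tvec \<Rightarrow> real) \<Rightarrow> ('m, 'n) tvec \<Rightarrow>
     ('m, 'n) tvec \<Rightarrow> ('m, 'n) tvec \<Rightarrow> ('m, 'n) tvec \<Rightarrow> real" where
  "cartan_tensor L v w1 w2 w3 =
     1/4 * deriv (\<lambda>s3. deriv (\<lambda>s2. deriv (\<lambda>s1.
       L (v +\<^sub>T s1 *\<^sub>T w1 +\<^sub>T s2 *\<^sub>T w2 +\<^sub>T s3 *\<^sub>T w3)) 0) 0) 0"

definition pseudo_finsler ::
  "('m::{t2_space, second_countable_topology}, 'n::finite) chart set \<Rightarrow> ('m, 'n) tvec set \<Rightarrow>
     (('m, 'n) tvec \<Rightarrow> real) \<Rightarrow> bool" where
  "pseudo_finsler \<A> A L \<longleftrightarrow>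
     smooth_manifold \<A> \<and>
     tb_open \<A> A \<and> A \<inter> range tzero = {} \<and>
     (\<forall>v\<in>A. \<forall>r>0. r *\<^sub>T v \<in> A) \<and>
     tb_smooth_on \<A> A L \<and>
     (\<forall>v\<in>A. \<forall>r>0. L (r *\<^sub>T v) = r\<^sup>2 * L v) \<and>
     (\<forall>v\<in>A. \<forall>u\<in>tangent_space \<A> (base v).
        (\<forall>w\<in>tangent_space \<A> (base v). fund_tensor L v u w = 0) \<longrightarrow> u = tzero (base v))"


section \<open>The connection of an admissible vector field\<close>

definition admissible_fields ::
  "('m, 'n::finite) chart set \<Rightarrow> ('m, 'n) tvec set \<Rightarrow> 'm set \<Rightarrow> ('m \<Rightarrow> ('m, 'n) tvec) set" where
  "admissible_fields \<A> A \<Omega> = {V \<in> vector_fields \<A> \<Omega>. \<forall>p\<in>\<Omega>. V p \<in> A}"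

definition torsion_free ::
  "('m, 'n::finite) chart set \<Rightarrow> 'm set \<Rightarrow>
     (('m \<Rightarrow> ('m, 'n) tvec) \<Rightarrow> ('m \<Rightarrow> ('m, 'n) tvec) \<Rightarrow> ('m \<Rightarrow> ('m, 'n) tvec)) \<Rightarrow> bool" where
  "torsion_free \<A> \<Omega> D \<longleftrightarrow>
     (\<forall>X\<in>vector_fields \<A> \<Omega>. \<forall>Y\<in>vector_fields \<A> \<Omega>. \<forall>p\<in>\<Omega>.
        D X Y p +\<^sub>T (-1) *\<^sub>T D Y X p = lie_bracket \<A> \<Omega> X Y p)"

definition almost_compatible ::
  "('m, 'n::finite) chart set \<Rightarrow> (('m, 'n) tvec \<Rightarrow> real) \<Rightarrow> 'm set \<Rightarrow> ('m \<Rightarrow> ('m, 'n) tvec) \<Rightarrow>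
     (('m \<Rightarrow> ('m, 'n) tvec) \<Rightarrow> ('m \<Rightarrow> ('m, 'n) tvec) \<Rightarrow> ('m \<Rightarrow> ('m, 'n) tvec)) \<Rightarrow> bool" where
  "almost_compatible \<A> L \<Omega> V D \<longleftrightarrow>
     (\<forall>X\<in>vector_fields \<A> \<Omega>. \<forall>Y\<in>vector_fields \<A> \<Omega>. \<forall>Z\<in>vector_fields \<A> \<Omega>. \<forall>p\<in>\<Omega>.
        dir_deriv \<A> (X p) (\<lambda>q. fund_tensor L (V q) (Y q) (Z q)) =
          fund_tensor L (V p) (D X Y p) (Z p) + fund_tensor L (V p) (Y p) (D X Z p)
          + 2 * cartan_tensor L (V p) (D X V p) (Y p) (Z p))"

definition nabla ::
  "('m, 'n::finite) chart set \<Rightarrow> (('m, 'n) tvec \<Rightarrow> real) \<Rightarrow> 'm set \<Rightarrow> ('m \<Rightarrow> ('m, 'n) tvec) \<Rightarrow>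
     ('m \<Rightarrow> ('m, 'n) tvec) \<Rightarrow> ('m \<Rightarrow> ('m, 'n) tvec) \<Rightarrow> ('m \<Rightarrow> ('m, 'n) tvec)" where
  "nabla \<A> L \<Omega> V = (THE D. affine_connection \<A> \<Omega> D \<and> torsion_free \<A> \<Omega> D \<and>
     almost_compatible \<A> L \<Omega> V D)"

text \<open>
  The Christoffel symbol with upper index \<open>k\<close> and lower indices \<open>i j\<close>, at the point \<open>p\<close>
  of \<open>\<Omega>\<close>, where \<open>\<Omega>\<close> is contained in the domain of the chart \<open>c\<close>.
\<close>

definition christoffel ::
  "('m, 'n::finite) chart set \<Rightarrow> (('m, 'n) tvec \<Rightarrow> real) \<Rightarrow> ('m, 'n) chart \<Rightarrow> 'm set \<Rightarrow>
     ('m \<Rightarrow> ('m, 'n) tvec) \<Rightarrow> 'n \<Rightarrow> 'n \<Rightarrow> 'n \<Rightarrow> 'm \<Rightarrow> real" where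
  "christoffel \<A> L c \<Omega> V k i j p =
     vcomp c (nabla \<A> L \<Omega> V (\<lambda>q\<in>\<Omega>. coord_basis \<A> c i q) (\<lambda>q\<in>\<Omega>. coord_basis \<A> c j q) p) $ k"

text \<open>
  The same symbol as a function of a vector \<open>v\<close>: the common value for all admissible local
  extensions of \<open>v\<close>. A vector of \<open>A\<close> need not extend to all of the chart domain.
\<close>

definition Gam ::
  "('m::topological_space, 'n::finite) chart set \<Rightarrow> ('m, 'n) tvec set \<Rightarrow>
     (('m, 'n) tvec \<Rightarrow> real) \<Rightarrow> ('m, 'n) chart \<Rightarrow> 'n \<Rightarrow> 'n \<Rightarrow> 'n \<Rightarrow> ('m, 'n) tvec \<Rightarrow> real" where
  "Gam \<A> A L c k i j v = (THE r. \<exists>\<Omega> V. open \<Omega> \<and> base v \<in> \<Omega> \<and> \<Omega> \<subseteq> cdom c \<and>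
     V \<in> admissible_fields \<A> A \<Omega> \<and> V (base v) = v \<and>
     r = christoffel \<A> L c \<Omega> V k i j (base v))"


section \<open>Coordinate expressions of the Chern connection\<close>

definition g_lo where
  "g_lo \<A> L c i j v =
     fund_tensor L v (coord_basis \<A> c i (base v)) (coord_basis \<A> c j (base v))"

definition g_up where
  "g_up \<A> L c i j v = matrix_inv (\<chi> i j. g_lo \<A> L c i j v) $ i $ j"

definition C_lo where
  "C_lo \<A> L c i j k v =
     cartan_tensor L v (coord_basis \<A> c i (base v)) (coord_basis \<A> c j (base v))
       (coord_basis \<A> c k (base v))"

text \<open>The partial derivative by \<open>x\<^sup>k\<close>, for functions of the induced coordinates \<open>(x, y)\<close>.\<close>

definition dx ::
  "('m, 'n::finite) chart set \<Rightarrow> ('m, 'n) chart \<Rightarrow> 'n \<Rightarrow> (('m, 'n) tvec \<Rightarrow> real) \<Rightarrow>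
     ('m, 'n) tvec \<Rightarrow> real" where
  "dx \<A> c k F v =
     deriv (\<lambda>t. F (coord_vec \<A> c (cinv c (cmap c (base v) + t *\<^sub>R axis k 1)) (vcomp c v))) 0"

definition gamma_lo where
  "gamma_lo \<A> L c i j k v =
     1/2 * (dx \<A> c k (g_lo \<A> L c i j) v - dx \<A> c i (g_lo \<A> L c j k) v
            + dx \<A> c j (g_lo \<A> L c k i) v)"

definition gamma_up where
  "gamma_up \<A> L c s j k v = (\<Sum>i\<in>UNIV. g_up \<A> L c s i v * gamma_lo \<A> L c i j k v)"

definition N_up where
  "N_up \<A> L c s j v =
     (\<Sum>i\<in>UNIV. vcomp c v $ i * gamma_up \<A> L c s j i v)
     - (\<Sum>l\<in>UNIV. \<Sum>i\<in>UNIV. \<Sum>p\<in>UNIV. \<Sum>k\<in>UNIV.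
          vcomp c v $ l * vcomp c v $ i * gamma_up \<A> L c p l i v * g_up \<A> L c k s v
          * C_lo \<A> L c p j k v)"

definition chern_christoffel ::
  "('m, 'n::finite) chart set \<Rightarrow> (('m, 'n) tvec \<Rightarrow> real) \<Rightarrow> ('m, 'n) chart \<Rightarrow>
     'n \<Rightarrow> 'n \<Rightarrow> 'n \<Rightarrow> ('m, 'n) tvec \<Rightarrow> real" where
  "chern_christoffel \<A> L c s j i v =
     gamma_up \<A> L c s j i v
     + (\<Sum>k\<in>UNIV. g_up \<A> L c k s v * (\<Sum>p\<in>UNIV.
          - (N_up \<A> L c p i v * C_lo \<A> L c p j k v)
          - N_up \<A> L c p j v * C_lo \<A> L c p k i v
          + N_up \<A> L c p k v * C_lo \<A> L c p i j v))"


section \<open>Vector fields along a curve and their covariant derivative\<close>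

definition smooth_curve ::
  "('m::topological_space, 'n::finite) chart set \<Rightarrow> real \<Rightarrow> real \<Rightarrow> (real \<Rightarrow> 'm) \<Rightarrow> bool" where
  "smooth_curve \<A> a b \<gamma> \<longleftrightarrow> continuous_on {a..b} \<gamma> \<and>
     (\<forall>c\<in>\<A>. smooth_on {t\<in>{a..b}. \<gamma> t \<in> cdom c} (\<lambda>t. cmap c (\<gamma> t)))"

definition fields_along ::
  "('m, 'n::finite) chart set \<Rightarrow> real \<Rightarrow> real \<Rightarrow> (real \<Rightarrow> 'm) \<Rightarrow> (real \<Rightarrow> ('m, 'n) tvec) set" where
  "fields_along \<A> a b \<gamma> = {X \<in> extensional {a..b}.
     (\<forall>t\<in>{a..b}. X t \<in> tangent_space \<A> (\<gamma> t)) \<and>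
     (\<forall>c\<in>\<A>. smooth_on {t\<in>{a..b}. \<gamma> t \<in> cdom c} (\<lambda>t. vcomp c (X t)))}"

definition velocity ::
  "('m, 'n::finite) chart set \<Rightarrow> real \<Rightarrow> real \<Rightarrow> (real \<Rightarrow> 'm) \<Rightarrow> real \<Rightarrow> ('m, 'n) tvec" where
  "velocity \<A> a b \<gamma> t = (\<gamma> t, \<lambda>c. if c \<in> \<A> \<and> \<gamma> t \<in> cdom c
     then vector_derivative (\<lambda>s. cmap c (\<gamma> s)) (at t within {a..b}) else 0)"

definition cov_expr ::
  "('m::topological_space, 'n::finite) chart set \<Rightarrow> ('m, 'n) tvec set \<Rightarrow>
     (('m, 'n) tvec \<Rightarrow> real) \<Rightarrow> real \<Rightarrow> real \<Rightarrow> (real \<Rightarrow> 'm) \<Rightarrow> (real \<Rightarrow> ('m, 'n) tvec) \<Rightarrow>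
     (real \<Rightarrow> ('m, 'n) tvec) \<Rightarrow> ('m, 'n) chart \<Rightarrow> real \<Rightarrow> ('m, 'n) tvec" where
  "cov_expr \<A> A L a b \<gamma> W X c t = coord_vec \<A> c (\<gamma> t)
     (\<chi> k. vector_derivative (\<lambda>s. vcomp c (X s)) (at t within {a..b}) $ k
       + (\<Sum>i\<in>UNIV. \<Sum>j\<in>UNIV.
            vcomp c (X t) $ i * vcomp c (velocity \<A> a b \<gamma> t) $ j * Gam \<A> A L c k i j (W t)))"

definition is_cov_deriv ::
  "('m::topological_space, 'n::finite) chart set \<Rightarrow> ('m, 'n) tvec set \<Rightarrow>
     (('m, 'n) tvec \<Rightarrow> real) \<Rightarrow> real \<Rightarrow> real \<Rightarrow> (real \<Rightarrow> 'm) \<Rightarrow> (real \<Rightarrow> ('m, 'n) tvec) \<Rightarrow>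
     (real \<Rightarrow> ('m, 'n) tvec) \<Rightarrow> (real \<Rightarrow> ('m, 'n) tvec) \<Rightarrow> bool" where
  "is_cov_deriv \<A> A L a b \<gamma> W X D \<longleftrightarrow> D \<in> fields_along \<A> a b \<gamma> \<and>
     (\<forall>c\<in>\<A>. \<forall>t\<in>{a..b}. \<gamma> t \<in> cdom c \<longrightarrow> D t = cov_expr \<A> A L a b \<gamma> W X c t)"

definition cov_deriv ::
  "('m::topological_space, 'n::finite) chart set \<Rightarrow> ('m, 'n) tvec set \<Rightarrow>
     (('m, 'n) tvec \<Rightarrow> real) \<Rightarrow> real \<Rightarrow> real \<Rightarrow> (real \<Rightarrow> 'm) \<Rightarrow> (real \<Rightarrow> ('m, 'n) tvec) \<Rightarrow>
     (real \<Rightarrow> ('m, 'n) tvec) \<Rightarrow> (real \<Rightarrow> ('m, 'n) tvec)" where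
  "cov_deriv \<A> A L a b \<gamma> W X = (THE D. is_cov_deriv \<A> A L a b \<gamma> W X D)"

end

theory Submission
  imports Defs
begin

text \<open>
  In a chart, almost compatibility reads
  \<open>d u w z = g (\<Gamma> u w) z + g w (\<Gamma> u z) + 2 C w z (\<Gamma> u y)\<close> with \<open>\<Gamma>\<close> symmetric, where \<open>d u\<close> is the
  derivative of the fundamental tensor in the base direction \<open>u\<close> at the vector with components \<open>y\<close>:
  the derivatives of the extension \<open>V\<close> cancel. As \<open>C\<close> vanishes on \<open>y\<close> by homogeneity, the Koszul
  trick solves this equation uniquely, first for \<open>\<Gamma> y y\<close>, then for the nonlinear connection
  \<open>\<Gamma> u y\<close>, then for \<open>\<Gamma>\<close>, and the solution is the Chern formula. The connection is therefore
  \<open>D Y (X) + \<Gamma> X Y\<close> on any patch inside a chart domain, where the coordinate fields make bump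
  functions unnecessary. Comparing its expressions in two charts gives the transformation law of
  \<open>\<Gamma>\<close>, hence the covariant derivative along curves, and its compatibility is the same computation
  of the derivative of \<open>g\<close> along a map into the bundle that is used for the connection.
\<close>

section \<open>Calculus of smooth maps\<close>

text \<open>The metric may be indefinite, so uniqueness can rest on nondegeneracy only, never on
  positivity. Solving the equation for \<open>\<Gamma>\<close> is also not enough for existence: a
  connection has to produce smooth fields. Smoothness is read off the index formulas, which are
  polynomial in derivatives of \<open>L\<close>, fibre coordinates and entries of the inverse
  metric, the latter being smooth by Cramer's rule. The notions \<open>dir_deriv\<close>,
  \<open>lie_bracket\<close>, \<open>nabla\<close>, \<open>Gam\<close> and \<open>cov_deriv\<close>
  are definite descriptions, so each needs existence and uniqueness of its value before anything can
  be computed with it. Curves bring one-sided derivatives at end points. The calculus is therefore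
  developed on sets where derivatives within the set are unique: \<open>unique_deriv\<close> is the
  usual sufficient condition, approach along every basis direction. Open sets and relatively open
  subsets of an interval satisfy it, so fields on patches and fields along curves share their
  lemmas.\<close>

definition unique_deriv :: "'a::euclidean_space set \<Rightarrow> bool" where
  "unique_deriv S \<longleftrightarrow>
     (\<forall>x\<in>S. \<forall>i\<in>Basis. \<forall>e>0. \<exists>d. 0 < \<bar>d\<bar> \<and> \<bar>d\<bar> < e \<and> x + d *\<^sub>R i \<in> S)"

lemma unique_deriv_open: "open S \<Longrightarrow> unique_deriv S"
  unfolding unique_deriv_def
proof (intro ballI allI impI)
  fix x i :: 'a and e :: real
  assume "open S" "x \<in> S" "i \<in> Basis" "0 < e"
  then obtain r where r: "0 < r" "ball x r \<subseteq> S"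
    by (meson openE)
  have "x + (min e r / 2) *\<^sub>R i \<in> S"
    using r \<open>0 < e\<close> \<open>i \<in> Basis\<close> by (auto simp: subset_iff dist_norm)
  then show "\<exists>d. 0 < \<bar>d\<bar> \<and> \<bar>d\<bar> < e \<and> x + d *\<^sub>R i \<in> S"
    using r \<open>0 < e\<close> by (intro exI[of _ "min e r / 2"]) auto
qed

text \<open>In dimension one it is enough to approach a point from a single side, and a
  nondegenerate interval always offers one.\<close>

lemma unique_deriv_interval:
  assumes "a < b" "openin (top_of_set {a..b}) (S :: real set)"
  shows "unique_deriv S"
  unfolding unique_deriv_def
proof (intro ballI allI impI)
  fix x i e :: real
  assume "x \<in> S" "i \<in> Basis" "0 < e"
  obtain U where U: "open U" "S = {a..b} \<inter> U"
    using assms(2) by (auto simp: openin_open)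
  then obtain r where r: "0 < r" "ball x r \<subseteq> U"
    using \<open>x \<in> S\<close> by (meson IntD2 openE)
  define m where "m = min (min e r) (b - a) / 2"
  have m: "0 < m" "m < e" "m < r" "m < b - a" "2 * m \<le> b - a"
    using r \<open>0 < e\<close> assms(1) by (auto simp: m_def)
  have x: "a \<le> x" "x \<le> b"
    using U \<open>x \<in> S\<close> by auto
  \<comment> \<open>Since \<open>2 * m \<le> b - a\<close>, at least one of the two steps of length
    \<open>m\<close> from \<open>x\<close> stays inside the interval.\<close>
  define d where "d = (if x + m \<le> b then m else - m)"
  have "\<bar>d\<bar> = m" "a \<le> x + d" "x + d \<le> b"
    using m x by (auto simp: d_def)
  moreover have "x + d \<in> U"
    using r m \<open>\<bar>d\<bar> = m\<close> by (auto simp: subset_iff dist_norm)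
  ultimately show "\<exists>d. 0 < \<bar>d\<bar> \<and> \<bar>d\<bar> < e \<and> x + d *\<^sub>R i \<in> S"
    using m U \<open>i \<in> Basis\<close> by (intro exI[of _ d]) auto
qed

lemma frechet_derivative_eqI:
  assumes "unique_deriv S" "x \<in> S" "(f has_derivative f') (at x within S)"
  shows "frechet_derivative f (at x within S) = f'"
proof -
  have "(f has_derivative frechet_derivative f (at x within S)) (at x within S)"
    using assms(3) by (meson differentiableI frechet_derivative_works)
  then show ?thesis
    using frechet_derivative_unique_within[OF _ assms(3)] assms(1,2)
    unfolding unique_deriv_def by blast
qed

text \<open>\<open>frechet_derivative\<close> is a choice from a predicate, and the predicates of
  \<open>f\<close> and \<open>g\<close> coincide.\<close>

lemma frechet_derivative_within_cong:
  assumes "x \<in> S" "\<And>y. y \<in> S \<Longrightarrow> f y = g y"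
  shows "frechet_derivative f (at x within S) = frechet_derivative g (at x within S)"
proof -
  have "(f has_derivative D) (at x within S) \<longleftrightarrow> (g has_derivative D) (at x within S)" for D
    using assms has_derivative_transform by metis
  then show ?thesis
    by (simp add: frechet_derivative_def)
qed

lemma differentiable_on_cong:
  "(\<And>x. x \<in> S \<Longrightarrow> f x = g x) \<Longrightarrow> f differentiable_on S \<longleftrightarrow> g differentiable_on S"
  unfolding differentiable_on_def differentiable_def
  using has_derivative_transform by metis

lemma Ck_on_cong:
  "(\<And>x. x \<in> S \<Longrightarrow> f x = g x) \<Longrightarrow> Ck_on k f S \<longleftrightarrow> Ck_on k g S"
proof (induction k arbitrary: f g)
  case 0
  then show ?case by simp
next
  case (Suc k)
  have "f differentiable_on S \<longleftrightarrow> g differentiable_on S"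
    using Suc.prems by (rule differentiable_on_cong)
  moreover have "Ck_on k (\<lambda>x. frechet_derivative f (at x within S) h) S \<longleftrightarrow>
      Ck_on k (\<lambda>x. frechet_derivative g (at x within S) h) S" for h
    by (rule Suc.IH, rule fun_cong[OF frechet_derivative_within_cong]) (use Suc.prems in auto)
  ultimately show ?case by simp
qed

lemma smooth_on_cong:
  "(\<And>x. x \<in> S \<Longrightarrow> f x = g x) \<Longrightarrow> smooth_on S f \<longleftrightarrow> smooth_on S g"
  unfolding smooth_on_def using Ck_on_cong[of S f g] by blast

lemma smooth_on_eq:
  "smooth_on S g \<Longrightarrow> (\<And>x. x \<in> S \<Longrightarrow> f x = g x) \<Longrightarrow> smooth_on S f"
  using smooth_on_cong[of S f g] by blast

lemma Ck_on_SucD: "Ck_on (Suc k) f S \<Longrightarrow> Ck_on k f S"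
  by (induction k arbitrary: f) (auto simp: differentiable_imp_continuous_on)

text \<open>The induction step of the closure lemmas: uniqueness of derivatives within
  \<open>S\<close> allows an explicit derivative in place of the one chosen by
  \<open>frechet_derivative\<close>.\<close>

lemma Ck_on_SucI:
  assumes "unique_deriv S" "\<And>x. x \<in> S \<Longrightarrow> (f has_derivative f' x) (at x within S)"
    "\<And>h. Ck_on k (\<lambda>x. f' x h) S"
  shows "Ck_on (Suc k) f S"
proof -
  have "Ck_on k (\<lambda>x. frechet_derivative f (at x within S) h) S" for h
    using assms(3)[of h] Ck_on_cong[of S "\<lambda>x. frechet_derivative f (at x within S) h" "\<lambda>x. f' x h"]
      frechet_derivative_eqI[OF assms(1) _ assms(2)] by simp
  moreover have "f differentiable_on S"
    using assms(2) unfolding differentiable_on_def differentiable_def by blast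
  ultimately show ?thesis by simp
qed

lemma Ck_on_has_derivative:
  "Ck_on (Suc k) f S \<Longrightarrow> x \<in> S \<Longrightarrow>
     (f has_derivative frechet_derivative f (at x within S)) (at x within S)"
  by (simp add: differentiable_on_def frechet_derivative_works)

lemma Ck_on_const: "unique_deriv S \<Longrightarrow> Ck_on k (\<lambda>x. c) S"
proof (induction k arbitrary: c)
  case (Suc k)
  show ?case
    by (rule Ck_on_SucI[OF Suc.prems, where f' = "\<lambda>_ _. 0"]) (auto intro: Suc)
qed simp

lemma Ck_on_linear:
  assumes "unique_deriv S" "bounded_linear f"
  shows "Ck_on k f S"
proof (cases k)
  case 0
  then show ?thesis using assms by (simp add: linear_continuous_on)
next
  case (Suc j)
  show ?thesis unfolding Suc
    by (rule Ck_on_SucI[OF assms(1), where f' = "\<lambda>_. f"])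
      (auto intro: assms bounded_linear_imp_has_derivative Ck_on_const)
qed

section \<open>Closure of finite differentiability under algebra and composition\<close>

lemma Ck_on_add:
  "unique_deriv S \<Longrightarrow> Ck_on k f S \<Longrightarrow> Ck_on k g S \<Longrightarrow> Ck_on k (\<lambda>x. f x + g x) S"
proof (induction k arbitrary: f g)
  case 0
  then show ?case by (auto intro: continuous_intros)
next
  case (Suc k)
  show ?case
    by (rule Ck_on_SucI[OF Suc.prems(1)],
        rule has_derivative_add[OF Ck_on_has_derivative[OF Suc.prems(2)] Ck_on_has_derivative[OF Suc.prems(3)]])
      (use Suc in auto)
qed

lemma Ck_on_scaleR:
  "unique_deriv S \<Longrightarrow> Ck_on k f S \<Longrightarrow> Ck_on k g S \<Longrightarrow> Ck_on k (\<lambda>x. f x *\<^sub>R g x) S"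
proof (induction k arbitrary: f g)
  case 0
  then show ?case by (auto intro: continuous_intros)
next
  case (Suc k)
  show ?case
    by (rule Ck_on_SucI[OF Suc.prems(1)],
        rule has_derivative_scaleR[OF Ck_on_has_derivative[OF Suc.prems(2)] Ck_on_has_derivative[OF Suc.prems(3)]])
      (use Suc Ck_on_SucD[OF Suc.prems(2)] Ck_on_SucD[OF Suc.prems(3)] in \<open>auto intro!: Ck_on_add\<close>)
qed

lemma Ck_on_sum:
  "unique_deriv S \<Longrightarrow> (\<And>i. i \<in> I \<Longrightarrow> Ck_on k (f i) S) \<Longrightarrow> Ck_on k (\<lambda>x. \<Sum>i\<in>I. f i x) S"
  by (induction I rule: infinite_finite_induct) (auto intro: Ck_on_const Ck_on_add)

lemma Ck_on_bounded_linear: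
  assumes "unique_deriv S" "bounded_linear g"
  shows "Ck_on k f S \<Longrightarrow> Ck_on k (\<lambda>x. g (f x)) S"
proof (induction k arbitrary: f)
  case 0
  then show ?case
    using bounded_linear.continuous_on[OF assms(2)] by simp
next
  case (Suc k)
  show ?case
  proof (rule Ck_on_SucI[OF assms(1)])
    show "((\<lambda>x. g (f x)) has_derivative (\<lambda>h. g (frechet_derivative f (at x within S) h)))
        (at x within S)" if "x \<in> S" for x
      by (rule bounded_linear.has_derivative[OF assms(2) Ck_on_has_derivative[OF Suc.prems that]])
    show "Ck_on k (\<lambda>x. g (frechet_derivative f (at x within S) h)) S" for h
      using Suc.prems by (intro Suc.IH) simp
  qed
qed

lemma linear_basis_expansion:
  fixes f :: "'a::euclidean_space \<Rightarrow> 'b::real_vector"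
  assumes "linear f"
  shows "f v = (\<Sum>b\<in>Basis. (v \<bullet> b) *\<^sub>R f b)"
proof -
  have "f v = f (\<Sum>b\<in>Basis. (v \<bullet> b) *\<^sub>R b)"
    by (simp add: euclidean_representation)
  also have "\<dots> = (\<Sum>b\<in>Basis. (v \<bullet> b) *\<^sub>R f b)"
    by (simp add: linear_sum[OF assms] linear_scale[OF assms])
  finally show ?thesis .
qed

text \<open>The outer derivative is expanded in a basis, so that every factor is a map of the same kind
  and the induction on \<open>k\<close> applies.\<close>

lemma Ck_on_compose:
  fixes f :: "'a::euclidean_space \<Rightarrow> 'b::euclidean_space"
  assumes "unique_deriv S" "open T" "f ` S \<subseteq> T" "Ck_on k f S" "Ck_on k g T"
  shows "Ck_on k (\<lambda>x. g (f x)) S"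
  using assms(4,5)
proof (induction k arbitrary: g)
  case 0
  then show ?case
    using assms(3) by (auto intro: continuous_on_compose2)
next
  case (Suc k)
  let ?D = "\<lambda>x. frechet_derivative f (at x within S)"
  let ?E = "\<lambda>y. frechet_derivative g (at y within T)"
  show ?case
  proof (rule Ck_on_SucI[OF assms(1)])
    fix x assume x: "x \<in> S"
    have f': "(f has_derivative ?D x) (at x within S)"
      by (rule Ck_on_has_derivative[OF Suc.prems(1) x])
    have y: "f x \<in> T" using assms(3) x by blast
    have g': "(g has_derivative ?E (f x)) (at (f x) within T)"
      by (rule Ck_on_has_derivative[OF Suc.prems(2) y])
    then have g'': "(g has_derivative ?E (f x)) (at (f x) within f ` S)"
      using assms(3) has_derivative_subset by blast
    have lin: "linear (?E (f x))"
      using g' has_derivative_linear by blast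
    have E: "?E (f x) (?D x h) = (\<Sum>b\<in>Basis. (?D x h \<bullet> b) *\<^sub>R ?E (f x) b)" for h
      by (rule linear_basis_expansion[OF lin])
    show "((\<lambda>x. g (f x)) has_derivative
        (\<lambda>h. \<Sum>b\<in>Basis. (?D x h \<bullet> b) *\<^sub>R ?E (f x) b)) (at x within S)"
      using diff_chain_within[OF f' g''] unfolding o_def E .
  next
    fix h
    have "Ck_on k (\<lambda>x. ?E (f x) b) S" for b
      using Suc.prems by (intro Suc.IH) (auto intro: Ck_on_SucD)
    then show "Ck_on k (\<lambda>x. \<Sum>b\<in>Basis. (?D x h \<bullet> b) *\<^sub>R ?E (f x) b) S"
      using Suc.prems by (auto intro!: Ck_on_sum Ck_on_scaleR Ck_on_bounded_linear[OF assms(1) bounded_linear_inner_left] assms(1))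
  qed
qed

lemma Ck_on_subset:
  assumes "unique_deriv T" "T \<subseteq> S" "Ck_on k f S"
  shows "Ck_on k f T"
  using assms(3)
proof (induction k arbitrary: f)
  case 0
  then show ?case using continuous_on_subset[OF _ assms(2)] by simp
next
  case (Suc k)
  show ?case
    using Suc assms(2)
    by (intro Ck_on_SucI[OF assms(1), where f' = "\<lambda>x. frechet_derivative f (at x within S)"]
        has_derivative_subset[OF Ck_on_has_derivative[OF Suc.prems]]) auto
qed

section \<open>Smooth maps\<close>

lemma smooth_on_subset:
  "unique_deriv T \<Longrightarrow> T \<subseteq> S \<Longrightarrow> smooth_on S f \<Longrightarrow> smooth_on T f"
  unfolding smooth_on_def using Ck_on_subset by blast

lemma smooth_on_const [simp]: "unique_deriv S \<Longrightarrow> smooth_on S (\<lambda>x. c)"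
  by (simp add: smooth_on_def Ck_on_const)

lemma smooth_on_linear: "unique_deriv S \<Longrightarrow> bounded_linear f \<Longrightarrow> smooth_on S f"
  by (simp add: smooth_on_def Ck_on_linear)

lemma smooth_on_add:
  "unique_deriv S \<Longrightarrow> smooth_on S f \<Longrightarrow> smooth_on S g \<Longrightarrow> smooth_on S (\<lambda>x. f x + g x)"
  by (simp add: smooth_on_def Ck_on_add)

lemma smooth_on_scaleR:
  "unique_deriv S \<Longrightarrow> smooth_on S f \<Longrightarrow> smooth_on S g \<Longrightarrow> smooth_on S (\<lambda>x. f x *\<^sub>R g x)"
  by (simp add: smooth_on_def Ck_on_scaleR)

lemma smooth_on_mult:
  fixes f g :: "_ \<Rightarrow> real"
  shows "unique_deriv S \<Longrightarrow> smooth_on S f \<Longrightarrow> smooth_on S g \<Longrightarrow> smooth_on S (\<lambda>x. f x * g x)"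
  using smooth_on_scaleR[of S f g] by simp

lemma smooth_on_minus:
  "unique_deriv S \<Longrightarrow> smooth_on S f \<Longrightarrow> smooth_on S (\<lambda>x. - f x)"
  using smooth_on_scaleR[of S "\<lambda>_. -1" f] by simp

lemma smooth_on_diff:
  "unique_deriv S \<Longrightarrow> smooth_on S f \<Longrightarrow> smooth_on S g \<Longrightarrow> smooth_on S (\<lambda>x. f x - g x)"
  using smooth_on_add[of S f "\<lambda>x. - g x"] smooth_on_minus[of S g] by simp

lemma smooth_on_sum:
  "unique_deriv S \<Longrightarrow> (\<And>i. i \<in> I \<Longrightarrow> smooth_on S (f i)) \<Longrightarrow> smooth_on S (\<lambda>x. \<Sum>i\<in>I. f i x)"
  by (simp add: smooth_on_def Ck_on_sum)

lemma smooth_on_prod: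
  fixes f :: "_ \<Rightarrow> _ \<Rightarrow> real"
  shows "unique_deriv S \<Longrightarrow> (\<And>i. i \<in> I \<Longrightarrow> smooth_on S (f i)) \<Longrightarrow> smooth_on S (\<lambda>x. \<Prod>i\<in>I. f i x)"
  by (induction I rule: infinite_finite_induct) (auto intro: smooth_on_mult)

lemma smooth_on_compose:
  fixes f :: "'a::euclidean_space \<Rightarrow> 'b::euclidean_space"
  assumes "unique_deriv S" "open T" "f ` S \<subseteq> T" "smooth_on S f" "smooth_on T g"
  shows "smooth_on S (\<lambda>x. g (f x))"
  using assms Ck_on_compose unfolding smooth_on_def by blast

lemma smooth_on_compose_linear:
  fixes f :: "'a::euclidean_space \<Rightarrow> 'b::euclidean_space"
  assumes "unique_deriv S" "smooth_on S f" "bounded_linear g"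
  shows "smooth_on S (\<lambda>x. g (f x))"
  by (rule smooth_on_compose[OF assms(1) open_UNIV _ assms(2)])
    (auto intro: smooth_on_linear unique_deriv_open assms)

lemma smooth_on_vec_nth:
  "unique_deriv S \<Longrightarrow> smooth_on S f \<Longrightarrow> smooth_on S (\<lambda>x. f x $ i :: real)"
  by (rule smooth_on_compose_linear[where g = "\<lambda>u. u $ i"]) (auto intro: bounded_linear_vec_nth)

lemma smooth_on_componentwise:
  fixes f :: "'a::euclidean_space \<Rightarrow> 'b::euclidean_space"
  assumes "unique_deriv S" "\<And>b. b \<in> Basis \<Longrightarrow> smooth_on S (\<lambda>x. f x \<bullet> b)"
  shows "smooth_on S f"
proof -
  have "smooth_on S (\<lambda>x. \<Sum>b\<in>Basis. (f x \<bullet> b) *\<^sub>R b)"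
    using assms by (intro smooth_on_sum smooth_on_scaleR) auto
  then show ?thesis by (simp add: euclidean_representation)
qed

lemma smooth_on_vecI:
  fixes f :: "'a::euclidean_space \<Rightarrow> real ^ 'n"
  assumes "unique_deriv S" "\<And>i. smooth_on S (\<lambda>x. f x $ i)"
  shows "smooth_on S f"
  by (rule smooth_on_componentwise[OF assms(1)]) (use assms(2) in \<open>auto simp: Basis_vec_def inner_axis\<close>)

lemma smooth_on_Pair:
  fixes f :: "'a::euclidean_space \<Rightarrow> 'b::euclidean_space" and g :: "'a \<Rightarrow> 'c::euclidean_space"
  assumes "unique_deriv S" "smooth_on S f" "smooth_on S g"
  shows "smooth_on S (\<lambda>x. (f x, g x))"
proof -
  have "smooth_on S (\<lambda>x. (f x, 0 :: 'c))"
    by (rule smooth_on_compose_linear[OF assms(1,2)])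
      (intro bounded_linear_Pair bounded_linear_ident bounded_linear_zero)
  moreover have "smooth_on S (\<lambda>x. (0 :: 'b, g x))"
    by (rule smooth_on_compose_linear[OF assms(1,3)])
      (intro bounded_linear_Pair bounded_linear_ident bounded_linear_zero)
  ultimately have "smooth_on S (\<lambda>x. (f x, 0) + (0, g x))"
    by (rule smooth_on_add[OF assms(1)])
  then show ?thesis by simp
qed

lemma smooth_on_differentiable: "smooth_on S f \<Longrightarrow> f differentiable_on S"
  unfolding smooth_on_def using Ck_on.simps(2) by blast

lemma smooth_on_has_derivative_within:
  "smooth_on S f \<Longrightarrow> x \<in> S \<Longrightarrow>
     (f has_derivative frechet_derivative f (at x within S)) (at x within S)"
  using Ck_on_has_derivative smooth_on_def by blast

lemma smooth_on_has_derivative: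
  "smooth_on S f \<Longrightarrow> open S \<Longrightarrow> x \<in> S \<Longrightarrow>
     (f has_derivative frechet_derivative f (at x)) (at x)"
  using smooth_on_has_derivative_within by (metis at_within_open)

lemma smooth_on_continuous: "smooth_on S f \<Longrightarrow> continuous_on S f"
  by (simp add: differentiable_imp_continuous_on smooth_on_differentiable)

lemma smooth_on_deriv_within:
  "smooth_on S f \<Longrightarrow> smooth_on S (\<lambda>x. frechet_derivative f (at x within S) h)"
  unfolding smooth_on_def using Ck_on.simps(2) by blast

lemma smooth_on_deriv:
  assumes "smooth_on S f" "open S"
  shows "smooth_on S (\<lambda>x. frechet_derivative f (at x) h)"
  by (rule smooth_on_eq[OF smooth_on_deriv_within[OF assms(1), of h]])
    (simp add: at_within_open_NO_MATCH assms(2))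

text \<open>Point and direction both move. Expanding the direction in the basis leaves derivatives
  in fixed directions, which are smooth, with smooth coefficients.\<close>

lemma smooth_on_deriv_field:
  fixes f :: "'a::euclidean_space \<Rightarrow> 'b::euclidean_space"
  assumes "smooth_on S f" "open S" "unique_deriv R" "w ` R \<subseteq> S" "smooth_on R w" "smooth_on R h"
  shows "smooth_on R (\<lambda>x. frechet_derivative f (at (w x)) (h x))"
proof (rule smooth_on_eq)
  show "frechet_derivative f (at (w x)) (h x) =
      (\<Sum>b\<in>Basis. (h x \<bullet> b) *\<^sub>R frechet_derivative f (at (w x)) b)" if "x \<in> R" for x
  proof -
    have "linear (frechet_derivative f (at (w x)))"
      using smooth_on_has_derivative[OF assms(1,2)] assms(4) that has_derivative_linear by blast
    then show ?thesis
      by (rule linear_basis_expansion)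
  qed
  have "smooth_on R (\<lambda>x. h x \<bullet> b)" for b
    by (rule smooth_on_compose_linear[OF assms(3,6) bounded_linear_inner_left])
  moreover have "smooth_on R (\<lambda>x. frechet_derivative f (at (w x)) b)" for b
    by (rule smooth_on_compose[OF assms(3,2,4,5) smooth_on_deriv[OF assms(1,2)]])
  ultimately show "smooth_on R (\<lambda>x. \<Sum>b\<in>Basis. (h x \<bullet> b) *\<^sub>R frechet_derivative f (at (w x)) b)"
    by (intro smooth_on_sum smooth_on_scaleR assms(3))
qed

text \<open>The derivative of inversion is built from inversion itself, so the product rule closes
  the induction.\<close>

lemma Ck_on_inverse: "Ck_on k (inverse :: real \<Rightarrow> real) (- {0})"
proof (induction k)
  case 0
  show ?case by (auto intro: continuous_intros)
next
  case (Suc k)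
  have u: "unique_deriv (- {0 :: real})"
    by (auto intro: unique_deriv_open)
  show ?case
  proof (rule Ck_on_SucI[OF u])
    show "(inverse has_derivative (\<lambda>h. (- (inverse x * inverse x)) *\<^sub>R h)) (at x within - {0})"
      if "x \<in> - {0}" for x :: real
      using that has_derivative_inverse'[of x "- {0}"] by (simp add: algebra_simps)
    have "Ck_on k (\<lambda>x::real. (-h) *\<^sub>R (inverse x *\<^sub>R inverse x)) (- {0})" for h
      by (intro Ck_on_scaleR Suc Ck_on_const u)
    then show "Ck_on k (\<lambda>x::real. (- (inverse x * inverse x)) *\<^sub>R h) (- {0})" for h :: real
      by (simp add: mult_ac)
  qed
qed

lemma smooth_on_inverse:
  fixes f :: "'a::euclidean_space \<Rightarrow> real"
  assumes "unique_deriv S" "smooth_on S f" "\<And>x. x \<in> S \<Longrightarrow> f x \<noteq> 0"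
  shows "smooth_on S (\<lambda>x. inverse (f x))"
  by (rule smooth_on_compose[OF assms(1) _ _ assms(2), where T = "- {0}"])
    (use assms(3) in \<open>auto simp: smooth_on_def Ck_on_inverse\<close>)

section \<open>Smooth dependence of the inverse matrix\<close>

lemma smooth_on_det:
  fixes M :: "'a::euclidean_space \<Rightarrow> real ^ 'n ^ 'n"
  assumes "unique_deriv S" "\<And>i j. smooth_on S (\<lambda>x. M x $ i $ j)"
  shows "smooth_on S (\<lambda>x. det (M x))"
  unfolding det_def using assms by (intro smooth_on_sum smooth_on_mult smooth_on_prod) auto

lemma matrix_inv_right:
  fixes M :: "real ^ 'n ^ 'n"
  assumes "det M \<noteq> 0"
  shows "M ** matrix_inv M = mat 1"
proof -
  obtain B where "M ** B = mat 1 \<and> B ** M = mat 1"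
    using assms invertible_det_nz unfolding invertible_def by metis
  then show ?thesis
    unfolding matrix_inv_def by (rule someI2) simp
qed

text \<open>\<open>matrix_inv\<close> is a choice of an inverse and gives no direct access to
  smoothness; Cramer's rule turns its entries into quotients of polynomials in the entries of
  \<open>M\<close>.\<close>

lemma matrix_inv_cramer:
  fixes M :: "real ^ 'n ^ 'n"
  assumes "det M \<noteq> 0"
  shows "matrix_inv M $ k $ l =
    det (\<chi> i j. if j = k then axis l 1 $ i else M $ i $ j) / det M"
proof -
  have "M ** matrix_inv M = mat 1"
    by (rule matrix_inv_right[OF assms])
  then have "M *v (matrix_inv M *v axis l 1) = axis l 1"
    by (simp add: matrix_vector_mul_assoc)
  then have "matrix_inv M *v axis l 1 =
      (\<chi> k. det (\<chi> i j. if j = k then axis l 1 $ i else M $ i $ j) / det M)"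
    using cramer[OF assms] by blast
  moreover have "(matrix_inv M *v axis l 1) $ k = matrix_inv M $ k $ l"
    by (simp add: matrix_vector_mul_component inner_axis)
  ultimately show ?thesis by simp
qed

lemma smooth_on_matrix_inv:
  fixes M :: "'a::euclidean_space \<Rightarrow> real ^ 'n ^ 'n"
  assumes S: "unique_deriv S" and M: "\<And>i j. smooth_on S (\<lambda>x. M x $ i $ j)"
    and nz: "\<And>x. x \<in> S \<Longrightarrow> det (M x) \<noteq> 0"
  shows "smooth_on S (\<lambda>x. matrix_inv (M x) $ k $ l)"
proof -
  have "smooth_on S (\<lambda>x. (if j = k then axis l 1 $ i else M x $ i $ j) :: real)" for i j
    using S M by (cases "j = k") auto
  then have "smooth_on S (\<lambda>x. det (\<chi> i j. if j = k then axis l 1 $ i else M x $ i $ j)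
      * inverse (det (M x)))"
    using nz M S by (intro smooth_on_mult smooth_on_inverse smooth_on_det) auto
  then show ?thesis
    by (rule smooth_on_eq) (use nz in \<open>simp add: matrix_inv_cramer divide_inverse\<close>)
qed

subsection \<open>Directional derivatives\<close>

text \<open>The direction comes first, so that \<open>pd h\<close> is an operator on functions and
  mixed derivatives are iterates.\<close>

definition pd :: "'a::real_normed_vector \<Rightarrow> ('a \<Rightarrow> 'b::real_normed_vector) \<Rightarrow> 'a \<Rightarrow> 'b" where
  "pd h f x = frechet_derivative f (at x) h"

lemma smooth_on_pd: "smooth_on S f \<Longrightarrow> open S \<Longrightarrow> smooth_on S (pd h f)"
  unfolding pd_def by (rule smooth_on_deriv)

lemma smooth_on_has_pd:
  "smooth_on S f \<Longrightarrow> open S \<Longrightarrow> x \<in> S \<Longrightarrow> (f has_derivative (\<lambda>h. pd h f x)) (at x)"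
  unfolding pd_def by (simp add: smooth_on_has_derivative)

lemma pd_eqI: "(f has_derivative f') (at x) \<Longrightarrow> pd h f x = f' h"
  unfolding pd_def by (metis frechet_derivative_at)

lemma pd_linear: "smooth_on S f \<Longrightarrow> open S \<Longrightarrow> x \<in> S \<Longrightarrow> linear (\<lambda>h. pd h f x)"
  using smooth_on_has_pd has_derivative_linear by blast

lemma pd_cong:
  assumes "open S" "x \<in> S" "\<And>y. y \<in> S \<Longrightarrow> f y = g y"
  shows "pd h f x = pd h g x"
  unfolding pd_def using frechet_derivative_within_cong[of x S f g] assms by (simp add: at_within_open_NO_MATCH)

lemma deriv_along_line:
  fixes f :: "'a::euclidean_space \<Rightarrow> real"
  assumes "smooth_on S f" "open S" "x + t *\<^sub>R h \<in> S"
  shows "((\<lambda>s. f (x + s *\<^sub>R h)) has_real_derivative pd h f (x + t *\<^sub>R h)) (at t)"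
proof -
  have "((\<lambda>s. x + s *\<^sub>R h) has_derivative (\<lambda>s. s *\<^sub>R h)) (at t)"
    by (auto intro!: derivative_eq_intros)
  from diff_chain_at[OF this smooth_on_has_pd[OF assms]]
  have "((\<lambda>s. f (x + s *\<^sub>R h)) has_derivative (\<lambda>s. pd (s *\<^sub>R h) f (x + t *\<^sub>R h))) (at t)"
    by (simp add: o_def)
  moreover have "pd (s *\<^sub>R h) f (x + t *\<^sub>R h) = s * pd h f (x + t *\<^sub>R h)" for s
    using linear_scale[OF pd_linear[OF assms]] by simp
  ultimately show ?thesis
    by (simp add: has_field_derivative_def mult_commute_abs)
qed

text \<open>The mean value theorem is applied twice to the second difference over a parallelogram,
  first along \<open>u\<close>, then along \<open>w\<close>.\<close>

lemma pd_mixed_mvt: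
  fixes f :: "'a::euclidean_space \<Rightarrow> real"
  assumes f: "smooth_on S f" "open S" and "0 < h"
    and sub: "\<And>s t. 0 \<le> s \<Longrightarrow> s \<le> h \<Longrightarrow> 0 \<le> t \<Longrightarrow> t \<le> h \<Longrightarrow> x + s *\<^sub>R u + t *\<^sub>R w \<in> S"
  shows "\<exists>s t. 0 < s \<and> s < h \<and> 0 < t \<and> t < h \<and>
    f (x + h *\<^sub>R u + h *\<^sub>R w) - f (x + h *\<^sub>R u) - f (x + h *\<^sub>R w) + f x
      = h * h * pd w (pd u f) (x + s *\<^sub>R u + t *\<^sub>R w)"
proof -
  let ?p = "\<lambda>s. f (x + h *\<^sub>R w + s *\<^sub>R u) - f (x + s *\<^sub>R u)"
  have "(?p has_real_derivative (pd u f (x + h *\<^sub>R w + s *\<^sub>R u) - pd u f (x + s *\<^sub>R u))) (at s)"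
    if "0 \<le> s" "s \<le> h" for s
    using sub[of s h] sub[of s 0] that \<open>0 < h\<close>
    by (intro DERIV_diff deriv_along_line[OF f]) (auto simp: algebra_simps)
  from MVT2[OF \<open>0 < h\<close> this]
  obtain s where s: "0 < s" "s < h"
    "?p h - ?p 0 = h * (pd u f (x + h *\<^sub>R w + s *\<^sub>R u) - pd u f (x + s *\<^sub>R u))"
    by auto
  have "((\<lambda>t. pd u f (x + s *\<^sub>R u + t *\<^sub>R w)) has_real_derivative
      pd w (pd u f) (x + s *\<^sub>R u + t *\<^sub>R w)) (at t)" if "0 \<le> t" "t \<le> h" for t
    using sub[of s t] that s f by (intro deriv_along_line smooth_on_pd) auto
  from MVT2[OF \<open>0 < h\<close> this]
  obtain t where t: "0 < t" "t < h"
    "pd u f (x + s *\<^sub>R u + h *\<^sub>R w) - pd u f (x + s *\<^sub>R u)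
      = h * pd w (pd u f) (x + s *\<^sub>R u + t *\<^sub>R w)"
    by auto
  show ?thesis
    using s t by (intro exI[of _ s] exI[of _ t]) (auto simp: algebra_simps)
qed

text \<open>The second difference is symmetric in \<open>u\<close> and \<open>w\<close>. Hence the
  two mixed derivatives take a common value at two points near \<open>x\<close>, and continuity
  carries this over to \<open>x\<close>.\<close>

lemma pd_commute:
  fixes f :: "'a::euclidean_space \<Rightarrow> real"
  assumes f: "smooth_on S f" "open S" and x: "x \<in> S"
  shows "pd w (pd u f) x = pd u (pd w f) x"
proof (rule ccontr)
  assume ne: "pd w (pd u f) x \<noteq> pd u (pd w f) x"
  \<comment> \<open>Half of the supposed gap: a common value within \<open>e\<close> of both mixed
    derivatives would bring them closer together than the gap.\<close>
  define e where "e = \<bar>pd w (pd u f) x - pd u (pd w f) x\<bar> / 2"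
  have e: "0 < e" using ne by (simp add: e_def)
  have c: "isCont (pd a (pd b f)) x" for a b
    using smooth_on_continuous[OF smooth_on_pd[OF smooth_on_pd[OF f] f(2)]] f(2) x
    by (simp add: continuous_on_eq_continuous_at)
  have "\<exists>r>0. \<forall>y. dist y x < r \<longrightarrow> dist (pd a (pd b f) y) (pd a (pd b f) x) < e" for a b
    using c[of a b] e unfolding continuous_at_eps_delta by auto
  then obtain r1 r2 where
    r1: "r1 > 0" "\<And>y. dist y x < r1 \<Longrightarrow> dist (pd w (pd u f) y) (pd w (pd u f) x) < e" and
    r2: "r2 > 0" "\<And>y. dist y x < r2 \<Longrightarrow> dist (pd u (pd w f) y) (pd u (pd w f) x) < e"
    by metis
  obtain r0 where r0: "r0 > 0" "ball x r0 \<subseteq> S"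
    using f(2) x by (meson openE)
  define r where "r = min r0 (min r1 r2)"
  \<comment> \<open>The parallelogram has to fit into the ball of radius \<open>r\<close>. The
    summand \<open>1\<close> keeps the denominator positive and the inequality strict.\<close>
  define h where "h = r / (norm u + norm w + 1)"
  have "0 < r" using r0 r1 r2 by (auto simp: r_def)
  have den: "0 < norm u + norm w + 1"
    by (smt (verit) norm_ge_zero)
  have h: "0 < h" "h * (norm u + norm w + 1) = r"
    using \<open>0 < r\<close> den by (auto simp: h_def)
  have close: "dist (x + s *\<^sub>R u + t *\<^sub>R w) x < r" if "0 \<le> s" "s \<le> h" "0 \<le> t" "t \<le> h" for s t
  proof -
    have "norm (s *\<^sub>R u + t *\<^sub>R w) \<le> s * norm u + t * norm w"
      using that norm_triangle_ineq[of "s *\<^sub>R u" "t *\<^sub>R w"] by simp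
    also have "\<dots> \<le> h * norm u + h * norm w"
      using that by (intro add_mono mult_right_mono) auto
    also have "\<dots> < r" using h by (simp add: algebra_simps)
    finally show ?thesis by (simp add: dist_norm add.assoc)
  qed
  have sub: "x + s *\<^sub>R u + t *\<^sub>R w \<in> S" if "0 \<le> s" "s \<le> h" "0 \<le> t" "t \<le> h" for s t
    using close[OF that] r0 by (auto simp: r_def dist_commute subset_iff)
  obtain s t where st: "0 < s" "s < h" "0 < t" "t < h"
    "f (x + h *\<^sub>R u + h *\<^sub>R w) - f (x + h *\<^sub>R u) - f (x + h *\<^sub>R w) + f x
      = h * h * pd w (pd u f) (x + s *\<^sub>R u + t *\<^sub>R w)"
    using pd_mixed_mvt[OF f h(1) sub] by blast
  have sub': "x + s *\<^sub>R w + t *\<^sub>R u \<in> S" if "0 \<le> s" "s \<le> h" "0 \<le> t" "t \<le> h" for s t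
    using sub[of t s] that by (simp add: algebra_simps)
  obtain s' t' where st': "0 < s'" "s' < h" "0 < t'" "t' < h"
    "f (x + h *\<^sub>R w + h *\<^sub>R u) - f (x + h *\<^sub>R w) - f (x + h *\<^sub>R u) + f x
      = h * h * pd u (pd w f) (x + s' *\<^sub>R w + t' *\<^sub>R u)"
    using pd_mixed_mvt[OF f h(1) sub'] by blast
  have "h * h * pd w (pd u f) (x + s *\<^sub>R u + t *\<^sub>R w)
      = h * h * pd u (pd w f) (x + t' *\<^sub>R u + s' *\<^sub>R w)"
    using st(5) st'(5) by (simp add: algebra_simps)
  then have eq: "pd w (pd u f) (x + s *\<^sub>R u + t *\<^sub>R w) = pd u (pd w f) (x + t' *\<^sub>R u + s' *\<^sub>R w)"
    using h(1) by simp
  have "dist (pd w (pd u f) (x + s *\<^sub>R u + t *\<^sub>R w)) (pd w (pd u f) x) < e"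
    using st close[of s t] by (intro r1) (auto simp: r_def)
  moreover have "dist (pd u (pd w f) (x + t' *\<^sub>R u + s' *\<^sub>R w)) (pd u (pd w f) x) < e"
    using st' close[of t' s'] by (intro r2) (auto simp: r_def)
  moreover have "\<bar>a - b\<bar> < 2 * e" if "dist p a < e" "dist q b < e" "p = q" for a b p q :: real
    using that unfolding dist_real_def by linarith
  ultimately show False
    using eq unfolding e_def by fastforce
qed

lemma pd_basis_expansion:
  fixes f :: "'a::euclidean_space \<Rightarrow> 'b::real_normed_vector"
  assumes "smooth_on S f" "open S" "x \<in> S"
  shows "pd v f x = (\<Sum>b\<in>Basis. (v \<bullet> b) *\<^sub>R pd b f x)"
  by (rule linear_basis_expansion[OF pd_linear[OF assms]])

lemma pd_pd_basis_expansion: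
  fixes f :: "'a::euclidean_space \<Rightarrow> 'b::real_normed_vector"
  assumes f: "smooth_on S f" "open S" and x: "x \<in> S"
  shows "pd k (pd v f) x = (\<Sum>b\<in>Basis. (v \<bullet> b) *\<^sub>R pd k (pd b f) x)"
proof (rule pd_eqI)
  have "((\<lambda>y. \<Sum>b\<in>Basis. (v \<bullet> b) *\<^sub>R pd b f y) has_derivative
      (\<lambda>k. \<Sum>b\<in>Basis. (v \<bullet> b) *\<^sub>R pd k (pd b f) x)) (at x)"
    by (intro has_derivative_sum has_derivative_scaleR_right smooth_on_has_pd[OF _ f(2) x]
        smooth_on_pd f)
  then show "(pd v f has_derivative (\<lambda>k. \<Sum>b\<in>Basis. (v \<bullet> b) *\<^sub>R pd k (pd b f) x)) (at x)"
    by (rule has_derivative_transform_within_open[OF _ f(2) x])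
      (simp add: pd_basis_expansion[OF f])
qed

text \<open>Moving the point costs a second derivative of \<open>f\<close>, moving the direction a
  first one. This rule is the source of the second-order terms in the Lie bracket and in the change
  of charts, and it also differentiates Euler's relation.\<close>

lemma has_derivative_pd_field:
  fixes f :: "'a::euclidean_space \<Rightarrow> 'b::real_normed_vector"
  assumes f: "smooth_on S f" "open S" and wS: "w ` R \<subseteq> S" and t: "t \<in> R"
    and w: "(w has_derivative w') (at t within R)" and h: "(h has_derivative h') (at t within R)"
  shows "((\<lambda>s. pd (h s) f (w s)) has_derivative
    (\<lambda>k. pd (w' k) (pd (h t) f) (w t) + pd (h' k) f (w t))) (at t within R)"
proof -
  have wt: "w t \<in> S" using wS t by blast
  have "((\<lambda>s. pd b f (w s)) has_derivative (\<lambda>k. pd (w' k) (pd b f) (w t))) (at t within R)" for b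
    using diff_chain_within[OF w has_derivative_at_withinI[OF smooth_on_has_pd[OF smooth_on_pd[OF f] f(2) wt]]]
    by (simp add: o_def)
  then have "((\<lambda>s. \<Sum>b\<in>Basis. (h s \<bullet> b) *\<^sub>R pd b f (w s)) has_derivative
      (\<lambda>k. \<Sum>b\<in>Basis. (h t \<bullet> b) *\<^sub>R pd (w' k) (pd b f) (w t) + (h' k \<bullet> b) *\<^sub>R pd b f (w t)))
      (at t within R)"
    by (intro has_derivative_sum has_derivative_scaleR has_derivative_inner_left h)
  then have "((\<lambda>s. \<Sum>b\<in>Basis. (h s \<bullet> b) *\<^sub>R pd b f (w s)) has_derivative
      (\<lambda>k. pd (w' k) (pd (h t) f) (w t) + pd (h' k) f (w t))) (at t within R)"
    by (simp add: sum.distrib pd_pd_basis_expansion[OF f wt, of _ "h t"]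
        pd_basis_expansion[OF f wt, of "h' _"])
  then show ?thesis
    by (rule has_derivative_transform[OF t, rotated])
      (use wS in \<open>auto intro: pd_basis_expansion[OF f]\<close>)
qed

text \<open>Links the \<open>deriv\<close> in the definitions of the tensors with \<open>pd\<close>.
  Agreement is asked only while the line stays in \<open>S\<close>, because outside of it nothing is
  known about the function.\<close>

lemma deriv_line:
  fixes f :: "'a::euclidean_space \<Rightarrow> real"
  assumes f: "smooth_on S f" "open S" and x: "x \<in> S"
    and eq: "\<And>t. x + t *\<^sub>R h \<in> S \<Longrightarrow> u t = f (x + t *\<^sub>R h)"
  shows "deriv u 0 = pd h f x"
proof -
  let ?T = "(\<lambda>t. x + t *\<^sub>R h) -` S"
  have T: "open ?T"
    by (rule open_vimage[OF f(2)]) (intro continuous_intros)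
  have "((\<lambda>t. f (x + t *\<^sub>R h)) has_real_derivative pd h f (x + 0 *\<^sub>R h)) (at 0)"
    by (rule deriv_along_line[OF f]) (simp add: x)
  then have "(u has_real_derivative pd h f x) (at 0)"
    using x eq by (intro has_field_derivative_transform_within_open[OF _ T, of _ _ 0 u]) auto
  then show ?thesis by (rule DERIV_imp_deriv)
qed

lemma linear_pd_Pair:
  fixes f :: "'a::euclidean_space \<times> 'b::euclidean_space \<Rightarrow> real"
  assumes "smooth_on S f" "open S" "z \<in> S"
  shows "linear (\<lambda>u. a * pd (u, 0) f z)" "linear (\<lambda>u. a * pd (0, u) f z)"
proof -
  have "linear (\<lambda>u::'a. (u, 0 :: 'b))" "linear (\<lambda>u::'b. (0 :: 'a, u))"
    by (auto intro: linearI)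
  note l = this[THEN linear_compose[OF _ pd_linear[OF assms]], unfolded o_def,
      THEN linear_compose_scale_right[of _ a], unfolded real_scaleR_def]
  show "linear (\<lambda>u. a * pd (u, 0) f z)" "linear (\<lambda>u. a * pd (0, u) f z)"
    by (rule l)+
qed

section \<open>The linear algebra of the Chern connection\<close>

lemma linear_axis_expansion:
  fixes f :: "real ^ 'n \<Rightarrow> 'b::real_vector"
  assumes "linear f"
  shows "f v = (\<Sum>i\<in>UNIV. v $ i *\<^sub>R f (axis i 1))"
proof -
  have "f v = f (\<Sum>i\<in>UNIV. v $ i *\<^sub>R axis i 1)"
    using basis_expansion[of v] by (simp add: scalar_mult_eq_scaleR)
  also have "\<dots> = (\<Sum>i\<in>UNIV. v $ i *\<^sub>R f (axis i 1))"
    by (simp add: linear_sum[OF assms] linear_scale[OF assms])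
  finally show ?thesis .
qed

text \<open>
  At a fixed tangent vector with components \<open>y\<close>: \<open>g\<close> is the fundamental tensor, \<open>C\<close> the Cartan tensor,
  and \<open>d u\<close> the derivative of \<open>g\<close> in the direction \<open>u\<close> of the base.
\<close>

locale chern_data =
  fixes g :: "real ^ 'n \<Rightarrow> real ^ 'n \<Rightarrow> real"
    and C d :: "real ^ 'n \<Rightarrow> real ^ 'n \<Rightarrow> real ^ 'n \<Rightarrow> real"
    and y :: "real ^ 'n"
  assumes g_linear: "linear (g u)"
    and g_sym: "g u w = g w u"
    and g_nondegenerate: "(\<And>w. g u w = 0) \<Longrightarrow> u = 0"
    and C_linear: "linear (C u w)"
    and C_sym1: "C u w z = C w u z"
    and C_sym2: "C u w z = C u z w"
    and C_y [simp]: "C y u w = 0"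
    and d_linear1: "linear (\<lambda>u. d u w z)"
    and d_linear: "linear (d u w)"
    and d_sym: "d u w z = d u z w"
begin

lemma C_y' [simp]: "C u y w = 0" "C u w y = 0"
  using C_y[of u w] C_sym1[of u y w] C_sym2[of u w y] by simp_all

lemma g_linear': "linear (\<lambda>u. g u w)"
  using g_linear[of w] g_sym[of _ w] by simp

lemma C_linear': "linear (\<lambda>u. C u w z)" "linear (\<lambda>w. C u w z)"
proof -
  have "(\<lambda>u. C u w z) = C w z"
    using C_sym1[of _ w z] C_sym2[of w _ z] by (intro ext) simp
  moreover have "(\<lambda>w. C u w z) = C u z"
    using C_sym2[of u _ z] by (intro ext) simp
  ultimately show "linear (\<lambda>u. C u w z)" "linear (\<lambda>w. C u w z)"
    using C_linear by simp_all
qed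

lemma d_linear': "linear (\<lambda>w. d u w z)"
  using d_linear[of u z] d_sym[of u _ z] by simp

lemmas g_lin = linear_add[OF g_linear] linear_scale[OF g_linear] linear_diff[OF g_linear]
  linear_add[OF g_linear'] linear_scale[OF g_linear'] linear_diff[OF g_linear']
  linear_0[OF g_linear] linear_0[OF g_linear']
lemmas C_lin = linear_add[OF C_linear] linear_scale[OF C_linear] linear_diff[OF C_linear]
  linear_add[OF C_linear'(1)] linear_scale[OF C_linear'(1)] linear_diff[OF C_linear'(1)]
  linear_add[OF C_linear'(2)] linear_scale[OF C_linear'(2)] linear_diff[OF C_linear'(2)]
  linear_0[OF C_linear] linear_0[OF C_linear'(1)] linear_0[OF C_linear'(2)]
lemmas d_lin = linear_add[OF d_linear] linear_scale[OF d_linear]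
  linear_add[OF d_linear1] linear_scale[OF d_linear1]
  linear_add[OF d_linear'] linear_scale[OF d_linear']

lemma g_eqI: "(\<And>z. g u z = g w z) \<Longrightarrow> u = w"
  using g_nondegenerate[of "u - w"] by (simp add: g_lin)

definition gmat :: "real ^ 'n ^ 'n" where
  "gmat = (\<chi> i j. g (axis i 1) (axis j 1))"

lemma gmat_mult: "gmat *v u = (\<chi> i. g (axis i 1) u)"
  using linear_axis_expansion[OF g_linear, of _ u]
  by (simp add: gmat_def matrix_vector_mult_def mult.commute)

lemma det_gmat: "det gmat \<noteq> 0"
proof -
  have "u = 0" if "gmat *v u = 0" for u
  proof (rule g_nondegenerate)
    fix w
    have "g (axis i 1) u = 0" for i
      using that by (simp add: gmat_mult vec_eq_iff)
    then show "g u w = 0"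
      using linear_axis_expansion[OF g_linear, of u w] by (simp add: g_sym[of u])
  qed
  then have "inj ((*v) gmat)"
    by (simp add: linear_injective_0)
  then show ?thesis
    using matrix_left_invertible_injective[of gmat] invertible_left_inverse[of gmat] invertible_det_nz
    by blast
qed

text \<open>Raising an index. The inverse Gram matrix is used instead of a choice, so that
  components and smoothness can be computed.\<close>

definition sharp :: "(real ^ 'n \<Rightarrow> real) \<Rightarrow> real ^ 'n" where
  "sharp l = matrix_inv gmat *v (\<chi> i. l (axis i 1))"

lemma g_sharp: "linear l \<Longrightarrow> g (sharp l) z = l z"
proof -
  assume l: "linear l"
  have "gmat *v sharp l = (\<chi> i. l (axis i 1))"
    unfolding sharp_def by (simp add: matrix_vector_mul_assoc matrix_inv_right[OF det_gmat])
  then have "g (axis i 1) (sharp l) = l (axis i 1)" for i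
    by (simp add: gmat_mult vec_eq_iff)
  then show ?thesis
    using linear_axis_expansion[OF g_linear, of "sharp l" z] linear_axis_expansion[OF l, of z]
    by (simp add: g_sym[of "sharp l"])
qed

text \<open>The coordinate formulas contract the inverse metric over its second index in
  \<open>gamma_up\<close> and over its first in the Cartan terms; symmetry reconciles both with
  \<open>sharp\<close>.\<close>

lemma matrix_inv_gmat_sym: "matrix_inv gmat $ i $ j = matrix_inv gmat $ j $ i"
proof -
  let ?N = "matrix_inv gmat"
  have "transpose gmat = gmat"
    by (simp add: transpose_def gmat_def vec_eq_iff g_sym)
  then have "transpose ?N ** gmat = mat 1"
    using matrix_inv_right[OF det_gmat] by (metis matrix_transpose_mul transpose_mat)
  then have "transpose ?N = ?N"
    using matrix_inv_right[OF det_gmat] by (metis matrix_mul_assoc matrix_mul_lid matrix_mul_rid)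
  then have "transpose ?N $ j $ i = ?N $ j $ i"
    by simp
  then show ?thesis
    by (simp add: transpose_def)
qed

lemma sharp_nth: "sharp l $ s = (\<Sum>i\<in>UNIV. matrix_inv gmat $ s $ i * l (axis i 1))"
  by (simp add: sharp_def matrix_vector_mult_def)

text \<open>The formal Christoffel symbols of the first kind as a trilinear form; the argument whose
  index will be raised stands first, as in \<open>gamma_lo\<close>.\<close>

definition gam :: "real ^ 'n \<Rightarrow> real ^ 'n \<Rightarrow> real ^ 'n \<Rightarrow> real" where
  "gam z u w = 1/2 * (d w z u - d z u w + d u w z)"

lemma gam_linear: "linear (\<lambda>z. gam z u w)" "linear (\<lambda>u. gam z u w)" "linear (\<lambda>w. gam z u w)"
  by (rule linearI; simp add: gam_def d_lin field_simps)+

text \<open>The value forced on \<open>\<Gamma> y y\<close>: with both lower arguments equal to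
  \<open>y\<close>, every Cartan term of the Koszul formula vanishes.\<close>

definition spray :: "real ^ 'n" where
  "spray = sharp (\<lambda>z. gam z y y)"

text \<open>The value forced on \<open>\<Gamma> u y\<close>: with one argument equal to
  \<open>y\<close>, the only Cartan term left in the Koszul formula involves
  \<open>\<Gamma> y y\<close>, which is \<open>spray\<close>.\<close>

definition nonlin :: "real ^ 'n \<Rightarrow> real ^ 'n" where
  "nonlin u = sharp (\<lambda>z. gam z u y - C spray u z)"

text \<open>The Koszul formula, made explicit by putting \<open>nonlin\<close> for the values on
  \<open>y\<close> in its Cartan terms.\<close>

definition chern :: "real ^ 'n \<Rightarrow> real ^ 'n \<Rightarrow> real ^ 'n" where
  "chern u w = sharp (\<lambda>z. gam z u w - C (nonlin w) u z - C (nonlin u) z w + C (nonlin z) u w)"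

lemma g_spray: "g spray z = gam z y y"
  unfolding spray_def by (rule g_sharp[OF gam_linear(1)])

lemma g_nonlin: "g (nonlin u) z = gam z u y - C spray u z"
  unfolding nonlin_def by (rule g_sharp[OF linear_compose_sub[OF gam_linear(1) C_linear]])

lemma nonlin_linear: "linear nonlin"
  by (rule linearI; rule g_eqI)
    (simp_all add: g_lin g_nonlin C_lin linear_add[OF gam_linear(2)] linear_scale[OF gam_linear(2)]
      algebra_simps)

lemma g_chern: "g (chern u w) z =
    gam z u w - C (nonlin w) u z - C (nonlin u) z w + C (nonlin z) u w"
proof -
  have "linear (\<lambda>z. gam z u w - C (nonlin w) u z - C (nonlin u) z w + C (nonlin z) u w)"
    by (intro linear_compose_add linear_compose_sub gam_linear C_linear C_linear'
        linear_compose[OF nonlin_linear C_linear'(1), unfolded o_def])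
  then show ?thesis
    unfolding chern_def by (rule g_sharp)
qed

lemma chern_linear: "linear (chern u)"
  by (rule linearI; rule g_eqI)
    (simp_all add: g_lin g_chern C_lin linear_add[OF gam_linear(3)] linear_scale[OF gam_linear(3)]
      linear_add[OF nonlin_linear] linear_scale[OF nonlin_linear] algebra_simps)

lemma chern_sym: "chern u w = chern w u"
proof (rule g_eqI)
  fix z
  have "gam z u w = gam z w u"
    unfolding gam_def using d_sym[of w z u] d_sym[of z u w] d_sym[of u w z] by simp
  then show "g (chern u w) z = g (chern w u) z"
    unfolding g_chern using C_sym2[of "nonlin w" u z] C_sym2[of "nonlin u" w z] C_sym2[of "nonlin z" u w]
    by simp
qed

lemma chern_linear': "linear (\<lambda>u. chern u w)"
  using chern_linear[of w] chern_sym[of _ w] by simp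

text \<open>Closes the circle: the solution built from \<open>nonlin\<close> reproduces
  \<open>nonlin\<close> on \<open>y\<close>, so the explicit formula solves the implicit
  equation.\<close>

lemma chern_y: "chern u y = nonlin u"
proof (rule g_eqI)
  fix z
  have "nonlin y = spray"
    by (rule g_eqI) (simp add: g_nonlin g_spray)
  then show "g (chern u y) z = g (nonlin u) z"
    by (simp add: g_chern g_nonlin)
qed

text \<open>When the Koszul expressions for \<open>w, z\<close> and for \<open>z, w\<close> are
  added, the \<open>gam\<close> parts give \<open>d u w z\<close>, and the Cartan parts cancel
  except for twice the term with \<open>nonlin u\<close>, which the last summand
  compensates.\<close>

lemma chern_compatible:
  "d u w z = g (chern u w) z + g w (chern u z) + 2 * C w z (chern u y)"
proof -
  have "gam z u w + gam w u z = d u w z"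
    unfolding gam_def using d_sym[of w z u] d_sym[of z u w] d_sym[of u w z] by (simp add: field_simps)
  moreover have "C w z (nonlin u) = C (nonlin u) z w" "C (nonlin u) w z = C (nonlin u) z w"
    "C (nonlin w) z u = C (nonlin w) u z" "C (nonlin z) w u = C (nonlin z) u w"
    using C_sym1 C_sym2 by metis+
  ultimately show ?thesis
    unfolding chern_y g_sym[of w] g_chern by simp
qed

text \<open>
  The Koszul formula expresses the difference \<open>E\<close> of two solutions through the Cartan tensor
  and \<open>E _ y\<close>. As \<open>C\<close> vanishes on \<open>y\<close>, it gives first \<open>E y y = 0\<close>, then \<open>E _ y = 0\<close>, and then \<open>E = 0\<close>.
\<close>

lemma chern_unique:
  assumes sym: "\<And>u w. G u w = G w u"
    and comp: "\<And>u w z. d u w z = g (G u w) z + g w (G u z) + 2 * C w z (G u y)"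
  shows "G u w = chern u w"
proof -
  define E where "E u w = G u w - chern u w" for u w
  have E_sym: "E u w = E w u" for u w
    by (simp add: E_def sym[of u] chern_sym[of u])
  have E0: "g (E u w) z + g w (E u z) + 2 * C w z (E u y) = 0" for u w z
    using comp[of u w z] chern_compatible[of u w z] by (simp add: E_def g_lin C_lin)
  have koszul: "g (E u w) z = C u w (E z y) - C w z (E u y) - C z u (E w y)" for u w z
  proof -
    \<comment> \<open>The first plus the second minus the third of these cyclic equations isolates
      \<open>g (E u w) z\<close>.\<close>
    have "g (E u w) z + g (E u z) w + 2 * C w z (E u y) = 0"
      "g (E w z) u + g (E u w) z + 2 * C z u (E w y) = 0"
      "g (E u z) w + g (E w z) u + 2 * C u w (E z y) = 0"
      using E0[of u w z] E0[of w z u] E0[of z u w] g_sym E_sym by metis+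
    then show ?thesis by linarith
  qed
  have yy: "E y y = 0"
    by (rule g_nondegenerate) (simp add: koszul)
  have uy: "E u y = 0" for u
    by (rule g_nondegenerate) (simp add: koszul yy C_lin)
  have "E u w = 0"
    by (rule g_nondegenerate) (simp add: koszul uy C_lin)
  then show ?thesis by (simp add: E_def)
qed

subsection \<open>Index formulas\<close>

definition gam_up :: "'n \<Rightarrow> 'n \<Rightarrow> 'n \<Rightarrow> real" where
  "gam_up s j k = (\<Sum>i\<in>UNIV. matrix_inv gmat $ s $ i * gam (axis i 1) (axis j 1) (axis k 1))"

lemma spray_nth: "spray $ p = (\<Sum>l\<in>UNIV. \<Sum>i\<in>UNIV. y $ l * y $ i * gam_up p l i)"
proof -
  have "gam z y y = (\<Sum>l\<in>UNIV. \<Sum>i\<in>UNIV. y $ l * y $ i * gam z (axis l 1) (axis i 1))" for z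
    by (subst linear_axis_expansion[OF gam_linear(2)], subst linear_axis_expansion[OF gam_linear(3)])
      (simp add: sum_distrib_left mult.assoc)
  then have "spray $ p = (\<Sum>m\<in>UNIV. \<Sum>l\<in>UNIV. \<Sum>i\<in>UNIV. matrix_inv gmat $ p $ m *
      (y $ l * y $ i * gam (axis m 1) (axis l 1) (axis i 1)))"
    by (simp add: spray_def sharp_nth sum_distrib_left)
  also have "\<dots> = (\<Sum>l\<in>UNIV. \<Sum>m\<in>UNIV. \<Sum>i\<in>UNIV. matrix_inv gmat $ p $ m *
      (y $ l * y $ i * gam (axis m 1) (axis l 1) (axis i 1)))"
    by (rule sum.swap)
  also have "\<dots> = (\<Sum>l\<in>UNIV. \<Sum>i\<in>UNIV. \<Sum>m\<in>UNIV. matrix_inv gmat $ p $ m *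
      (y $ l * y $ i * gam (axis m 1) (axis l 1) (axis i 1)))"
    by (intro sum.cong refl sum.swap)
  finally show ?thesis
    by (simp add: gam_up_def sum_distrib_left mult_ac)
qed

text \<open>Beyond the multilinear expansion this is a reordering of four sums, to meet the
  summation order of \<open>N_up\<close>.\<close>

lemma nonlin_nth:
  "nonlin (axis j 1) $ s = (\<Sum>i\<in>UNIV. y $ i * gam_up s j i)
     - (\<Sum>l\<in>UNIV. \<Sum>i\<in>UNIV. \<Sum>p\<in>UNIV. \<Sum>k\<in>UNIV.
          y $ l * y $ i * gam_up p l i * matrix_inv gmat $ k $ s * C (axis p 1) (axis j 1) (axis k 1))"
proof -
  let ?e = "\<lambda>i. axis i 1 :: real ^ 'n" and ?h = "\<lambda>i j. matrix_inv gmat $ i $ j"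
  have "(\<Sum>i\<in>UNIV. ?h s i * gam (?e i) (?e j) y)
      = (\<Sum>i\<in>UNIV. \<Sum>m\<in>UNIV. ?h s i * (y $ m * gam (?e i) (?e j) (?e m)))"
    by (subst linear_axis_expansion[OF gam_linear(3)]) (simp add: sum_distrib_left)
  also have "\<dots> = (\<Sum>m\<in>UNIV. \<Sum>i\<in>UNIV. ?h s i * (y $ m * gam (?e i) (?e j) (?e m)))"
    by (rule sum.swap)
  also have "\<dots> = (\<Sum>m\<in>UNIV. y $ m * gam_up s j m)"
    by (simp add: gam_up_def sum_distrib_left mult_ac)
  finally have 1: "(\<Sum>i\<in>UNIV. ?h s i * gam (?e i) (?e j) y) = (\<Sum>m\<in>UNIV. y $ m * gam_up s j m)" .
  have "(\<Sum>k\<in>UNIV. ?h s k * C spray (?e j) (?e k))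
      = (\<Sum>k\<in>UNIV. ?h k s * (\<Sum>p\<in>UNIV. spray $ p * C (?e p) (?e j) (?e k)))"
    by (subst linear_axis_expansion[OF C_linear'(1)]) (simp add: matrix_inv_gmat_sym[of s])
  also have "\<dots> = (\<Sum>k\<in>UNIV. \<Sum>p\<in>UNIV. \<Sum>l\<in>UNIV. \<Sum>i\<in>UNIV.
      y $ l * y $ i * gam_up p l i * ?h k s * C (?e p) (?e j) (?e k))"
    by (simp add: spray_nth sum_distrib_left sum_distrib_right mult_ac)
  also have "\<dots> = (\<Sum>p\<in>UNIV. \<Sum>k\<in>UNIV. \<Sum>l\<in>UNIV. \<Sum>i\<in>UNIV.
      y $ l * y $ i * gam_up p l i * ?h k s * C (?e p) (?e j) (?e k))"
    by (rule sum.swap)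
  also have "\<dots> = (\<Sum>p\<in>UNIV. \<Sum>l\<in>UNIV. \<Sum>k\<in>UNIV. \<Sum>i\<in>UNIV.
      y $ l * y $ i * gam_up p l i * ?h k s * C (?e p) (?e j) (?e k))"
    by (rule sum.cong[OF refl], rule sum.swap)
  also have "\<dots> = (\<Sum>l\<in>UNIV. \<Sum>p\<in>UNIV. \<Sum>k\<in>UNIV. \<Sum>i\<in>UNIV.
      y $ l * y $ i * gam_up p l i * ?h k s * C (?e p) (?e j) (?e k))"
    by (rule sum.swap)
  also have "\<dots> = (\<Sum>l\<in>UNIV. \<Sum>p\<in>UNIV. \<Sum>i\<in>UNIV. \<Sum>k\<in>UNIV.
      y $ l * y $ i * gam_up p l i * ?h k s * C (?e p) (?e j) (?e k))"
    by (rule sum.cong[OF refl], rule sum.cong[OF refl], rule sum.swap)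
  also have "\<dots> = (\<Sum>l\<in>UNIV. \<Sum>i\<in>UNIV. \<Sum>p\<in>UNIV. \<Sum>k\<in>UNIV.
      y $ l * y $ i * gam_up p l i * ?h k s * C (?e p) (?e j) (?e k))"
    by (rule sum.cong[OF refl], rule sum.swap)
  finally show ?thesis
    by (simp add: nonlin_def sharp_nth 1 right_diff_distrib sum_subtractf)
qed

text \<open>Serves two purposes: it identifies the solution with the Chern formula, and it exhibits
  its components as smooth expressions.\<close>

lemma chern_nth:
  "chern (axis j 1) (axis i 1) $ s = gam_up s j i
     + (\<Sum>k\<in>UNIV. matrix_inv gmat $ k $ s * (\<Sum>p\<in>UNIV.
          - (nonlin (axis i 1) $ p * C (axis p 1) (axis j 1) (axis k 1))
          - nonlin (axis j 1) $ p * C (axis p 1) (axis k 1) (axis i 1)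
          + nonlin (axis k 1) $ p * C (axis p 1) (axis i 1) (axis j 1)))"
proof -
  let ?e = "\<lambda>i. axis i 1 :: real ^ 'n"
  have C: "C (nonlin u) w z = (\<Sum>p\<in>UNIV. nonlin u $ p * C (?e p) w z)" for u w z
    by (subst linear_axis_expansion[OF C_linear'(1)]) simp
  have "(\<Sum>p\<in>UNIV. - (nonlin (?e i) $ p * C (?e p) (?e j) (?e k))
          - nonlin (?e j) $ p * C (?e p) (?e k) (?e i)
          + nonlin (?e k) $ p * C (?e p) (?e i) (?e j))
      = - C (nonlin (?e i)) (?e j) (?e k) - C (nonlin (?e j)) (?e k) (?e i)
        + C (nonlin (?e k)) (?e i) (?e j)" for k
    unfolding C by (simp add: sum.distrib sum_subtractf sum_negf)
  also have "\<dots> k = - C (nonlin (?e i)) (?e j) (?e k) - C (nonlin (?e j)) (?e k) (?e i)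
        + C (nonlin (?e k)) (?e j) (?e i)" for k
    using C_sym2[of "nonlin (?e k)"] by simp
  finally have S: "(\<Sum>p\<in>UNIV. - (nonlin (?e i) $ p * C (?e p) (?e j) (?e k))
          - nonlin (?e j) $ p * C (?e p) (?e k) (?e i)
          + nonlin (?e k) $ p * C (?e p) (?e i) (?e j))
      = - C (nonlin (?e i)) (?e j) (?e k) - C (nonlin (?e j)) (?e k) (?e i)
        + C (nonlin (?e k)) (?e j) (?e i)" for k .
  show ?thesis
    unfolding S
    by (simp add: chern_def sharp_nth gam_up_def matrix_inv_gmat_sym[of s] sum.distrib[symmetric]
        algebra_simps)
qed

end

section \<open>Charts and tangent vectors\<close>

locale manifold =
  fixes \<A> :: "('m::{t2_space, second_countable_topology}, 'n::finite) chart set"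
  assumes manifold: "smooth_manifold \<A>"
begin

lemma is_chart: "c \<in> \<A> \<Longrightarrow> is_chart c"
  using manifold by (simp add: smooth_manifold_def)

lemma open_cdom: "c \<in> \<A> \<Longrightarrow> open (cdom c)"
  using is_chart by (simp add: is_chart_def)

lemma chart_homeomorphism: "c \<in> \<A> \<Longrightarrow> homeomorphism (cdom c) (cmap c ` cdom c) (cmap c) (cinv c)"
  using is_chart by (simp add: is_chart_def)

lemma cinv_cmap: "c \<in> \<A> \<Longrightarrow> p \<in> cdom c \<Longrightarrow> cinv c (cmap c p) = p"
  using chart_homeomorphism unfolding homeomorphism_def by blast

lemma cmap_cinv: "x \<in> cmap c ` cdom c \<Longrightarrow> cmap c (cinv c x) = x"
  by (rule f_inv_into_f)

lemma cinv_in_subset: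
  assumes "c \<in> \<A>" "U \<subseteq> cdom c" "x \<in> cmap c ` U"
  shows "cinv c x \<in> U" "cmap c (cinv c x) = x"
  using assms cinv_cmap[OF assms(1)] by auto

lemma open_cmap_image:
  assumes "c \<in> \<A>" "open U" "U \<subseteq> cdom c"
  shows "open (cmap c ` U)"
proof -
  have "openin (top_of_set (cmap c ` cdom c)) (cmap c ` U)"
    using homeomorphism_imp_open_map[OF chart_homeomorphism[OF assms(1)]] assms(2,3)
    by (metis openin_open Int_absorb1)
  moreover have "open (cmap c ` cdom c)"
    using is_chart[OF assms(1)] by (simp add: is_chart_def)
  ultimately show ?thesis
    using openin_open_trans by blast
qed

section \<open>Coordinate changes and their Jacobians\<close>

lemma open_overlap: "c \<in> \<A> \<Longrightarrow> c' \<in> \<A> \<Longrightarrow> open (cmap c ` (cdom c \<inter> cdom c'))"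
  by (intro open_cmap_image open_Int open_cdom) auto

lemma smooth_trans:
  "c \<in> \<A> \<Longrightarrow> c' \<in> \<A> \<Longrightarrow> smooth_on (cmap c ` (cdom c \<inter> cdom c')) (cmap c' \<circ> cinv c)"
  using manifold unfolding smooth_manifold_def compatible_def by blast

definition jac :: "('m, 'n) chart \<Rightarrow> ('m, 'n) chart \<Rightarrow> 'm \<Rightarrow> real ^ 'n \<Rightarrow> real ^ 'n" where
  "jac c c' p = frechet_derivative (cmap c' \<circ> cinv c) (at (cmap c p))"

lemma trans_has_derivative:
  assumes "c \<in> \<A>" "c' \<in> \<A>" "p \<in> cdom c" "p \<in> cdom c'"
  shows "((cmap c' \<circ> cinv c) has_derivative jac c c' p) (at (cmap c p))"
  unfolding jac_def
  by (rule smooth_on_has_derivative[OF smooth_trans open_overlap]) (use assms in auto)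

lemma jac_linear:
  assumes "c \<in> \<A>" "c' \<in> \<A>" "p \<in> cdom c" "p \<in> cdom c'"
  shows "linear (jac c c' p)"
  using trans_has_derivative[OF assms] has_derivative_linear by blast

lemma jac_refl:
  assumes "c \<in> \<A>" "p \<in> cdom c"
  shows "jac c c p y = y"
proof -
  have "((cmap c \<circ> cinv c) has_derivative (\<lambda>y. y)) (at (cmap c p))"
    by (rule has_derivative_transform_within_open[OF has_derivative_ident
          open_cmap_image[OF assms(1) open_cdom[OF assms(1)] subset_refl]])
      (use assms in \<open>auto simp: cmap_cinv\<close>)
  then show ?thesis
    unfolding jac_def using frechet_derivative_at by metis
qed

text \<open>The chain rule. The composite of two coordinate changes agrees with the direct one on
  the triple overlap, an open set around the point.\<close>

lemma jac_jac:
  assumes "c \<in> \<A>" "c' \<in> \<A>" "c'' \<in> \<A>" "p \<in> cdom c" "p \<in> cdom c'" "p \<in> cdom c''"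
  shows "jac c' c'' p (jac c c' p y) = jac c c'' p y"
proof -
  let ?U = "cmap c ` (cdom c \<inter> cdom c' \<inter> cdom c'')"
  have p: "(cmap c' \<circ> cinv c) (cmap c p) = cmap c' p"
    by (simp add: cinv_cmap assms)
  have "((cmap c'' \<circ> cinv c') \<circ> (cmap c' \<circ> cinv c) has_derivative jac c' c'' p \<circ> jac c c' p)
      (at (cmap c p))"
    using diff_chain_at[OF trans_has_derivative[of c c' p], of "cmap c'' \<circ> cinv c'"]
      trans_has_derivative[of c' c'' p] assms unfolding p by blast
  then have "((cmap c'' \<circ> cinv c) has_derivative jac c' c'' p \<circ> jac c c' p) (at (cmap c p))"
  proof (rule has_derivative_transform_within_open)
    show "open ?U"
      using assms by (intro open_cmap_image open_Int open_cdom) auto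
    show "cmap c p \<in> ?U" using assms by auto
    show "((cmap c'' \<circ> cinv c') \<circ> (cmap c' \<circ> cinv c)) x = (cmap c'' \<circ> cinv c) x" if "x \<in> ?U" for x
      using that assms by (auto simp: cinv_cmap)
  qed
  from frechet_derivative_at[OF this] show ?thesis
    unfolding jac_def[of c c''] by (metis comp_apply)
qed

section \<open>Tangent vectors and their components\<close>

lemma base_coord_vec [simp]: "base (coord_vec \<A> c p y) = p"
  by (simp add: coord_vec_def)

lemma vcomp_coord_vec:
  "c' \<in> \<A> \<Longrightarrow> p \<in> cdom c' \<Longrightarrow> vcomp c' (coord_vec \<A> c p y) = jac c c' p y"
  by (simp add: coord_vec_def jac_def)

lemma vcomp_coord_vec_same:
  "c \<in> \<A> \<Longrightarrow> p \<in> cdom c \<Longrightarrow> vcomp c (coord_vec \<A> c p y) = y"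
  by (simp add: vcomp_coord_vec jac_refl)

lemma tangent_bundleI:
  assumes "\<And>c c'. c \<in> \<A> \<Longrightarrow> c' \<in> \<A> \<Longrightarrow> base v \<in> cdom c \<Longrightarrow> base v \<in> cdom c' \<Longrightarrow>
      vcomp c' v = jac c c' (base v) (vcomp c v)"
    and "\<And>c. \<not> (c \<in> \<A> \<and> base v \<in> cdom c) \<Longrightarrow> vcomp c v = 0"
  shows "v \<in> tangent_bundle \<A>"
  using assms unfolding tangent_bundle_def jac_def by blast

lemma vcomp_change:
  assumes "v \<in> tangent_bundle \<A>" "c \<in> \<A>" "c' \<in> \<A>" "base v \<in> cdom c" "base v \<in> cdom c'"
  shows "vcomp c' v = jac c c' (base v) (vcomp c v)"
  using assms unfolding tangent_bundle_def jac_def by blast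

lemma vcomp_outside:
  "v \<in> tangent_bundle \<A> \<Longrightarrow> \<not> (c \<in> \<A> \<and> base v \<in> cdom c) \<Longrightarrow> vcomp c v = 0"
  unfolding tangent_bundle_def by blast

lemma coord_vec_in_tangent_bundle:
  assumes "c \<in> \<A>" "p \<in> cdom c"
  shows "coord_vec \<A> c p y \<in> tangent_bundle \<A>"
proof (rule tangent_bundleI)
  fix d d' assume "d \<in> \<A>" "d' \<in> \<A>" "base (coord_vec \<A> c p y) \<in> cdom d" "base (coord_vec \<A> c p y) \<in> cdom d'"
  then show "vcomp d' (coord_vec \<A> c p y) = jac d d' (base (coord_vec \<A> c p y)) (vcomp d (coord_vec \<A> c p y))"
    using assms by (simp add: vcomp_coord_vec jac_jac)
next
  fix d assume "\<not> (d \<in> \<A> \<and> base (coord_vec \<A> c p y) \<in> cdom d)"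
  then show "vcomp d (coord_vec \<A> c p y) = 0"
    by (auto simp: coord_vec_def)
qed

lemma coord_vec_in_tangent_space:
  "c \<in> \<A> \<Longrightarrow> p \<in> cdom c \<Longrightarrow> coord_vec \<A> c p y \<in> tangent_space \<A> p"
  by (simp add: tangent_space_def coord_vec_in_tangent_bundle)

lemma tangent_spaceD: "v \<in> tangent_space \<A> p \<Longrightarrow> v \<in> tangent_bundle \<A> \<and> base v = p"
  by (simp add: tangent_space_def)

text \<open>The components in the other charts around the base point follow from those in
  \<open>c\<close> by the Jacobians, and all remaining ones are zero by convention.\<close>

lemma coord_vec_vcomp:
  assumes "v \<in> tangent_bundle \<A>" "c \<in> \<A>" "base v \<in> cdom c"
  shows "coord_vec \<A> c (base v) (vcomp c v) = v"
proof (rule prod_eqI)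
  show "snd (coord_vec \<A> c (base v) (vcomp c v)) = snd v"
  proof
    fix c'
    show "vcomp c' (coord_vec \<A> c (base v) (vcomp c v)) = vcomp c' v"
    proof (cases "c' \<in> \<A> \<and> base v \<in> cdom c'")
      case True
      then show ?thesis using vcomp_change[OF assms(1,2) _ assms(3)] by (simp add: vcomp_coord_vec)
    next
      case False
      then show ?thesis using vcomp_outside[OF assms(1) False] by (auto simp: coord_vec_def)
    qed
  qed
qed simp

lemma tangent_eqI:
  assumes "v \<in> tangent_space \<A> p" "w \<in> tangent_space \<A> p" "c \<in> \<A>" "p \<in> cdom c"
    "vcomp c v = vcomp c w"
  shows "v = w"
  using assms coord_vec_vcomp tangent_spaceD by metis

lemma tadd_tangent:
  assumes "v \<in> tangent_space \<A> p" "w \<in> tangent_space \<A> p"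
  shows "v +\<^sub>T w \<in> tangent_space \<A> p"
proof -
  have "v +\<^sub>T w \<in> tangent_bundle \<A>"
  proof (rule tangent_bundleI)
    fix c c' assume c: "c \<in> \<A>" "c' \<in> \<A>" "base (v +\<^sub>T w) \<in> cdom c" "base (v +\<^sub>T w) \<in> cdom c'"
    then show "vcomp c' (v +\<^sub>T w) = jac c c' (base (v +\<^sub>T w)) (vcomp c (v +\<^sub>T w))"
      using assms vcomp_change[of v c c'] vcomp_change[of w c c']
      by (simp add: tadd_def tangent_space_def linear_add[OF jac_linear])
  next
    fix c assume "\<not> (c \<in> \<A> \<and> base (v +\<^sub>T w) \<in> cdom c)"
    then show "vcomp c (v +\<^sub>T w) = 0"
      using assms vcomp_outside by (auto simp: tadd_def tangent_space_def)
  qed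
  then show ?thesis
    using assms by (simp add: tangent_space_def tadd_def)
qed

lemma tscale_tangent:
  assumes "v \<in> tangent_space \<A> p"
  shows "r *\<^sub>T v \<in> tangent_space \<A> p"
proof -
  have "r *\<^sub>T v \<in> tangent_bundle \<A>"
  proof (rule tangent_bundleI)
    fix c c' assume c: "c \<in> \<A>" "c' \<in> \<A>" "base (r *\<^sub>T v) \<in> cdom c" "base (r *\<^sub>T v) \<in> cdom c'"
    then show "vcomp c' (r *\<^sub>T v) = jac c c' (base (r *\<^sub>T v)) (vcomp c (r *\<^sub>T v))"
      using assms vcomp_change[of v c c']
      by (simp add: tscale_def tangent_space_def linear_scale[OF jac_linear])
  next
    fix c assume "\<not> (c \<in> \<A> \<and> base (r *\<^sub>T v) \<in> cdom c)"
    then show "vcomp c (r *\<^sub>T v) = 0"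
      using assms vcomp_outside by (auto simp: tscale_def tangent_space_def)
  qed
  then show ?thesis
    using assms by (simp add: tangent_space_def tscale_def)
qed

lemma vcomp_tadd [simp]: "vcomp c (v +\<^sub>T w) = vcomp c v + vcomp c w"
  by (simp add: tadd_def)

lemma vcomp_tscale [simp]: "vcomp c (r *\<^sub>T v) = r *\<^sub>R vcomp c v"
  by (simp add: tscale_def)

lemma base_tadd [simp]: "base (v +\<^sub>T w) = base v"
  by (simp add: tadd_def)

lemma base_tscale [simp]: "base (r *\<^sub>T v) = base v"
  by (simp add: tscale_def)

text \<open>The definite description has a value because, by the chain rule, the change of the
  derivative of \<open>f\<close> from chart to chart is balanced by the change of the components of
  \<open>v\<close>.\<close>

lemma dir_deriv_chart:
  assumes v: "v \<in> tangent_bundle \<A>" and c: "c \<in> \<A>" "base v \<in> cdom c"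
    and f: "f \<in> smooth_functions \<A> \<Omega>" and \<Omega>: "open \<Omega>" "base v \<in> \<Omega>"
  shows "dir_deriv \<A> v f = frechet_derivative (f \<circ> cinv c) (at (cmap c (base v))) (vcomp c v)"
  unfolding dir_deriv_def
proof (rule the_equality)
  let ?p = "base v"
  let ?D = "frechet_derivative (f \<circ> cinv c) (at (cmap c ?p))"
  have f': "(f \<circ> cinv c has_derivative ?D) (at (cmap c ?p))"
  proof (rule smooth_on_has_derivative)
    show "smooth_on (cmap c ` (cdom c \<inter> \<Omega>)) (f \<circ> cinv c)"
      using f c unfolding smooth_functions_def o_def by blast
    show "open (cmap c ` (cdom c \<inter> \<Omega>))"
      using c \<Omega> by (intro open_cmap_image open_Int open_cdom) auto
  qed (use c \<Omega> in auto)
  show "\<forall>c'\<in>\<A>. ?p \<in> cdom c' \<longrightarrow>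
     ?D (vcomp c v) = frechet_derivative (f \<circ> cinv c') (at (cmap c' ?p)) (vcomp c' v)"
  proof (intro ballI impI)
    fix c' assume c': "c' \<in> \<A>" "?p \<in> cdom c'"
    have "((f \<circ> cinv c) \<circ> (cmap c \<circ> cinv c') has_derivative ?D \<circ> jac c' c ?p) (at (cmap c' ?p))"
      using diff_chain_at[OF trans_has_derivative[OF c'(1) c(1) c'(2) c(2)]] f'
      by (simp add: cinv_cmap c')
    then have "(f \<circ> cinv c' has_derivative ?D \<circ> jac c' c ?p) (at (cmap c' ?p))"
      by (rule has_derivative_transform_within_open[OF _ open_overlap[OF c'(1) c(1)]])
        (use c c' in \<open>auto simp: cinv_cmap\<close>)
    from frechet_derivative_at[OF this]
    show "?D (vcomp c v) = frechet_derivative (f \<circ> cinv c') (at (cmap c' ?p)) (vcomp c' v)"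
      using vcomp_change[OF v c'(1) c(1) c'(2) c(2)] by (metis comp_apply)
  qed
  then show "r = ?D (vcomp c v)" if "\<forall>c\<in>\<A>. ?p \<in> cdom c \<longrightarrow>
     r = frechet_derivative (f \<circ> cinv c) (at (cmap c ?p)) (vcomp c v)" for r
    using that c by blast
qed

end

subsection \<open>Vector fields in a chart\<close>

text \<open>The patch may be smaller than the chart domain, since an admissible extension of a
  vector need not exist on the whole domain.\<close>

locale coord_patch = manifold \<A>
  for \<A> :: "('m::{t2_space, second_countable_topology}, 'n::finite) chart set" +
  fixes c :: "('m, 'n) chart" and \<Omega> :: "'m set"
  assumes c: "c \<in> \<A>" and open_patch: "open \<Omega>" and patch_subset: "\<Omega> \<subseteq> cdom c"
begin

abbreviation B :: "(real ^ 'n) set" where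
  "B \<equiv> cmap c ` \<Omega>"

abbreviation VF :: "('m \<Rightarrow> ('m, 'n) tvec) set" where
  "VF \<equiv> vector_fields \<A> \<Omega>"

text \<open>With \<open>comps\<close> as its inverse (\<open>lift_comps\<close>,
  \<open>comps_lift\<close>), it identifies smooth maps on \<open>B\<close> with fields on the
  patch, so that computations with fields become computations with vector-valued maps.\<close>

definition lift :: "(real ^ 'n \<Rightarrow> real ^ 'n) \<Rightarrow> 'm \<Rightarrow> ('m, 'n) tvec" where
  "lift w = (\<lambda>q\<in>\<Omega>. coord_vec \<A> c q (w (cmap c q)))"

definition comps :: "('m \<Rightarrow> ('m, 'n) tvec) \<Rightarrow> real ^ 'n \<Rightarrow> real ^ 'n" where
  "comps X = (\<lambda>x. vcomp c (X (cinv c x)))"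

lemma open_B: "open B"
  by (rule open_cmap_image[OF c open_patch patch_subset])

lemma uB: "unique_deriv B"
  by (rule unique_deriv_open[OF open_B])

lemma patch_cdom: "p \<in> \<Omega> \<Longrightarrow> p \<in> cdom c"
  using patch_subset by blast

lemma cinv_B: "x \<in> B \<Longrightarrow> cinv c x \<in> \<Omega>" "x \<in> B \<Longrightarrow> cmap c (cinv c x) = x"
  using cinv_in_subset[OF c patch_subset] by blast+

lemma cinv_patch: "p \<in> \<Omega> \<Longrightarrow> cinv c (cmap c p) = p"
  by (simp add: cinv_cmap c patch_cdom)

lemma smooth_on_chart_change:
  fixes w :: "real ^ 'n \<Rightarrow> 'x::euclidean_space"
  assumes "smooth_on B w" "c' \<in> \<A>"
  shows "smooth_on (cmap c' ` (cdom c' \<inter> \<Omega>)) (\<lambda>x. w (cmap c (cinv c' x)))"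
proof (rule smooth_on_compose[where T = B, OF _ open_B])
  have o: "open (cmap c' ` (cdom c' \<inter> \<Omega>))"
    using assms open_patch by (intro open_cmap_image open_Int open_cdom) auto
  then show "unique_deriv (cmap c' ` (cdom c' \<inter> \<Omega>))"
    by (rule unique_deriv_open)
  then show "smooth_on (cmap c' ` (cdom c' \<inter> \<Omega>)) (\<lambda>x. cmap c (cinv c' x))"
    using smooth_on_subset[OF _ _ smooth_trans[OF assms(2) c]] patch_subset
    unfolding o_def by blast
  show "(\<lambda>x. cmap c (cinv c' x)) ` cmap c' ` (cdom c' \<inter> \<Omega>) \<subseteq> B"
    using assms cinv_cmap by auto
qed (rule assms(1))

text \<open>Smoothness is required in every chart of the atlas. In another chart the components are
  the Jacobian applied to \<open>w\<close>, which is a derivative in a moving direction.\<close>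

lemma lift_in_VF:
  assumes w: "smooth_on B w"
  shows "lift w \<in> VF"
proof -
  have "smooth_on (cmap c' ` (cdom c' \<inter> \<Omega>)) (\<lambda>x. vcomp c' (lift w (cinv c' x)))"
    if c': "c' \<in> \<A>" for c'
  proof (rule smooth_on_eq)
    let ?R = "cmap c' ` (cdom c' \<inter> \<Omega>)"
    have o: "open ?R"
      using c' open_patch by (intro open_cmap_image open_Int open_cdom) auto
    show "smooth_on ?R (\<lambda>x. frechet_derivative (cmap c' \<circ> cinv c) (at (cmap c (cinv c' x)))
        (w (cmap c (cinv c' x))))"
    proof (rule smooth_on_deriv_field[OF smooth_trans[OF c c'] open_overlap[OF c c'] unique_deriv_open[OF o]])
      show "(\<lambda>x. cmap c (cinv c' x)) ` ?R \<subseteq> cmap c ` (cdom c \<inter> cdom c')"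
        using c' patch_subset by (auto simp: cinv_cmap)
      show "smooth_on ?R (\<lambda>x. cmap c (cinv c' x))"
        by (rule smooth_on_chart_change[OF _ c', where w = "\<lambda>x. x"])
          (simp add: smooth_on_linear uB bounded_linear_ident)
      show "smooth_on ?R (\<lambda>x. w (cmap c (cinv c' x)))"
        by (rule smooth_on_chart_change[OF w c'])
    qed
    show "vcomp c' (lift w (cinv c' x)) = frechet_derivative (cmap c' \<circ> cinv c)
        (at (cmap c (cinv c' x))) (w (cmap c (cinv c' x)))" if "x \<in> ?R" for x
    proof -
      from that obtain q where "q \<in> cdom c'" "q \<in> \<Omega>" "x = cmap c' q" by blast
      then show ?thesis
        using c' by (simp add: lift_def vcomp_coord_vec cinv_cmap jac_def)
    qed
  qed
  moreover have "lift w p \<in> tangent_space \<A> p" if "p \<in> \<Omega>" for p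
    using that by (simp add: lift_def coord_vec_in_tangent_space c patch_cdom)
  ultimately show ?thesis
    by (auto simp: vector_fields_def lift_def)
qed

lemma smooth_comps: "X \<in> VF \<Longrightarrow> smooth_on B (comps X)"
  using c patch_subset unfolding vector_fields_def comps_def
  by (auto simp: Int_absorb1)

lemma VF_tangent: "X \<in> VF \<Longrightarrow> p \<in> \<Omega> \<Longrightarrow> X p \<in> tangent_space \<A> p"
  by (auto simp: vector_fields_def)

lemma vcomp_comps: "p \<in> \<Omega> \<Longrightarrow> vcomp c (X p) = comps X (cmap c p)"
  by (simp add: comps_def cinv_patch)

lemma lift_comps:
  assumes "X \<in> VF"
  shows "lift (comps X) = X"
proof
  fix p
  show "lift (comps X) p = X p"
  proof (cases "p \<in> \<Omega>")
    case True
    then show ?thesis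
      using tangent_spaceD[OF VF_tangent[OF assms True]] coord_vec_vcomp[OF _ c, of "X p"]
      by (simp add: lift_def vcomp_comps[symmetric] patch_cdom)
  next
    case False
    then show ?thesis
      using assms by (auto simp: lift_def vector_fields_def extensional_def)
  qed
qed

lemma comps_lift: "x \<in> B \<Longrightarrow> comps (lift w) x = w x"
  by (simp add: comps_def lift_def cinv_B vcomp_coord_vec_same c patch_cdom)

lemma vcomp_lift: "p \<in> \<Omega> \<Longrightarrow> vcomp c (lift w p) = w (cmap c p)"
  by (simp add: lift_def vcomp_coord_vec_same c patch_cdom)

lemma lift_cong: "(\<And>x. x \<in> B \<Longrightarrow> w x = w' x) \<Longrightarrow> lift w = lift w'"
  by (auto simp: lift_def)

lemma VF_eqI:
  assumes "X \<in> VF" "Y \<in> VF" "\<And>x. x \<in> B \<Longrightarrow> comps X x = comps Y x"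
  shows "X = Y"
proof -
  have "lift (comps X) = lift (comps Y)"
    by (rule lift_cong[OF assms(3)])
  then show ?thesis
    unfolding lift_comps[OF assms(1)] lift_comps[OF assms(2)] .
qed

lemma tadd_lift: "(\<lambda>q\<in>\<Omega>. lift u q +\<^sub>T lift w q) = lift (\<lambda>x. u x + w x)"
proof
  fix p
  show "(\<lambda>q\<in>\<Omega>. lift u q +\<^sub>T lift w q) p = lift (\<lambda>x. u x + w x) p"
  proof (cases "p \<in> \<Omega>")
    case True
    then show ?thesis
      using c patch_cdom[OF True]
      by (intro tangent_eqI[of _ p _ c])
        (auto simp: lift_def vcomp_coord_vec_same intro!: tadd_tangent coord_vec_in_tangent_space)
  qed (simp add: lift_def)
qed

lemma tscale_lift:
  assumes "\<And>p. p \<in> \<Omega> \<Longrightarrow> f p = a (cmap c p)"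
  shows "(\<lambda>q\<in>\<Omega>. f q *\<^sub>T lift w q) = lift (\<lambda>x. a x *\<^sub>R w x)"
proof
  fix p
  show "(\<lambda>q\<in>\<Omega>. f q *\<^sub>T lift w q) p = lift (\<lambda>x. a x *\<^sub>R w x) p"
  proof (cases "p \<in> \<Omega>")
    case True
    then show ?thesis
      using c patch_cdom[OF True] assms[OF True]
      by (intro tangent_eqI[of _ p _ c])
        (auto simp: lift_def vcomp_coord_vec_same intro!: tscale_tangent coord_vec_in_tangent_space)
  qed (simp add: lift_def)
qed

lemma smooth_functionI:
  assumes "smooth_on B a" "\<And>p. p \<in> \<Omega> \<Longrightarrow> f p = a (cmap c p)"
  shows "f \<in> smooth_functions \<A> \<Omega>"
  unfolding smooth_functions_def
proof (rule CollectI, rule ballI)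
  fix c' assume c': "c' \<in> \<A>"
  show "smooth_on (cmap c' ` (cdom c' \<inter> \<Omega>)) (\<lambda>x. f (cinv c' x))"
    by (rule smooth_on_eq[OF smooth_on_chart_change[OF assms(1) c']])
      (use c' in \<open>auto simp: cinv_cmap intro: assms(2)\<close>)
qed

lemma smooth_functionD: "f \<in> smooth_functions \<A> \<Omega> \<Longrightarrow> smooth_on B (\<lambda>x. f (cinv c x))"
  using c patch_subset unfolding smooth_functions_def by (auto simp: Int_absorb1)

lemma dir_deriv_patch:
  assumes "smooth_on B a" "\<And>p. p \<in> \<Omega> \<Longrightarrow> f p = a (cmap c p)" "p \<in> \<Omega>" "v \<in> tangent_space \<A> p"
  shows "dir_deriv \<A> v f = pd (vcomp c v) a (cmap c p)"
proof -
  have "dir_deriv \<A> v f = pd (vcomp c v) (f \<circ> cinv c) (cmap c p)"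
    using assms(3,4) dir_deriv_chart[OF _ c _ smooth_functionI[OF assms(1,2)] open_patch]
    by (auto simp: tangent_space_def patch_cdom pd_def)
  also have "\<dots> = pd (vcomp c v) a (cmap c p)"
    using assms by (intro pd_cong[OF open_B]) (auto simp: cinv_patch)
  finally show ?thesis .
qed

lemma dir_deriv_VF:
  assumes "smooth_on B a" "\<And>p. p \<in> \<Omega> \<Longrightarrow> f p = a (cmap c p)" "p \<in> \<Omega>" "X \<in> VF"
  shows "dir_deriv \<A> (X p) f = pd (comps X (cmap c p)) a (cmap c p)"
  using dir_deriv_patch[OF assms(1-3) VF_tangent[OF assms(4,3)]] by (simp add: vcomp_comps assms(3))

lemma smooth_pd_field:
  fixes a :: "real ^ 'n \<Rightarrow> 'x::euclidean_space"
  assumes "smooth_on B a" "smooth_on B w"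
  shows "smooth_on B (\<lambda>x. pd (w x) a x)"
  unfolding pd_def
  by (rule smooth_on_deriv_field[OF assms(1) open_B uB _ _ assms(2)])
    (auto simp: smooth_on_linear uB bounded_linear_ident)

text \<open>The second derivatives of the test function cancel by symmetry, which leaves a
  derivation of first order. The coordinate functions, taken as test functions, recover the
  components and hence the uniqueness of the field.\<close>

lemma lie_bracket_patch:
  assumes X: "X \<in> VF" and Y: "Y \<in> VF"
  shows "lie_bracket \<A> \<Omega> X Y =
    lift (\<lambda>x. pd (comps X x) (comps Y) x - pd (comps Y x) (comps X) x)"
  unfolding lie_bracket_def
proof (rule the_equality)
  let ?z = "\<lambda>x. pd (comps X x) (comps Y) x - pd (comps Y x) (comps X) x"
  have sz: "smooth_on B ?z"
    by (intro smooth_on_diff uB smooth_pd_field smooth_comps X Y)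
  have bracket: "dir_deriv \<A> (X p) (\<lambda>q. dir_deriv \<A> (Y q) f) - dir_deriv \<A> (Y p) (\<lambda>q. dir_deriv \<A> (X q) f)
      = pd (?z (cmap c p)) a (cmap c p)"
    if a: "smooth_on B a" "\<And>p. p \<in> \<Omega> \<Longrightarrow> f p = a (cmap c p)" and p: "p \<in> \<Omega>" for f a p
  proof -
    let ?x = "cmap c p"
    have x: "?x \<in> B" using p by blast
    have D: "dir_deriv \<A> (X p) (\<lambda>q. dir_deriv \<A> (Y q) f)
        = pd (comps X ?x) (pd (comps Y ?x) a) ?x + pd (pd (comps X ?x) (comps Y) ?x) a ?x"
      if X: "X \<in> VF" and Y: "Y \<in> VF" for X Y
    proof -
      have "dir_deriv \<A> (X p) (\<lambda>q. dir_deriv \<A> (Y q) f)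
          = pd (comps X ?x) (\<lambda>x. pd (comps Y x) a x) ?x"
        by (rule dir_deriv_VF[OF smooth_pd_field[OF a(1) smooth_comps[OF Y]] dir_deriv_VF[OF a _ Y] p X])
      also have "\<dots> = pd (comps X ?x) (pd (comps Y ?x) a) ?x + pd (pd (comps X ?x) (comps Y) ?x) a ?x"
      proof (rule pd_eqI)
        have "((\<lambda>x. x) has_derivative (\<lambda>k. k)) (at ?x within B)"
          by (rule has_derivative_ident)
        from has_derivative_pd_field[OF a(1) open_B _ x this
            has_derivative_at_withinI[OF smooth_on_has_pd[OF smooth_comps[OF Y] open_B x]]]
        show "((\<lambda>x. pd (comps Y x) a x) has_derivative
            (\<lambda>k. pd k (pd (comps Y ?x) a) ?x + pd (pd k (comps Y) ?x) a ?x)) (at ?x)"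
          using at_within_open[OF x open_B] by simp
      qed
      finally show ?thesis .
    qed
    show ?thesis
      using pd_commute[OF a(1) open_B x, of "comps X ?x" "comps Y ?x"]
        linear_diff[OF pd_linear[OF a(1) open_B x]]
      by (simp add: D X Y)
  qed
  have fa: "smooth_on B (\<lambda>x. f (cinv c x)) \<and> (\<forall>p\<in>\<Omega>. f p = f (cinv c (cmap c p)))"
    if "f \<in> smooth_functions \<A> \<Omega>" for f
    using smooth_functionD[OF that] by (simp add: cinv_patch)
  show "lift ?z \<in> VF \<and> (\<forall>f\<in>smooth_functions \<A> \<Omega>. \<forall>p\<in>\<Omega>. dir_deriv \<A> (lift ?z p) f =
      dir_deriv \<A> (X p) (\<lambda>q. dir_deriv \<A> (Y q) f) - dir_deriv \<A> (Y p) (\<lambda>q. dir_deriv \<A> (X q) f))"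
  proof (intro conjI ballI)
    show "lift ?z \<in> VF" by (rule lift_in_VF[OF sz])
    fix f p assume f: "f \<in> smooth_functions \<A> \<Omega>" and p: "p \<in> \<Omega>"
    then have x: "cmap c p \<in> B" by blast
    have "dir_deriv \<A> (lift ?z p) f = pd (?z (cmap c p)) (\<lambda>x. f (cinv c x)) (cmap c p)"
      using dir_deriv_VF[of "\<lambda>x. f (cinv c x)" f p "lift ?z"] fa[OF f] p lift_in_VF[OF sz]
      by (simp add: comps_lift[OF x])
    then show "dir_deriv \<A> (lift ?z p) f =
        dir_deriv \<A> (X p) (\<lambda>q. dir_deriv \<A> (Y q) f) - dir_deriv \<A> (Y p) (\<lambda>q. dir_deriv \<A> (X q) f)"
      using bracket[of "\<lambda>x. f (cinv c x)" f p] fa[OF f] p by simp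
  qed
  fix Z
  assume Z: "Z \<in> VF \<and> (\<forall>f\<in>smooth_functions \<A> \<Omega>. \<forall>p\<in>\<Omega>. dir_deriv \<A> (Z p) f =
      dir_deriv \<A> (X p) (\<lambda>q. dir_deriv \<A> (Y q) f) - dir_deriv \<A> (Y p) (\<lambda>q. dir_deriv \<A> (X q) f))"
  show "Z = lift ?z"
  proof (rule VF_eqI)
    show "Z \<in> VF" "lift ?z \<in> VF" using Z lift_in_VF[OF sz] by auto
    fix x assume x: "x \<in> B"
    then obtain p where p: "p \<in> \<Omega>" "x = cmap c p" by blast
    have "comps Z x $ i = ?z x $ i" for i
    proof -
      have a: "smooth_on B (\<lambda>x. x $ i)"
        by (rule smooth_on_linear[OF uB bounded_linear_vec_nth])
      have d: "pd h (\<lambda>x. x $ i) (cmap c p) = h $ i" for h :: "real ^ 'n"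
        by (rule pd_eqI, rule bounded_linear_imp_has_derivative, rule bounded_linear_vec_nth)
      have f: "(\<lambda>p. cmap c p $ i) \<in> smooth_functions \<A> \<Omega>"
        by (rule smooth_functionI[OF a]) simp
      have "dir_deriv \<A> (Z p) (\<lambda>p. cmap c p $ i) = comps Z x $ i"
        using dir_deriv_VF[OF a, of "\<lambda>p. cmap c p $ i" p Z] p Z by (simp add: d del: vector_minus_component)
      moreover have "dir_deriv \<A> (Z p) (\<lambda>p. cmap c p $ i) = ?z x $ i"
        using Z f p bracket[OF a, of "\<lambda>p. cmap c p $ i" p] unfolding d by simp
      ultimately show ?thesis by simp
    qed
    then show "comps Z x = comps (lift ?z) x"
      by (simp add: comps_lift[OF x] vec_eq_iff)
  qed
qed

end

section \<open>Pseudo-Finsler metrics in coordinates\<close>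

definition metric_of ::
  "((real ^ 'n) \<times> (real ^ 'n) \<Rightarrow> real) \<Rightarrow> (real ^ 'n) \<times> (real ^ 'n) \<Rightarrow> real ^ 'n \<Rightarrow> real ^ 'n \<Rightarrow> real" where
  "metric_of F z u w = 1/2 * pd (0, u) (pd (0, w) F) z"

definition cartan_of ::
  "((real ^ 'n) \<times> (real ^ 'n) \<Rightarrow> real) \<Rightarrow> (real ^ 'n) \<times> (real ^ 'n) \<Rightarrow>
     real ^ 'n \<Rightarrow> real ^ 'n \<Rightarrow> real ^ 'n \<Rightarrow> real" where
  "cartan_of F z u w v = 1/4 * pd (0, v) (pd (0, w) (pd (0, u) F)) z"

definition metric_dx ::
  "((real ^ 'n) \<times> (real ^ 'n) \<Rightarrow> real) \<Rightarrow> (real ^ 'n) \<times> (real ^ 'n) \<Rightarrow>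
     real ^ 'n \<Rightarrow> real ^ 'n \<Rightarrow> real ^ 'n \<Rightarrow> real" where
  "metric_dx F z h u w = pd (h, 0) (\<lambda>z. metric_of F z u w) z"

text \<open>The tensors are taken at the point \<open>z\<close> of the bundle, and its fibre
  coordinate \<open>snd z\<close> is the reference vector. The constants of
  \<open>chern_data\<close> are total, but their properties are available only where its assumptions
  hold.\<close>

definition chern_of ::
  "((real ^ 'n) \<times> (real ^ 'n) \<Rightarrow> real) \<Rightarrow> (real ^ 'n) \<times> (real ^ 'n) \<Rightarrow>
     real ^ 'n \<Rightarrow> real ^ 'n \<Rightarrow> real ^ 'n" where
  "chern_of F z = chern_data.chern (metric_of F z) (cartan_of F z) (metric_dx F z) (snd z)"

locale local_metric =
  fixes F :: "(real ^ 'n) \<times> (real ^ 'n) \<Rightarrow> real" and U :: "((real ^ 'n) \<times> (real ^ 'n)) set"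
  assumes open_U: "open U" and smooth_F: "smooth_on U F"
    and homogeneous: "(x, y) \<in> U \<Longrightarrow> 0 < r \<Longrightarrow> (x, r *\<^sub>R y) \<in> U \<and> F (x, r *\<^sub>R y) = r\<^sup>2 * F (x, y)"
    and nondegenerate: "z \<in> U \<Longrightarrow> (\<And>w. metric_of F z u w = 0) \<Longrightarrow> u = 0"
begin

abbreviation "g \<equiv> metric_of F"
abbreviation "C \<equiv> cartan_of F"
abbreviation "d \<equiv> metric_dx F"
abbreviation "\<Gamma> \<equiv> chern_of F"

lemma uU: "unique_deriv U"
  by (rule unique_deriv_open[OF open_U])

lemma smooth_F1: "smooth_on U (pd a F)"
  by (rule smooth_on_pd[OF smooth_F open_U])

lemma smooth_F2: "smooth_on U (pd b (pd a F))"
  by (rule smooth_on_pd[OF smooth_F1 open_U])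

lemma smooth_F3: "smooth_on U (pd e (pd b (pd a F)))"
  by (rule smooth_on_pd[OF smooth_F2 open_U])

lemma pd3_commute:
  assumes "z \<in> U"
  shows "pd e (pd b (pd a F)) z = pd e (pd a (pd b F)) z"
    and "pd e (pd b (pd a F)) z = pd b (pd e (pd a F)) z"
proof -
  show "pd e (pd b (pd a F)) z = pd e (pd a (pd b F)) z"
    by (rule pd_cong[OF open_U assms]) (rule pd_commute[OF smooth_F open_U])
  show "pd e (pd b (pd a F)) z = pd b (pd e (pd a F)) z"
    by (rule pd_commute[OF smooth_F1 open_U assms])
qed

lemma metric_sym: "z \<in> U \<Longrightarrow> g z u w = g z w u"
  unfolding metric_of_def using pd_commute[OF smooth_F open_U] by simp

lemma smooth_metric: "smooth_on U (\<lambda>z. g z u w)"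
  unfolding metric_of_def by (intro smooth_on_mult uU smooth_on_const smooth_F2)

lemma smooth_cartan: "smooth_on U (\<lambda>z. C z u w v)"
  unfolding cartan_of_def by (intro smooth_on_mult uU smooth_on_const smooth_F3)

lemma smooth_metric_dx: "smooth_on U (\<lambda>z. d z h u w)"
  unfolding metric_dx_def by (rule smooth_on_pd[OF smooth_metric open_U])

lemma pd_metric: "z \<in> U \<Longrightarrow> pd h (\<lambda>z. g z u w) z = 1/2 * pd h (pd (0, u) (pd (0, w) F)) z"
  unfolding metric_of_def
  by (rule pd_eqI, rule has_derivative_mult_right, rule smooth_on_has_pd[OF smooth_F2 open_U])

text \<open>The origin of the factor 2 in almost compatibility: the metric carries
  \<open>1/2\<close> of a second fibre derivative, the Cartan tensor \<open>1/4\<close> of a third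
  one.\<close>

lemma pd_metric_vertical: "z \<in> U \<Longrightarrow> pd (0, v) (\<lambda>z. g z u w) z = 2 * C z u w v"
  unfolding pd_metric cartan_of_def using pd3_commute(1)[of z "(0, v)" "(0, u)" "(0, w)"] by simp

lemma pd_metric_split:
  assumes "z \<in> U"
  shows "pd (h, v) (\<lambda>z. g z u w) z = d z h u w + 2 * C z u w v"
  using linear_add[OF pd_linear[OF smooth_metric open_U assms], of "(h, 0)" "(0, v)"]
  by (simp add: pd_metric_vertical[OF assms] metric_dx_def)

text \<open>Here \<open>u\<close> is the direction of an inner derivative, where linearity is not
  visible; exchanging derivatives brings it to the outside.\<close>

lemma linear_pd_metric:
  assumes "z \<in> U"
  shows "linear (\<lambda>u. pd h (\<lambda>z. g z u w) z)"
proof -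
  have "pd h (\<lambda>z. g z u w) z = 1/2 * pd (0, u) (pd h (pd (0, w) F)) z" for u
    using pd_metric[OF assms] pd3_commute(2)[OF assms] by simp
  moreover have "linear (\<lambda>u. 1/2 * pd (0, u) (pd h (pd (0, w) F)) z)"
    by (rule linear_pd_Pair(2)[OF smooth_F2 open_U assms])
  ultimately show ?thesis by presburger
qed

text \<open>The proof differentiates Euler's relation twice in the fibre.\<close>

lemma cartan_vanishes:
  assumes z: "z \<in> U"
  shows "C z (snd z) u w = 0"
proof -
  have euler: "pd (0, snd z) F z = 2 * F z" if "z \<in> U" for z
  proof -
    obtain x y where xy: "z = (x, y)" by (cases z)
    have "((\<lambda>s. F ((x, 0) + s *\<^sub>R (0, y))) has_real_derivative
        pd (0, y) F ((x, 0) + 1 *\<^sub>R (0, y))) (at 1)"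
      by (rule deriv_along_line[OF smooth_F open_U]) (use that xy in simp)
    then have "((\<lambda>s. F (x, s *\<^sub>R y)) has_real_derivative pd (0, y) F (x, y)) (at 1)"
      by simp
    then have "((\<lambda>s. s\<^sup>2 * F (x, y)) has_real_derivative pd (0, y) F (x, y)) (at 1)"
      by (rule has_field_derivative_transform_within_open[OF _ open_greaterThan[of 0]])
        (use homogeneous[of x y] that xy in auto)
    moreover have "((\<lambda>s. s\<^sup>2 * F (x, y)) has_real_derivative 2 * F (x, y)) (at 1)"
      by (auto intro!: derivative_eq_intros)
    ultimately show ?thesis
      using DERIV_unique xy by auto
  qed
  have snd': "((\<lambda>z. (0 :: real ^ 'n, snd z)) has_derivative (\<lambda>k. (0, snd k))) (at z within U)" for z
    by (auto intro!: derivative_eq_intros)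
  have step: "pd k (pd (0, snd z) f) z + pd (0, snd k) f z = pd k (\<lambda>z. pd (0, snd z) f z) z"
    if "smooth_on U f" "z \<in> U" for f z and k :: "(real ^ 'n) \<times> (real ^ 'n)"
  proof (rule pd_eqI[symmetric])
    show "((\<lambda>z. pd (0, snd z) f z) has_derivative
        (\<lambda>k. pd k (pd (0, snd z) f) z + pd (0, snd k) f z)) (at z)"
      using has_derivative_pd_field[OF that(1) open_U _ that(2) has_derivative_ident snd']
        at_within_open[OF that(2) open_U] by simp
  qed
  \<comment> \<open>Euler's relation for a fibre derivative of \<open>F\<close>, which is
    homogeneous of degree one.\<close>
  have euler1: "pd (0, snd z) (pd (0, u) F) z = pd (0, u) F z" if "z \<in> U" for z
  proof -
    have "pd (0, u) (\<lambda>z. pd (0, snd z) F z) z = pd (0, u) (\<lambda>z. 2 * F z) z"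
      by (rule pd_cong[OF open_U that]) (rule euler)
    also have "\<dots> = 2 * pd (0, u) F z"
      by (rule pd_eqI, rule has_derivative_mult_right, rule smooth_on_has_pd[OF smooth_F open_U that])
    finally show ?thesis
      using step[OF smooth_F that, of "(0, u)"] pd_commute[OF smooth_F open_U that, of "(0, u)"]
      by simp
  qed
  \<comment> \<open>The second fibre derivatives have degree zero, so their derivative along the
    fibre coordinate vanishes.\<close>
  have "pd (0, w) (\<lambda>z. pd (0, snd z) (pd (0, u) F) z) z = pd (0, w) (pd (0, u) F) z"
    by (rule pd_cong[OF open_U z]) (rule euler1)
  then have "pd (0, w) (pd (0, snd z) (pd (0, u) F)) z = 0"
    using step[OF smooth_F1 z, of "(0, w)" "(0, u)"] by simp
  then show ?thesis
    using pd3_commute(1)[OF z, of "(0, w)" "(0, u)" "(0, snd z)"] by (simp add: cartan_of_def)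
qed

lemma chern_data: 
  assumes z: "z \<in> U"
  shows "chern_data (g z) (C z) (d z) (snd z)"
proof (rule chern_data.intro)
  fix u w v h r
  show "g z u w = g z w u" by (rule metric_sym[OF z])
  have "linear (\<lambda>w. g z w u)"
    unfolding metric_of_def by (rule linear_pd_Pair(2)[OF smooth_F1 open_U z])
  then show "linear (g z u)"
    using metric_sym[OF z, of u] by presburger
  show "u = 0" if "\<And>w. g z u w = 0" by (rule nondegenerate[OF z that])
  show "linear (C z u w)"
    unfolding cartan_of_def by (rule linear_pd_Pair(2)[OF smooth_F2 open_U z])
  show "C z u w v = C z w u v" "C z u w v = C z u v w"
    unfolding cartan_of_def
    using pd3_commute(1)[OF z, of "(0, v)" "(0, w)" "(0, u)"] pd3_commute(2)[OF z, of "(0, v)" "(0, w)" "(0, u)"]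
    by simp_all
  show "C z (snd z) u w = 0" by (rule cartan_vanishes[OF z])
  show "linear (\<lambda>h. d z h u w)"
    using linear_pd_Pair(1)[OF smooth_metric open_U z, of 1] unfolding metric_dx_def by simp
  show dsym: "d z u w v = d z u v w" for u w v
    unfolding metric_dx_def by (rule pd_cong[OF open_U z]) (rule metric_sym)
  have "linear (\<lambda>w. d z u w v)" for v
    unfolding metric_dx_def by (rule linear_pd_metric[OF z])
  then show "linear (d z u w)"
    using dsym[of u w] by presburger
qed

lemma \<Gamma>_props:
  assumes z: "z \<in> U"
  shows chern_of_sym: "\<Gamma> z u w = \<Gamma> z w u"
    and chern_of_linear: "linear (\<Gamma> z u)" "linear (\<lambda>u. \<Gamma> z u w)"
    and chern_of_compatible: "d z u w v = g z (\<Gamma> z u w) v + g z w (\<Gamma> z u v) + 2 * C z w v (\<Gamma> z u (snd z))"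
  unfolding chern_of_def
  by (rule chern_data.chern_sym chern_data.chern_linear chern_data.chern_linear'
      chern_data.chern_compatible, rule chern_data[OF z])+

text \<open>By the index formulas each component is a sum of products of smooth functions, the
  inverse metric being smooth by nondegeneracy.\<close>

lemma smooth_chern: "smooth_on U (\<lambda>z. \<Gamma> z (axis j 1) (axis i 1) $ s)"
proof -
  let ?e = "\<lambda>i. axis i 1 :: real ^ 'n"
  let ?h = "\<lambda>z. matrix_inv (chern_data.gmat (g z))"
  let ?gam = "\<lambda>z. chern_data.gam_up (g z) (d z)"
  let ?N = "\<lambda>z. chern_data.nonlin (g z) (C z) (d z) (snd z)"
  have h: "smooth_on U (\<lambda>z. ?h z $ i $ j)" for i j
  proof (rule smooth_on_matrix_inv[OF uU])
    show "smooth_on U (\<lambda>z. chern_data.gmat (g z) $ i $ j)" for i j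
      by (rule smooth_on_eq[OF smooth_metric[of "?e i" "?e j"]])
        (simp add: chern_data.gmat_def[OF chern_data])
    show "det (chern_data.gmat (g z)) \<noteq> 0" if "z \<in> U" for z
      by (rule chern_data.det_gmat[OF chern_data[OF that]])
  qed
  have gam: "smooth_on U (\<lambda>z. ?gam z s j k)" for s j k
  proof (rule smooth_on_eq)
    show "smooth_on U (\<lambda>z. \<Sum>i\<in>UNIV. ?h z $ s $ i * (1/2 * (d z (?e k) (?e i) (?e j)
        - d z (?e i) (?e j) (?e k) + d z (?e j) (?e k) (?e i))))"
      by (intro smooth_on_sum smooth_on_mult smooth_on_add smooth_on_diff smooth_on_const uU h
          smooth_metric_dx)
  qed (simp add: chern_data.gam_up_def[OF chern_data] chern_data.gam_def[OF chern_data])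
  have y: "smooth_on U (\<lambda>z. snd z $ i)" for i
    by (rule smooth_on_vec_nth[OF uU]) (simp add: smooth_on_linear uU bounded_linear_snd)
  have N: "smooth_on U (\<lambda>z. ?N z (?e j) $ s)" for j s
    by (rule smooth_on_eq[OF _ chern_data.nonlin_nth[OF chern_data]])
      (intro smooth_on_sum smooth_on_mult smooth_on_diff uU h gam y smooth_cartan)
  show ?thesis
    unfolding chern_of_def
    by (rule smooth_on_eq[OF _ chern_data.chern_nth[OF chern_data]])
      (intro smooth_on_sum smooth_on_mult smooth_on_diff smooth_on_add smooth_on_minus uU h gam N smooth_cartan)
qed

lemma chern_of_expansion:
  assumes "z \<in> U"
  shows "\<Gamma> z u w $ s = (\<Sum>i\<in>UNIV. \<Sum>j\<in>UNIV. u $ i * w $ j * \<Gamma> z (axis i 1) (axis j 1) $ s)"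
proof -
  have "\<Gamma> z u w = (\<Sum>i\<in>UNIV. u $ i *\<^sub>R (\<Sum>j\<in>UNIV. w $ j *\<^sub>R \<Gamma> z (axis i 1) (axis j 1)))"
    by (subst linear_axis_expansion[OF chern_of_linear(2)[OF assms]],
        subst linear_axis_expansion[OF chern_of_linear(1)[OF assms]]) (rule refl)
  then show ?thesis
    by (simp add: sum_distrib_left mult.assoc)
qed

lemma smooth_chern_field:
  fixes u w :: "'a::euclidean_space \<Rightarrow> real ^ 'n"
  assumes S: "unique_deriv S" and z: "smooth_on S z" "z ` S \<subseteq> U" and u: "smooth_on S u" and w: "smooth_on S w"
  shows "smooth_on S (\<lambda>t. \<Gamma> (z t) (u t) (w t))"
proof (rule smooth_on_vecI[OF S])
  fix s
  have "smooth_on S (\<lambda>t. \<Gamma> (z t) (axis i 1) (axis j 1) $ s)" for i j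
    by (rule smooth_on_compose[OF S open_U z(2,1) smooth_chern])
  then have "smooth_on S (\<lambda>t. \<Sum>i\<in>UNIV. \<Sum>j\<in>UNIV.
      u t $ i * w t $ j * \<Gamma> (z t) (axis i 1) (axis j 1) $ s)"
    by (intro smooth_on_sum smooth_on_mult smooth_on_vec_nth[OF S u] smooth_on_vec_nth[OF S w] S)
  then show "smooth_on S (\<lambda>t. \<Gamma> (z t) (u t) (w t) $ s)"
    by (rule smooth_on_eq) (use z(2) in \<open>auto intro: chern_of_expansion\<close>)
qed

text \<open>The metric varies by \<open>d\<close> in the base velocity plus twice the Cartan tensor
  in the fibre velocity. Compatibility rewrites \<open>d\<close> through \<open>\<Gamma>\<close>,
  and every ordinary derivative is completed to a covariant one. The derivative within an arbitrary
  \<open>R\<close> covers patches as well as curves.\<close>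

lemma metric_has_derivative:
  assumes zU: "\<And>s. s \<in> R \<Longrightarrow> (\<xi> s, \<eta> s) \<in> U" and t: "t \<in> R"
    and \<xi>: "(\<xi> has_derivative \<xi>') (at t within R)" and \<eta>: "(\<eta> has_derivative \<eta>') (at t within R)"
    and Y: "(Y has_derivative Y') (at t within R)" and Z: "(Z has_derivative Z') (at t within R)"
  defines "z \<equiv> (\<xi> t, \<eta> t)"
  shows "((\<lambda>s. g (\<xi> s, \<eta> s) (Y s) (Z s)) has_derivative
    (\<lambda>k. g z (Y' k + \<Gamma> z (\<xi>' k) (Y t)) (Z t) + g z (Y t) (Z' k + \<Gamma> z (\<xi>' k) (Z t))
      + 2 * C z (Y t) (Z t) (\<eta>' k + \<Gamma> z (\<xi>' k) (\<eta> t)))) (at t within R)"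
proof -
  have z: "z \<in> U" using zU[OF t] by (simp add: z_def)
  interpret chern_data "g z" "C z" "d z" "snd z" by (rule chern_data[OF z])
  \<comment> \<open>\<open>has_derivative_pd_field\<close> lets one direction move. The first
    argument is therefore expanded in the basis and treated by the product rule, and the symmetry of
    the metric makes the second one the outer direction.\<close>
  have expand: "g z u w = (\<Sum>i\<in>UNIV. u $ i * g z (axis i 1) w)" if "z \<in> U" for z u w
    using linear_axis_expansion[OF chern_data.g_linear'[OF chern_data[OF that]], of u w] by simp
  have zz: "((\<lambda>s. (\<xi> s, \<eta> s)) has_derivative (\<lambda>k. (\<xi>' k, \<eta>' k))) (at t within R)"
    by (rule has_derivative_Pair[OF \<xi> \<eta>])
  have 0: "((\<lambda>s. (0, Z s) :: (real ^ 'n) \<times> (real ^ 'n)) has_derivative (\<lambda>k. (0, Z' k))) (at t within R)"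
    by (rule has_derivative_Pair[OF has_derivative_const Z])
  have P: "((\<lambda>s. 1/2 * pd (0, Z s) (pd (0, axis i 1) F) (\<xi> s, \<eta> s)) has_derivative
      (\<lambda>k. 1/2 * (pd (\<xi>' k, \<eta>' k) (pd (0, Z t) (pd (0, axis i 1) F)) z
        + pd (0, Z' k) (pd (0, axis i 1) F) z))) (at t within R)" for i
    unfolding z_def
    by (rule has_derivative_mult_right, rule has_derivative_pd_field[OF smooth_F1 open_U _ t zz 0])
      (use zU in auto)
  have Q: "1/2 * (pd h (pd (0, w) (pd (0, u) F)) z + pd (0, w') (pd (0, u) F) z)
      = pd h (\<lambda>z. g z u w) z + g z u w'" for h u w w'
    using pd_metric[OF z, of h u w] pd3_commute(1)[OF z, of h "(0, u)" "(0, w)"] metric_sym[OF z, of u w']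
    by (simp add: metric_of_def)
  have E: "g (\<xi> s, \<eta> s) u w = 1/2 * pd (0, w) (pd (0, u) F) (\<xi> s, \<eta> s)" if "s \<in> R" for s u w
    using metric_sym[OF zU[OF that], of u w] by (simp add: metric_of_def)
  have i: "((\<lambda>s. g (\<xi> s, \<eta> s) (axis i 1) (Z s)) has_derivative
      (\<lambda>k. pd (\<xi>' k, \<eta>' k) (\<lambda>z. g z (axis i 1) (Z t)) z + g z (axis i 1) (Z' k))) (at t within R)" for i
    by (rule has_derivative_transform[OF t E P[unfolded Q]])
  have "((\<lambda>s. \<Sum>i\<in>UNIV. Y s $ i * g (\<xi> s, \<eta> s) (axis i 1) (Z s)) has_derivative
      (\<lambda>k. \<Sum>i\<in>UNIV. Y t $ i * (pd (\<xi>' k, \<eta>' k) (\<lambda>z. g z (axis i 1) (Z t)) z + g z (axis i 1) (Z' k))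
        + Y' k $ i * g z (axis i 1) (Z t))) (at t within R)"
    unfolding z_def
    by (intro has_derivative_sum has_derivative_mult i[unfolded z_def]
        bounded_linear.has_derivative[OF bounded_linear_vec_nth Y])
  moreover have "(\<Sum>i\<in>UNIV. Y t $ i * (pd (\<xi>' k, \<eta>' k) (\<lambda>z. g z (axis i 1) (Z t)) z + g z (axis i 1) (Z' k))
        + Y' k $ i * g z (axis i 1) (Z t))
      = g z (Y' k + \<Gamma> z (\<xi>' k) (Y t)) (Z t) + g z (Y t) (Z' k + \<Gamma> z (\<xi>' k) (Z t))
      + 2 * C z (Y t) (Z t) (\<eta>' k + \<Gamma> z (\<xi>' k) (\<eta> t))" for k
  proof -
    have "(\<Sum>i\<in>UNIV. Y t $ i * pd (\<xi>' k, \<eta>' k) (\<lambda>z. g z (axis i 1) (Z t)) z)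
        = pd (\<xi>' k, \<eta>' k) (\<lambda>z. g z (Y t) (Z t)) z"
      using linear_axis_expansion[OF linear_pd_metric[OF z], of "(\<xi>' k, \<eta>' k)" "Y t" "Z t"] by simp
    also have "\<dots> = d z (\<xi>' k) (Y t) (Z t) + 2 * C z (Y t) (Z t) (\<eta>' k)"
      by (rule pd_metric_split[OF z])
    also have "d z (\<xi>' k) (Y t) (Z t) = g z (\<Gamma> z (\<xi>' k) (Y t)) (Z t) + g z (Y t) (\<Gamma> z (\<xi>' k) (Z t))
        + 2 * C z (Y t) (Z t) (\<Gamma> z (\<xi>' k) (\<eta> t))"
      using chern_of_compatible[OF z] by (simp add: z_def)
    finally have *: "(\<Sum>i\<in>UNIV. Y t $ i * pd (\<xi>' k, \<eta>' k) (\<lambda>z. g z (axis i 1) (Z t)) z) = \<dots>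
        + 2 * C z (Y t) (Z t) (\<eta>' k)" .
    show ?thesis
      by (simp add: distrib_left sum.distrib * expand[OF z, of "Y t" "Z' k", symmetric]
          expand[OF z, of "Y' k" "Z t", symmetric] g_lin C_lin)
  qed
  ultimately have "((\<lambda>s. \<Sum>i\<in>UNIV. Y s $ i * g (\<xi> s, \<eta> s) (axis i 1) (Z s)) has_derivative
      (\<lambda>k. g z (Y' k + \<Gamma> z (\<xi>' k) (Y t)) (Z t) + g z (Y t) (Z' k + \<Gamma> z (\<xi>' k) (Z t))
      + 2 * C z (Y t) (Z t) (\<eta>' k + \<Gamma> z (\<xi>' k) (\<eta> t)))) (at t within R)"
    by (simp only:)
  then show ?thesis
    by (rule has_derivative_transform[OF t, rotated]) (rule expand[OF zU])
qed

lemma metric_expansion: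
  assumes "z \<in> U"
  shows "g z u w = (\<Sum>i\<in>UNIV. \<Sum>j\<in>UNIV. u $ i * w $ j * g z (axis i 1) (axis j 1))"
proof -
  interpret chern_data "g z" "C z" "d z" "snd z" by (rule chern_data[OF assms])
  have "g z u w = (\<Sum>i\<in>UNIV. u $ i * (\<Sum>j\<in>UNIV. w $ j * g z (axis i 1) (axis j 1)))"
    by (subst linear_axis_expansion[OF g_linear'], subst linear_axis_expansion[OF g_linear]) simp
  then show ?thesis
    by (simp add: sum_distrib_left mult.assoc)
qed

lemma smooth_metric_field:
  fixes u w :: "'a::euclidean_space \<Rightarrow> real ^ 'n"
  assumes S: "unique_deriv S" and z: "smooth_on S z" "z ` S \<subseteq> U" and u: "smooth_on S u" and w: "smooth_on S w"
  shows "smooth_on S (\<lambda>t. g (z t) (u t) (w t))"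
proof -
  have "smooth_on S (\<lambda>t. g (z t) (axis i 1) (axis j 1))" for i j
    by (rule smooth_on_compose[OF S open_U z(2,1) smooth_metric])
  then have "smooth_on S (\<lambda>t. \<Sum>i\<in>UNIV. \<Sum>j\<in>UNIV. u t $ i * w t $ j * g (z t) (axis i 1) (axis j 1))"
    by (intro smooth_on_sum smooth_on_mult smooth_on_vec_nth[OF S u] smooth_on_vec_nth[OF S w] S)
  then show ?thesis
    by (rule smooth_on_eq) (use z(2) in \<open>auto intro: metric_expansion\<close>)
qed

end

section \<open>Pseudo-Finsler manifolds in a chart\<close>

locale finsler = manifold \<A>
  for \<A> :: "('m::{t2_space, second_countable_topology}, 'n::finite) chart set" +
  fixes A :: "('m, 'n) tvec set" and L :: "('m, 'n) tvec \<Rightarrow> real"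
  assumes pseudo_finsler: "pseudo_finsler \<A> A L"
begin

definition F :: "('m, 'n) chart \<Rightarrow> (real ^ 'n) \<times> (real ^ 'n) \<Rightarrow> real" where
  "F c = (\<lambda>(x, y). L (coord_vec \<A> c (cinv c x) y))"

definition U :: "('m, 'n) chart \<Rightarrow> ((real ^ 'n) \<times> (real ^ 'n)) set" where
  "U c = induced_coords c ` {v \<in> A. base v \<in> cdom c}"

lemma A_tangent: "v \<in> A \<Longrightarrow> v \<in> tangent_bundle \<A>"
  using pseudo_finsler by (auto simp: pseudo_finsler_def tb_open_def)

lemma A_tangent_space: "v \<in> A \<Longrightarrow> v \<in> tangent_space \<A> (base v)"
  by (simp add: tangent_space_def A_tangent)

lemma open_U: "c \<in> \<A> \<Longrightarrow> open (U c)"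
  using pseudo_finsler by (auto simp: pseudo_finsler_def tb_open_def U_def)

lemma smooth_F: "c \<in> \<A> \<Longrightarrow> smooth_on (U c) (F c)"
  using pseudo_finsler by (auto simp: pseudo_finsler_def tb_smooth_on_def U_def F_def)

lemma coords_in_U: "v \<in> A \<Longrightarrow> base v \<in> cdom c \<Longrightarrow> (cmap c (base v), vcomp c v) \<in> U c"
  by (auto simp: U_def induced_coords_def)

lemma U_E:
  assumes "z \<in> U c"
  obtains v where "v \<in> A" "base v \<in> cdom c" "z = (cmap c (base v), vcomp c v)"
  using assms by (auto simp: U_def induced_coords_def)

lemma F_coords:
  assumes "c \<in> \<A>" "v \<in> tangent_space \<A> p" "p \<in> cdom c"
  shows "F c (cmap c p, vcomp c v) = L v"
  using assms coord_vec_vcomp[of v c] by (auto simp: F_def cinv_cmap tangent_space_def)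

text \<open>\<open>U c\<close> is an image, so the pair belongs to some vector of \<open>A\<close>;
  the chart is injective and the components determine the vector, hence it is this one.\<close>

lemma coord_vec_in_A:
  assumes "c \<in> \<A>" "p \<in> cdom c" "(cmap c p, y) \<in> U c"
  shows "coord_vec \<A> c p y \<in> A"
proof -
  obtain v where v: "v \<in> A" "base v \<in> cdom c" "cmap c p = cmap c (base v)" "y = vcomp c v"
    using U_E[OF assms(3)] by (metis prod.inject)
  then have "base v = p"
    using assms cinv_cmap by metis
  then show ?thesis
    using v coord_vec_vcomp[OF A_tangent assms(1), of v] by simp
qed

lemma U_point:
  assumes "c \<in> \<A>" "(x, y) \<in> U c"
  shows "cinv c x \<in> cdom c" "cmap c (cinv c x) = x" "coord_vec \<A> c (cinv c x) y \<in> A"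
proof -
  obtain v where v: "v \<in> A" "base v \<in> cdom c" "x = cmap c (base v)"
    using U_E[OF assms(2)] by (metis prod.inject)
  then show *: "cinv c x \<in> cdom c" "cmap c (cinv c x) = x"
    using assms(1) cinv_cmap by auto
  show "coord_vec \<A> c (cinv c x) y \<in> A"
    by (rule coord_vec_in_A[OF assms(1) *(1)]) (simp add: * assms)
qed

lemma fund_tensor_chart:
  assumes c: "c \<in> \<A>" "p \<in> cdom c" and v: "v \<in> A" "base v = p"
    and u: "u \<in> tangent_space \<A> p" and w: "w \<in> tangent_space \<A> p"
  shows "fund_tensor L v u w = metric_of (F c) (cmap c p, vcomp c v) (vcomp c u) (vcomp c w)"
proof -
  let ?z = "(cmap c p, vcomp c v)"
  have z: "?z \<in> U c" using coords_in_U[OF v(1), of c] v c by simp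
  have "deriv (\<lambda>t. deriv (\<lambda>s. L (v +\<^sub>T t *\<^sub>T u +\<^sub>T s *\<^sub>T w)) 0) 0
      = pd (0, vcomp c u) (pd (0, vcomp c w) (F c)) ?z"
  proof (rule deriv_line[OF smooth_on_pd[OF smooth_F[OF c(1)] open_U[OF c(1)]] open_U[OF c(1)] z])
    \<comment> \<open>The restriction to \<open>U c\<close> matters: only there is the inner
      \<open>deriv\<close> known to be a directional derivative of \<open>F c\<close>.\<close>
    fix t assume t: "?z + t *\<^sub>R (0, vcomp c u) \<in> U c"
    show "deriv (\<lambda>s. L (v +\<^sub>T t *\<^sub>T u +\<^sub>T s *\<^sub>T w)) 0
        = pd (0, vcomp c w) (F c) (?z + t *\<^sub>R (0, vcomp c u))"
    proof (rule deriv_line[OF smooth_F[OF c(1)] open_U[OF c(1)] t])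
      fix s
      have "v +\<^sub>T t *\<^sub>T u +\<^sub>T s *\<^sub>T w \<in> tangent_space \<A> p"
        using A_tangent_space[OF v(1)] v u w by (intro tadd_tangent tscale_tangent) auto
      from F_coords[OF c(1) this c(2)]
      show "L (v +\<^sub>T t *\<^sub>T u +\<^sub>T s *\<^sub>T w)
          = F c (?z + t *\<^sub>R (0, vcomp c u) + s *\<^sub>R (0, vcomp c w))"
        by simp
    qed
  qed
  then show ?thesis
    by (simp add: fund_tensor_def metric_of_def)
qed

lemma cartan_tensor_chart:
  assumes c: "c \<in> \<A>" "p \<in> cdom c" and v: "v \<in> A" "base v = p"
    and u: "u1 \<in> tangent_space \<A> p" "u2 \<in> tangent_space \<A> p" "u3 \<in> tangent_space \<A> p"
  shows "cartan_tensor L v u1 u2 u3 =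
    cartan_of (F c) (cmap c p, vcomp c v) (vcomp c u1) (vcomp c u2) (vcomp c u3)"
proof -
  let ?z = "(cmap c p, vcomp c v)"
  have z: "?z \<in> U c" using coords_in_U[OF v(1), of c] v c by simp
  note sm = smooth_F[OF c(1)] open_U[OF c(1)]
  have "deriv (\<lambda>s3. deriv (\<lambda>s2. deriv (\<lambda>s1.
       L (v +\<^sub>T s1 *\<^sub>T u1 +\<^sub>T s2 *\<^sub>T u2 +\<^sub>T s3 *\<^sub>T u3)) 0) 0) 0
      = pd (0, vcomp c u3) (pd (0, vcomp c u2) (pd (0, vcomp c u1) (F c))) ?z"
  proof (rule deriv_line[OF smooth_on_pd[OF smooth_on_pd[OF sm] sm(2)] sm(2) z])
    fix s3 assume s3: "?z + s3 *\<^sub>R (0, vcomp c u3) \<in> U c"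
    show "deriv (\<lambda>s2. deriv (\<lambda>s1. L (v +\<^sub>T s1 *\<^sub>T u1 +\<^sub>T s2 *\<^sub>T u2 +\<^sub>T s3 *\<^sub>T u3)) 0) 0
        = pd (0, vcomp c u2) (pd (0, vcomp c u1) (F c)) (?z + s3 *\<^sub>R (0, vcomp c u3))"
    proof (rule deriv_line[OF smooth_on_pd[OF sm] sm(2) s3])
      fix s2 assume s2: "?z + s3 *\<^sub>R (0, vcomp c u3) + s2 *\<^sub>R (0, vcomp c u2) \<in> U c"
      show "deriv (\<lambda>s1. L (v +\<^sub>T s1 *\<^sub>T u1 +\<^sub>T s2 *\<^sub>T u2 +\<^sub>T s3 *\<^sub>T u3)) 0
        = pd (0, vcomp c u1) (F c) (?z + s3 *\<^sub>R (0, vcomp c u3) + s2 *\<^sub>R (0, vcomp c u2))"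
      proof (rule deriv_line[OF sm s2])
        fix s1
        have "v +\<^sub>T s1 *\<^sub>T u1 +\<^sub>T s2 *\<^sub>T u2 +\<^sub>T s3 *\<^sub>T u3 \<in> tangent_space \<A> p"
          using A_tangent_space[OF v(1)] v u by (intro tadd_tangent tscale_tangent) auto
        from F_coords[OF c(1) this c(2)]
        show "L (v +\<^sub>T s1 *\<^sub>T u1 +\<^sub>T s2 *\<^sub>T u2 +\<^sub>T s3 *\<^sub>T u3)
            = F c (?z + s3 *\<^sub>R (0, vcomp c u3) + s2 *\<^sub>R (0, vcomp c u2) + s1 *\<^sub>R (0, vcomp c u1))"
          by (simp add: algebra_simps)
      qed
    qed
  qed
  then show ?thesis
    by (simp add: cartan_tensor_def cartan_of_def)
qed

lemma local_metric:
  assumes c: "c \<in> \<A>"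
  shows "local_metric (F c) (U c)"
proof (rule local_metric.intro)
  show "open (U c)" "smooth_on (U c) (F c)" by (rule open_U[OF c], rule smooth_F[OF c])
next
  fix x y r assume xy: "(x, y) \<in> U c" and r: "0 < (r :: real)"
  obtain v where v: "v \<in> A" "base v \<in> cdom c" "x = cmap c (base v)" "y = vcomp c v"
    using U_E[OF xy] by (metis prod.inject)
  have rv: "r *\<^sub>T v \<in> A" "L (r *\<^sub>T v) = r\<^sup>2 * L v"
    using pseudo_finsler v(1) r by (auto simp: pseudo_finsler_def)
  have "(x, r *\<^sub>R y) \<in> U c"
    using coords_in_U[OF rv(1), of c] v by simp
  moreover have "F c (x, r *\<^sub>R y) = r\<^sup>2 * F c (x, y)"
    using F_coords[OF c A_tangent_space[OF rv(1)], simplified] F_coords[OF c A_tangent_space[OF v(1)]] rv(2) v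
    by simp
  ultimately show "(x, r *\<^sub>R y) \<in> U c \<and> F c (x, r *\<^sub>R y) = r\<^sup>2 * F c (x, y)" by blast
next
  fix z u assume "z \<in> U c" and u: "\<And>w. metric_of (F c) z u w = 0"
  from this(1) obtain v where v: "v \<in> A" "base v \<in> cdom c" "z = (cmap c (base v), vcomp c v)"
    by (rule U_E)
  \<comment> \<open>Every coordinate vector consists of the components of a tangent vector, so
    nondegeneracy of the intrinsic tensor applies.\<close>
  let ?u = "coord_vec \<A> c (base v) u"
  have "fund_tensor L v ?u w = 0" if "w \<in> tangent_space \<A> (base v)" for w
    using fund_tensor_chart[OF c v(2,1) refl coord_vec_in_tangent_space[OF c v(2)] that, of u] u v(3)
    by (simp add: vcomp_coord_vec_same[OF c v(2)])
  then have "?u = tzero (base v)"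
    using pseudo_finsler v(1) coord_vec_in_tangent_space[OF c v(2)]
    unfolding pseudo_finsler_def by blast
  then have "vcomp c ?u = 0"
    by (simp add: tzero_def)
  then show "u = 0"
    by (simp add: vcomp_coord_vec_same[OF c v(2)])
qed

section \<open>Coordinate expressions of the tensors and of the Chern symbols\<close>

lemma g_lo_chart:
  assumes "c \<in> \<A>" "v \<in> A" "base v \<in> cdom c"
  shows "g_lo \<A> L c i j v = metric_of (F c) (cmap c (base v), vcomp c v) (axis i 1) (axis j 1)"
  unfolding g_lo_def
  using fund_tensor_chart[OF assms(1,3,2) refl coord_vec_in_tangent_space coord_vec_in_tangent_space]
    assms by (simp add: vcomp_coord_vec_same)

lemma C_lo_chart:
  assumes "c \<in> \<A>" "v \<in> A" "base v \<in> cdom c"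
  shows "C_lo \<A> L c i j k v =
    cartan_of (F c) (cmap c (base v), vcomp c v) (axis i 1) (axis j 1) (axis k 1)"
  unfolding C_lo_def
  using cartan_tensor_chart[OF assms(1,3,2) refl coord_vec_in_tangent_space
      coord_vec_in_tangent_space coord_vec_in_tangent_space]
    assms by (simp add: vcomp_coord_vec_same)

text \<open>\<open>dx\<close> moves the base point with the fibre components held fixed. While the
  coordinates stay in \<open>U c\<close>, the moved vector lies in \<open>A\<close>, so its
  \<open>g_lo\<close> is again given by the chart.\<close>

lemma dx_g_lo_chart:
  assumes c: "c \<in> \<A>" and v: "v \<in> A" "base v \<in> cdom c"
  shows "dx \<A> c k (g_lo \<A> L c i j) v =
    metric_dx (F c) (cmap c (base v), vcomp c v) (axis k 1) (axis i 1) (axis j 1)"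
  unfolding dx_def metric_dx_def
proof (rule deriv_line[OF local_metric.smooth_metric[OF local_metric[OF c]] open_U[OF c]])
  show "(cmap c (base v), vcomp c v) \<in> U c" by (rule coords_in_U[OF v])
  fix t assume "(cmap c (base v), vcomp c v) + t *\<^sub>R (axis k 1, 0) \<in> U c"
  then have t: "(cmap c (base v) + t *\<^sub>R axis k 1, vcomp c v) \<in> U c" by simp
  note pt = U_point[OF c t]
  show "g_lo \<A> L c i j (coord_vec \<A> c (cinv c (cmap c (base v) + t *\<^sub>R axis k 1)) (vcomp c v))
      = metric_of (F c) ((cmap c (base v), vcomp c v) + t *\<^sub>R (axis k 1, 0)) (axis i 1) (axis j 1)"
    using g_lo_chart[OF c pt(3)] pt by (simp add: vcomp_coord_vec_same[OF c])
qed

lemma chern_christoffel_chart: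
  assumes c: "c \<in> \<A>" and v: "v \<in> A" "base v \<in> cdom c"
  shows "chern_christoffel \<A> L c s j i v =
    chern_of (F c) (cmap c (base v), vcomp c v) (axis j 1) (axis i 1) $ s"
proof -
  let ?z = "(cmap c (base v), vcomp c v)"
  interpret local_metric "F c" "U c" by (rule local_metric[OF c])
  interpret chern_data "g ?z" "C ?z" "d ?z" "vcomp c v"
    using chern_data[OF coords_in_U[OF v]] by simp
  note lo = g_lo_chart[OF c v] C_lo_chart[OF c v] dx_g_lo_chart[OF c v]
  have "g_up \<A> L c i j v = matrix_inv gmat $ i $ j" for i j
    by (simp add: g_up_def gmat_def lo)
  moreover have "gamma_lo \<A> L c i j k v = gam (axis i 1) (axis j 1) (axis k 1)" for i j k
    by (simp add: gamma_lo_def gam_def lo)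
  ultimately have up: "gamma_up \<A> L c s j k v = gam_up s j k"
    "g_up \<A> L c i j v = matrix_inv gmat $ i $ j" for s i j k
    by (simp_all add: gamma_up_def gam_up_def)
  have "N_up \<A> L c s j v = nonlin (axis j 1) $ s" for s j
    by (simp add: N_up_def nonlin_nth up lo)
  then show ?thesis
    unfolding chern_of_def snd_conv chern_nth by (simp add: chern_christoffel_def up lo)
qed

end

section \<open>The connection of an admissible vector field in a chart\<close>

locale finsler_patch = finsler \<A> A L + coord_patch \<A> c \<Omega>
  for \<A> :: "('m::{t2_space, second_countable_topology}, 'n::finite) chart set" and A L c \<Omega> +
  fixes V :: "'m \<Rightarrow> ('m, 'n) tvec"
  assumes V: "V \<in> admissible_fields \<A> A \<Omega>"
begin

sublocale loc: local_metric "F c" "U c"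
  by (rule local_metric[OF c])

definition \<eta> :: "real ^ 'n \<Rightarrow> real ^ 'n" where
  "\<eta> = comps V"

text \<open>In coordinates \<open>V\<close> is this section of the bundle, and all tensors are
  evaluated along it.\<close>

abbreviation z where "z x \<equiv> (x, \<eta> x)"
abbreviation "g x \<equiv> metric_of (F c) (z x)"
abbreviation "C x \<equiv> cartan_of (F c) (z x)"
abbreviation "d x \<equiv> metric_dx (F c) (z x)"
abbreviation "\<Gamma> x \<equiv> chern_of (F c) (z x)"

lemma V_VF: "V \<in> VF" and V_A: "p \<in> \<Omega> \<Longrightarrow> V p \<in> A"
  using V by (auto simp: admissible_fields_def)

lemma base_VF: "X \<in> VF \<Longrightarrow> p \<in> \<Omega> \<Longrightarrow> base (X p) = p"
  using VF_tangent tangent_spaceD by blast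

lemma z_V: "p \<in> \<Omega> \<Longrightarrow> z (cmap c p) = (cmap c p, vcomp c (V p))"
  by (simp add: \<eta>_def vcomp_comps)

lemma z_U: "x \<in> B \<Longrightarrow> z x \<in> U c"
  using coords_in_U[OF V_A, of _ c] by (auto simp: z_V base_VF[OF V_VF] patch_cdom simp del: prod.inject)

lemma smooth_\<eta>: "smooth_on B \<eta>"
  unfolding \<eta>_def by (rule smooth_comps[OF V_VF])

lemma smooth_z: "smooth_on B z"
  by (rule smooth_on_Pair[OF uB smooth_on_linear[OF uB bounded_linear_ident] smooth_\<eta>])

lemma z_image: "z ` B \<subseteq> U c"
  using z_U by blast

lemma fund_tensor_patch:
  assumes "p \<in> \<Omega>" "Y \<in> VF" "Z \<in> VF"
  shows "fund_tensor L (V p) (Y p) (Z p) = g (cmap c p) (comps Y (cmap c p)) (comps Z (cmap c p))"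
  using fund_tensor_chart[OF c patch_cdom V_A base_VF[OF V_VF] VF_tangent VF_tangent] assms
  by (simp add: z_V vcomp_comps del: prod.inject)

lemma cartan_tensor_patch:
  assumes "p \<in> \<Omega>" "X \<in> VF" "Y \<in> VF" "Z \<in> VF"
  shows "cartan_tensor L (V p) (X p) (Y p) (Z p) =
    C (cmap c p) (comps X (cmap c p)) (comps Y (cmap c p)) (comps Z (cmap c p))"
  using cartan_tensor_chart[OF c patch_cdom V_A base_VF[OF V_VF] VF_tangent VF_tangent VF_tangent] assms
  by (simp add: z_V vcomp_comps del: prod.inject)

lemma has_derivative_B:
  assumes "smooth_on B w" "x \<in> B"
  shows "(w has_derivative (\<lambda>h. pd h w x)) (at x within B)"
  by (rule has_derivative_at_withinI[OF smooth_on_has_pd[OF assms(1) open_B assms(2)]])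

text \<open>The last argument of the Cartan term is the covariant derivative of \<open>V\<close> in
  components, so this is already almost compatibility for the connection below.\<close>

lemma pd_metric_fields:
  assumes Y: "smooth_on B Y" and Z: "smooth_on B Z" and x: "x \<in> B"
  shows "pd h (\<lambda>x. g x (Y x) (Z x)) x =
    g x (pd h Y x + \<Gamma> x h (Y x)) (Z x) + g x (Y x) (pd h Z x + \<Gamma> x h (Z x))
      + 2 * C x (Y x) (Z x) (pd h \<eta> x + \<Gamma> x h (\<eta> x))"
proof (rule pd_eqI)
  show "((\<lambda>x. g x (Y x) (Z x)) has_derivative (\<lambda>h.
    g x (pd h Y x + \<Gamma> x h (Y x)) (Z x) + g x (Y x) (pd h Z x + \<Gamma> x h (Z x))
      + 2 * C x (Y x) (Z x) (pd h \<eta> x + \<Gamma> x h (\<eta> x)))) (at x)"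
    using loc.metric_has_derivative[OF z_U x has_derivative_ident has_derivative_B[OF smooth_\<eta> x]
        has_derivative_B[OF Y x] has_derivative_B[OF Z x]]
    unfolding at_within_open[OF x open_B] by blast
qed

lemma smooth_metric_fields: "smooth_on B Y \<Longrightarrow> smooth_on B Z \<Longrightarrow> smooth_on B (\<lambda>x. g x (Y x) (Z x))"
  by (rule loc.smooth_metric_field[OF uB smooth_z z_image])

subsection \<open>Existence\<close>

definition cov :: "('m \<Rightarrow> ('m, 'n) tvec) \<Rightarrow> ('m \<Rightarrow> ('m, 'n) tvec) \<Rightarrow> real ^ 'n \<Rightarrow> real ^ 'n" where
  "cov X Y x = pd (comps X x) (comps Y) x + \<Gamma> x (comps X x) (comps Y x)"

text \<open>Restricted in both arguments because \<open>affine_connection\<close> asks for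
  extensional functions, which makes uniqueness an equality of functions.\<close>

definition conn :: "('m \<Rightarrow> ('m, 'n) tvec) \<Rightarrow> ('m \<Rightarrow> ('m, 'n) tvec) \<Rightarrow> 'm \<Rightarrow> ('m, 'n) tvec" where
  "conn = (\<lambda>X\<in>VF. \<lambda>Y\<in>VF. lift (cov X Y))"

lemma conn_VF: "X \<in> VF \<Longrightarrow> Y \<in> VF \<Longrightarrow> conn X Y \<in> VF"
proof -
  assume X: "X \<in> VF" and Y: "Y \<in> VF"
  have "smooth_on B (cov X Y)"
    unfolding cov_def
    by (intro smooth_on_add uB smooth_pd_field smooth_comps X Y
        loc.smooth_chern_field[OF uB smooth_z z_image])
  then show ?thesis
    by (simp add: conn_def X Y lift_in_VF)
qed

lemma comps_conn: "X \<in> VF \<Longrightarrow> Y \<in> VF \<Longrightarrow> x \<in> B \<Longrightarrow> comps (conn X Y) x = cov X Y x"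
  by (simp add: conn_def comps_lift)

lemma sum_VF: "X \<in> VF \<Longrightarrow> Y \<in> VF \<Longrightarrow> (\<lambda>q\<in>\<Omega>. X q +\<^sub>T Y q) \<in> VF"
  using lift_in_VF[OF smooth_on_add[OF uB smooth_comps smooth_comps], of X Y]
    tadd_lift[of "comps X" "comps Y"] by (simp add: lift_comps)

lemma scale_VF: "f \<in> smooth_functions \<A> \<Omega> \<Longrightarrow> X \<in> VF \<Longrightarrow> (\<lambda>q\<in>\<Omega>. f q *\<^sub>T X q) \<in> VF"
  using lift_in_VF[OF smooth_on_scaleR[OF uB smooth_functionD smooth_comps], of f X]
    tscale_lift[of f "\<lambda>x. f (cinv c x)" "comps X"] by (simp add: lift_comps cinv_patch)

lemma comps_sum: "x \<in> B \<Longrightarrow> comps (\<lambda>q\<in>\<Omega>. X q +\<^sub>T Y q) x = comps X x + comps Y x"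
  by (simp add: comps_def cinv_B)

lemma comps_scale: "x \<in> B \<Longrightarrow> comps (\<lambda>q\<in>\<Omega>. f q *\<^sub>T X q) x = f (cinv c x) *\<^sub>R comps X x"
  by (simp add: comps_def cinv_B)

text \<open>Reduces each axiom of a connection at a point to an identity between components in
  \<open>c\<close>.\<close>

lemma VF_eq_at:
  assumes "X \<in> VF" "p \<in> \<Omega>" "v \<in> tangent_space \<A> p" "comps X (cmap c p) = vcomp c v"
  shows "X p = v"
  using tangent_eqI[OF VF_tangent[OF assms(1,2)] assms(3) c patch_cdom[OF assms(2)]] assms
  by (simp add: vcomp_comps)

lemma cov_add1:
  assumes "X \<in> VF" "X' \<in> VF" "Y \<in> VF" "x \<in> B"
  shows "cov (\<lambda>q\<in>\<Omega>. X q +\<^sub>T X' q) Y x = cov X Y x + cov X' Y x"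
  unfolding cov_def comps_sum[OF assms(4)]
    linear_add[OF pd_linear[OF smooth_comps[OF assms(3)] open_B assms(4)]]
    linear_add[OF loc.chern_of_linear(2)[OF z_U[OF assms(4)]]]
  by simp

lemma cov_scale1:
  assumes "X \<in> VF" "Y \<in> VF" "x \<in> B"
  shows "cov (\<lambda>q\<in>\<Omega>. f q *\<^sub>T X q) Y x = f (cinv c x) *\<^sub>R cov X Y x"
  unfolding cov_def comps_scale[OF assms(3)]
    linear_scale[OF pd_linear[OF smooth_comps[OF assms(2)] open_B assms(3)]]
    linear_scale[OF loc.chern_of_linear(2)[OF z_U[OF assms(3)]]]
  by (simp add: scaleR_add_right)

lemma pd_add:
  assumes "smooth_on B u" "smooth_on B w" "x \<in> B"
  shows "pd h (\<lambda>x. u x + w x) x = pd h u x + pd h w x"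
  by (rule pd_eqI[OF has_derivative_add[OF smooth_on_has_pd[OF assms(1) open_B assms(3)]
          smooth_on_has_pd[OF assms(2) open_B assms(3)]]])

lemma pd_scaleR:
  assumes "smooth_on B a" "smooth_on B w" "x \<in> B"
  shows "pd h (\<lambda>x. a x *\<^sub>R w x) x = a x *\<^sub>R pd h w x + pd h a x *\<^sub>R w x"
  by (rule pd_eqI[OF has_derivative_scaleR[OF smooth_on_has_pd[OF assms(1) open_B assms(3)]
          smooth_on_has_pd[OF assms(2) open_B assms(3)]]])

lemma cov_add2:
  assumes "X \<in> VF" "Y \<in> VF" "Y' \<in> VF" "x \<in> B"
  shows "cov X (\<lambda>q\<in>\<Omega>. Y q +\<^sub>T Y' q) x = cov X Y x + cov X Y' x"
proof -
  have "pd h (comps (\<lambda>q\<in>\<Omega>. Y q +\<^sub>T Y' q)) x = pd h (comps Y) x + pd h (comps Y') x" for h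
    using pd_cong[OF open_B assms(4), of "comps (\<lambda>q\<in>\<Omega>. Y q +\<^sub>T Y' q)" "\<lambda>x. comps Y x + comps Y' x" h]
      pd_add[OF smooth_comps[OF assms(2)] smooth_comps[OF assms(3)] assms(4)] comps_sum by simp
  then show ?thesis
    unfolding cov_def comps_sum[OF assms(4)]
      linear_add[OF loc.chern_of_linear(1)[OF z_U[OF assms(4)]]] by simp
qed

lemma cov_scale2:
  assumes f: "f \<in> smooth_functions \<A> \<Omega>" and "X \<in> VF" "Y \<in> VF" "x \<in> B"
  shows "cov X (\<lambda>q\<in>\<Omega>. f q *\<^sub>T Y q) x =
    pd (comps X x) (\<lambda>x. f (cinv c x)) x *\<^sub>R comps Y x + f (cinv c x) *\<^sub>R cov X Y x"
proof -
  have "pd h (comps (\<lambda>q\<in>\<Omega>. f q *\<^sub>T Y q)) x =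
      f (cinv c x) *\<^sub>R pd h (comps Y) x + pd h (\<lambda>x. f (cinv c x)) x *\<^sub>R comps Y x" for h
    using pd_cong[OF open_B assms(4), of "comps (\<lambda>q\<in>\<Omega>. f q *\<^sub>T Y q)" "\<lambda>x. f (cinv c x) *\<^sub>R comps Y x" h]
      pd_scaleR[OF smooth_functionD[OF f] smooth_comps[OF assms(3)] assms(4)] comps_scale by simp
  then show ?thesis
    unfolding cov_def comps_scale[OF assms(4)]
      linear_scale[OF loc.chern_of_linear(1)[OF z_U[OF assms(4)]]]
    by (simp add: scaleR_add_right)
qed

lemma dir_deriv_VF':
  assumes "f \<in> smooth_functions \<A> \<Omega>" "X \<in> VF" "p \<in> \<Omega>"
  shows "dir_deriv \<A> (X p) f = pd (comps X (cmap c p)) (\<lambda>x. f (cinv c x)) (cmap c p)"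
  by (rule dir_deriv_VF[OF smooth_functionD[OF assms(1)] _ assms(3,2)]) (simp add: cinv_patch)

lemma affine_connection_conn: "affine_connection \<A> \<Omega> conn"
  unfolding affine_connection_def
proof (intro conjI ballI)
  show "conn \<in> VF \<rightarrow>\<^sub>E VF \<rightarrow>\<^sub>E VF"
    using conn_VF by (auto simp: conn_def)
next
  fix X X' Y p assume *: "X \<in> VF" "X' \<in> VF" "Y \<in> VF" "p \<in> \<Omega>"
  then have x: "cmap c p \<in> B" by blast
  show "conn (\<lambda>q\<in>\<Omega>. X q +\<^sub>T X' q) Y p = conn X Y p +\<^sub>T conn X' Y p"
    using * by (intro VF_eq_at conn_VF sum_VF tadd_tangent VF_tangent)
      (simp_all add: vcomp_comps comps_conn[OF _ _ x] sum_VF cov_add1[OF _ _ _ x] del: restrict_apply)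
next
  fix f X Y p assume *: "f \<in> smooth_functions \<A> \<Omega>" "X \<in> VF" "Y \<in> VF" "p \<in> \<Omega>"
  then have x: "cmap c p \<in> B" by blast
  show "conn (\<lambda>q\<in>\<Omega>. f q *\<^sub>T X q) Y p = f p *\<^sub>T conn X Y p"
    using * by (intro VF_eq_at conn_VF scale_VF tscale_tangent VF_tangent)
      (simp_all add: vcomp_comps comps_conn[OF _ _ x] scale_VF cov_scale1[OF _ _ x] cinv_patch del: restrict_apply)
next
  fix X Y Y' p assume *: "X \<in> VF" "Y \<in> VF" "Y' \<in> VF" "p \<in> \<Omega>"
  then have x: "cmap c p \<in> B" by blast
  show "conn X (\<lambda>q\<in>\<Omega>. Y q +\<^sub>T Y' q) p = conn X Y p +\<^sub>T conn X Y' p"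
    using * by (intro VF_eq_at conn_VF sum_VF tadd_tangent VF_tangent)
      (simp_all add: vcomp_comps comps_conn[OF _ _ x] sum_VF cov_add2[OF _ _ _ x] del: restrict_apply)
next
  fix f X Y p assume *: "f \<in> smooth_functions \<A> \<Omega>" "X \<in> VF" "Y \<in> VF" "p \<in> \<Omega>"
  then have x: "cmap c p \<in> B" by blast
  show "conn X (\<lambda>q\<in>\<Omega>. f q *\<^sub>T Y q) p = dir_deriv \<A> (X p) f *\<^sub>T Y p +\<^sub>T f p *\<^sub>T conn X Y p"
    using * by (intro VF_eq_at conn_VF scale_VF tadd_tangent tscale_tangent VF_tangent)
      (simp_all add: vcomp_comps comps_conn[OF _ _ x] scale_VF cov_scale2[OF _ _ _ x] cinv_patch
        dir_deriv_VF' del: restrict_apply)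
qed

lemma torsion_free_conn: "torsion_free \<A> \<Omega> conn"
  unfolding torsion_free_def
proof (intro ballI)
  fix X Y p assume *: "X \<in> VF" "Y \<in> VF" "p \<in> \<Omega>"
  then have x: "cmap c p \<in> B" by blast
  let ?z = "\<lambda>x. pd (comps X x) (comps Y) x - pd (comps Y x) (comps X) x"
  have "smooth_on B ?z"
    by (intro smooth_on_diff uB smooth_pd_field smooth_comps *)
  then have "lift ?z p = conn X Y p +\<^sub>T (-1) *\<^sub>T conn Y X p"
    using * by (intro VF_eq_at lift_in_VF tadd_tangent tscale_tangent VF_tangent conn_VF)
      (simp_all add: vcomp_comps comps_conn[OF _ _ x] comps_lift[OF x] cov_def
        loc.chern_of_sym[OF z_U[OF x], of "comps Y _"])
  then show "conn X Y p +\<^sub>T (-1) *\<^sub>T conn Y X p = lie_bracket \<A> \<Omega> X Y p"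
    using lie_bracket_patch[OF *(1,2)] by simp
qed

lemma dir_deriv_fund_tensor:
  assumes "X \<in> VF" "Y \<in> VF" "Z \<in> VF" "p \<in> \<Omega>"
  shows "dir_deriv \<A> (X p) (\<lambda>q. fund_tensor L (V q) (Y q) (Z q)) =
    pd (comps X (cmap c p)) (\<lambda>x. g x (comps Y x) (comps Z x)) (cmap c p)"
  by (rule dir_deriv_VF[OF smooth_metric_fields[OF smooth_comps smooth_comps] fund_tensor_patch])
    (use assms in auto)

lemma almost_compatible_conn: "almost_compatible \<A> L \<Omega> V conn"
  unfolding almost_compatible_def
proof (intro ballI)
  fix X Y Z p assume *: "X \<in> VF" "Y \<in> VF" "Z \<in> VF" "p \<in> \<Omega>"
  then have x: "cmap c p \<in> B" by blast
  interpret chern_data "g (cmap c p)" "C (cmap c p)" "d (cmap c p)" "snd (z (cmap c p))"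
    by (rule loc.chern_data[OF z_U[OF x]])
  have "C (cmap c p) u w v = C (cmap c p) v u w" for u w v
    using C_sym1[of v u w] C_sym2[of u v w] by simp
  then show "dir_deriv \<A> (X p) (\<lambda>q. fund_tensor L (V q) (Y q) (Z q)) =
      fund_tensor L (V p) (conn X Y p) (Z p) + fund_tensor L (V p) (Y p) (conn X Z p)
      + 2 * cartan_tensor L (V p) (conn X V p) (Y p) (Z p)"
    using * V_VF pd_metric_fields[OF smooth_comps smooth_comps x, of Y Z "comps X (cmap c p)"]
    by (simp add: dir_deriv_fund_tensor fund_tensor_patch cartan_tensor_patch conn_VF
        comps_conn[OF _ _ x] cov_def \<eta>_def)
qed

subsection \<open>Uniqueness\<close>

abbreviation E :: "'n \<Rightarrow> 'm \<Rightarrow> ('m, 'n) tvec" where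
  "E i \<equiv> lift (\<lambda>x. axis i 1)"

lemma coord_field: "(\<lambda>q\<in>\<Omega>. coord_basis \<A> c i q) = E i"
  by (simp add: lift_def)

lemma const_VF: "lift (\<lambda>x. u) \<in> VF"
  by (simp add: lift_in_VF uB)

lemma affine_connectionD:
  assumes "affine_connection \<A> \<Omega> D"
  shows connection_add1: "X \<in> VF \<Longrightarrow> X' \<in> VF \<Longrightarrow> Y \<in> VF \<Longrightarrow> p \<in> \<Omega> \<Longrightarrow>
      D (\<lambda>q\<in>\<Omega>. X q +\<^sub>T X' q) Y p = D X Y p +\<^sub>T D X' Y p"
    and connection_scale1: "f \<in> smooth_functions \<A> \<Omega> \<Longrightarrow> X \<in> VF \<Longrightarrow> Y \<in> VF \<Longrightarrow> p \<in> \<Omega> \<Longrightarrow>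
      D (\<lambda>q\<in>\<Omega>. f q *\<^sub>T X q) Y p = f p *\<^sub>T D X Y p"
    and connection_add2: "X \<in> VF \<Longrightarrow> Y \<in> VF \<Longrightarrow> Y' \<in> VF \<Longrightarrow> p \<in> \<Omega> \<Longrightarrow>
      D X (\<lambda>q\<in>\<Omega>. Y q +\<^sub>T Y' q) p = D X Y p +\<^sub>T D X Y' p"
    and connection_leibniz: "f \<in> smooth_functions \<A> \<Omega> \<Longrightarrow> X \<in> VF \<Longrightarrow> Y \<in> VF \<Longrightarrow> p \<in> \<Omega> \<Longrightarrow>
      D X (\<lambda>q\<in>\<Omega>. f q *\<^sub>T Y q) p = dir_deriv \<A> (X p) f *\<^sub>T Y p +\<^sub>T f p *\<^sub>T D X Y p"
  using assms unfolding affine_connection_def by simp_all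

text \<open>The frame \<open>E i\<close> and the coefficients exist on the whole patch, so the
  axioms apply to each summand and induction on the index set suffices.\<close>

lemma affine_expansion1:
  assumes D: "affine_connection \<A> \<Omega> D" and Y: "Y \<in> VF" and x: "x \<in> B"
    and a: "\<And>i. smooth_on B (a i)" and fin: "finite I"
  shows "comps (D (lift (\<lambda>x. \<Sum>i\<in>I. a i x *\<^sub>R axis i 1)) Y) x = (\<Sum>i\<in>I. a i x *\<^sub>R comps (D (E i) Y) x)"
  using fin
proof (induction I rule: finite_induct)
  case empty
  let ?Z = "lift (\<lambda>x. 0)"
  \<comment> \<open>The zero field equals its sum with itself, so its image under \<open>D\<close>
    equals its own double and vanishes.\<close>
  have "D (\<lambda>q\<in>\<Omega>. ?Z q +\<^sub>T ?Z q) Y p = D ?Z Y p +\<^sub>T D ?Z Y p" if "p \<in> \<Omega>" for p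
    by (rule connection_add1[OF D const_VF const_VF Y that])
  moreover have "(\<lambda>q\<in>\<Omega>. ?Z q +\<^sub>T ?Z q) = ?Z"
    using tadd_lift[of "\<lambda>_. 0" "\<lambda>_. 0"] by simp
  ultimately have eq: "D ?Z Y p = D ?Z Y p +\<^sub>T D ?Z Y p" if "p \<in> \<Omega>" for p
    using that by simp
  have "vcomp c (D ?Z Y p) = 0" if "p \<in> \<Omega>" for p
    using arg_cong[OF eq[OF that], of "\<lambda>v. vcomp c v"] by simp
  then show ?case
    using cinv_B(1)[OF x] by (simp add: comps_def)
next
  case (insert i I)
  let ?S = "\<lambda>x. \<Sum>i\<in>I. a i x *\<^sub>R axis i 1 :: real ^ 'n" and ?p = "cinv c x"
  let ?f = "\<lambda>q. a i (cmap c q)"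
  have f: "?f \<in> smooth_functions \<A> \<Omega>"
    by (rule smooth_functionI[OF a]) simp
  have s: "smooth_on B (\<lambda>x. a i x *\<^sub>R (axis i 1 :: real ^ 'n))" for i
    by (intro smooth_on_scaleR uB a smooth_on_const)
  then have S: "smooth_on B ?S"
    by (intro smooth_on_sum uB)
  have "lift (\<lambda>x. \<Sum>i\<in>insert i I. a i x *\<^sub>R axis i 1) = (\<lambda>q\<in>\<Omega>. lift (\<lambda>x. a i x *\<^sub>R axis i 1) q +\<^sub>T lift ?S q)"
    using insert.hyps by (simp add: tadd_lift)
  moreover have "D (\<lambda>q\<in>\<Omega>. lift (\<lambda>x. a i x *\<^sub>R axis i 1) q +\<^sub>T lift ?S q) Y ?p
      = D (lift (\<lambda>x. a i x *\<^sub>R axis i 1)) Y ?p +\<^sub>T D (lift ?S) Y ?p"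
    by (rule connection_add1[OF D lift_in_VF[OF s] lift_in_VF[OF S] Y cinv_B(1)[OF x]])
  moreover have "lift (\<lambda>x. a i x *\<^sub>R axis i 1) = (\<lambda>q\<in>\<Omega>. ?f q *\<^sub>T E i q)"
    by (rule tscale_lift[symmetric]) simp
  moreover have "D (\<lambda>q\<in>\<Omega>. ?f q *\<^sub>T E i q) Y ?p = ?f ?p *\<^sub>T D (E i) Y ?p"
    by (rule connection_scale1[OF D f const_VF Y cinv_B(1)[OF x]])
  ultimately have "vcomp c (D (lift (\<lambda>x. \<Sum>i\<in>insert i I. a i x *\<^sub>R axis i 1)) Y ?p)
      = a i x *\<^sub>R vcomp c (D (E i) Y ?p) + vcomp c (D (lift ?S) Y ?p)"
    using cinv_B(2)[OF x] by simp
  then show ?case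
    using insert by (simp add: comps_def)
qed

lemma affine_expansion2:
  assumes D: "affine_connection \<A> \<Omega> D" and X: "X \<in> VF" and x: "x \<in> B"
    and a: "\<And>i. smooth_on B (a i)" and fin: "finite I"
  shows "comps (D X (lift (\<lambda>x. \<Sum>i\<in>I. a i x *\<^sub>R axis i 1))) x
    = (\<Sum>i\<in>I. pd (comps X x) (a i) x *\<^sub>R axis i 1 + a i x *\<^sub>R comps (D X (E i)) x)"
  using fin
proof (induction I rule: finite_induct)
  case empty
  let ?Z = "lift (\<lambda>x. 0)"
  have "D X (\<lambda>q\<in>\<Omega>. ?Z q +\<^sub>T ?Z q) p = D X ?Z p +\<^sub>T D X ?Z p" if "p \<in> \<Omega>" for p
    by (rule connection_add2[OF D X const_VF const_VF that])
  moreover have "(\<lambda>q\<in>\<Omega>. ?Z q +\<^sub>T ?Z q) = ?Z"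
    using tadd_lift[of "\<lambda>_. 0" "\<lambda>_. 0"] by simp
  ultimately have eq: "D X ?Z p = D X ?Z p +\<^sub>T D X ?Z p" if "p \<in> \<Omega>" for p
    using that by simp
  have "vcomp c (D X ?Z p) = 0" if "p \<in> \<Omega>" for p
    using arg_cong[OF eq[OF that], of "\<lambda>v. vcomp c v"] by simp
  then show ?case
    using cinv_B(1)[OF x] by (simp add: comps_def)
next
  case (insert i I)
  let ?S = "\<lambda>x. \<Sum>i\<in>I. a i x *\<^sub>R axis i 1 :: real ^ 'n" and ?p = "cinv c x"
  let ?f = "\<lambda>q. a i (cmap c q)"
  have f: "?f \<in> smooth_functions \<A> \<Omega>"
    by (rule smooth_functionI[OF a]) simp
  have s: "smooth_on B (\<lambda>x. a i x *\<^sub>R (axis i 1 :: real ^ 'n))" for i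
    by (intro smooth_on_scaleR uB a smooth_on_const)
  then have S: "smooth_on B ?S"
    by (intro smooth_on_sum uB)
  have "lift (\<lambda>x. \<Sum>i\<in>insert i I. a i x *\<^sub>R axis i 1) = (\<lambda>q\<in>\<Omega>. lift (\<lambda>x. a i x *\<^sub>R axis i 1) q +\<^sub>T lift ?S q)"
    using insert.hyps by (simp add: tadd_lift)
  moreover have "D X (\<lambda>q\<in>\<Omega>. lift (\<lambda>x. a i x *\<^sub>R axis i 1) q +\<^sub>T lift ?S q) ?p
      = D X (lift (\<lambda>x. a i x *\<^sub>R axis i 1)) ?p +\<^sub>T D X (lift ?S) ?p"
    by (rule connection_add2[OF D X lift_in_VF[OF s] lift_in_VF[OF S] cinv_B(1)[OF x]])
  moreover have "lift (\<lambda>x. a i x *\<^sub>R axis i 1) = (\<lambda>q\<in>\<Omega>. ?f q *\<^sub>T E i q)"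
    by (rule tscale_lift[symmetric]) simp
  moreover have "D X (\<lambda>q\<in>\<Omega>. ?f q *\<^sub>T E i q) ?p
      = dir_deriv \<A> (X ?p) ?f *\<^sub>T E i ?p +\<^sub>T ?f ?p *\<^sub>T D X (E i) ?p"
    by (rule connection_leibniz[OF D f X const_VF cinv_B(1)[OF x]])
  moreover have "dir_deriv \<A> (X ?p) ?f = pd (comps X x) (a i) x"
    using dir_deriv_VF[OF a _ cinv_B(1)[OF x] X, of ?f] cinv_B(2)[OF x] by simp
  moreover have "vcomp c (E i ?p) = axis i 1"
    by (rule vcomp_lift[OF cinv_B(1)[OF x]])
  ultimately have "vcomp c (D X (lift (\<lambda>x. \<Sum>i\<in>insert i I. a i x *\<^sub>R axis i 1)) ?p)
      = pd (comps X x) (a i) x *\<^sub>R axis i 1 + a i x *\<^sub>R vcomp c (D X (E i) ?p) + vcomp c (D X (lift ?S) ?p)"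
    using cinv_B(2)[OF x] by simp
  then show ?case
    using insert by (simp add: comps_def)
qed

lemma pd_vec_nth:
  assumes "smooth_on B w" "x \<in> B"
  shows "pd h (\<lambda>x. w x $ i) x = pd h w x $ i"
  by (rule pd_eqI[OF bounded_linear.has_derivative[OF bounded_linear_vec_nth
          smooth_on_has_pd[OF assms(1) open_B assms(2)]]])

lemma axis_sum: "(\<Sum>i\<in>UNIV. u $ i *\<^sub>R axis i 1) = (u :: real ^ 'n)"
  using basis_expansion[of u] by (simp add: scalar_mult_eq_scaleR)

text \<open>The coefficients of an arbitrary connection on the coordinate frame, extended bilinearly
  so that \<open>chern_unique\<close> can be applied to them.\<close>

definition christ ::
  "(('m \<Rightarrow> ('m, 'n) tvec) \<Rightarrow> ('m \<Rightarrow> ('m, 'n) tvec) \<Rightarrow> 'm \<Rightarrow> ('m, 'n) tvec) \<Rightarrow>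
     real ^ 'n \<Rightarrow> real ^ 'n \<Rightarrow> real ^ 'n \<Rightarrow> real ^ 'n" where
  "christ D x u w = (\<Sum>i\<in>UNIV. \<Sum>j\<in>UNIV. (u $ i * w $ j) *\<^sub>R comps (D (E i) (E j)) x)"

lemma affine_connection_coords:
  assumes D: "affine_connection \<A> \<Omega> D" and X: "X \<in> VF" and Y: "Y \<in> VF" and x: "x \<in> B"
  shows "comps (D X Y) x = pd (comps X x) (comps Y) x + christ D x (comps X x) (comps Y x)"
proof -
  have coef: "smooth_on B (\<lambda>x. comps X x $ i)" if "X \<in> VF" for X i
    by (rule smooth_on_vec_nth[OF uB smooth_comps[OF that]])
  have ex: "lift (\<lambda>x. \<Sum>i\<in>UNIV. comps X x $ i *\<^sub>R axis i 1) = X" if "X \<in> VF" for X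
    using lift_comps[OF that] by (simp add: axis_sum)
  have "comps (D X Y) x = (\<Sum>j\<in>UNIV. pd (comps X x) (\<lambda>x. comps Y x $ j) x *\<^sub>R axis j 1
      + comps Y x $ j *\<^sub>R comps (D X (E j)) x)"
    using affine_expansion2[OF D X x, where a = "\<lambda>i x. comps Y x $ i" and I = UNIV, OF coef[OF Y] finite]
    unfolding ex[OF Y] .
  also have "\<dots> = pd (comps X x) (comps Y) x + (\<Sum>j\<in>UNIV. comps Y x $ j *\<^sub>R comps (D X (E j)) x)"
    by (simp add: sum.distrib pd_vec_nth[OF smooth_comps[OF Y] x] axis_sum)
  also have "(\<Sum>j\<in>UNIV. comps Y x $ j *\<^sub>R comps (D X (E j)) x)
      = (\<Sum>j\<in>UNIV. comps Y x $ j *\<^sub>R (\<Sum>i\<in>UNIV. comps X x $ i *\<^sub>R comps (D (E i) (E j)) x))"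
    using affine_expansion1[OF D const_VF x, where a = "\<lambda>i x. comps X x $ i" and I = UNIV,
        OF coef[OF X] finite]
    unfolding ex[OF X] by simp
  also have "\<dots> = christ D x (comps X x) (comps Y x)"
    unfolding christ_def by (subst sum.swap) (simp add: scaleR_sum_right mult.commute)
  finally show ?thesis .
qed

lemma connection_VF: "affine_connection \<A> \<Omega> D \<Longrightarrow> X \<in> VF \<Longrightarrow> Y \<in> VF \<Longrightarrow> D X Y \<in> VF"
  unfolding affine_connection_def by (blast dest: PiE_mem)

text \<open>The axioms are tested on fields with constant components: their own derivatives vanish,
  and the only field still differentiated is \<open>V\<close>.\<close>

lemma christ_eq:
  assumes D: "affine_connection \<A> \<Omega> D" "torsion_free \<A> \<Omega> D" "almost_compatible \<A> L \<Omega> V D"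
    and x: "x \<in> B"
  shows "christ D x u w = \<Gamma> x u w"
proof -
  let ?p = "cinv c x"
  have p: "?p \<in> \<Omega>" "cmap c ?p = x" using cinv_B x by auto
  interpret chern_data "g x" "C x" "d x" "snd (z x)"
    by (rule loc.chern_data[OF z_U[OF x]])
  have pd0: "pd h (comps (lift (\<lambda>x. u))) x = 0" for h u
  proof -
    have "pd h (comps (lift (\<lambda>x. u))) x = pd h (\<lambda>x. u) x"
      by (rule pd_cong[OF open_B x]) (rule comps_lift)
    also have "\<dots> = 0" by (rule pd_eqI) (rule has_derivative_const)
    finally show ?thesis .
  qed
  have DE: "comps (D (lift (\<lambda>x. u)) (lift (\<lambda>x. w))) x = christ D x u w" for u w
    using affine_connection_coords[OF D(1) const_VF const_VF x] by (simp add: pd0 comps_lift[OF x])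
  have DV: "comps (D (lift (\<lambda>x. u)) V) x = pd u \<eta> x + christ D x u (\<eta> x)" for u
    using affine_connection_coords[OF D(1) const_VF V_VF x] by (simp add: \<eta>_def comps_lift[OF x])
  show ?thesis
    unfolding chern_of_def
  proof (rule chern_unique)
    fix u w
    let ?X = "lift (\<lambda>x. u)" and ?Y = "lift (\<lambda>x. w)"
    have "D ?X ?Y ?p +\<^sub>T (-1) *\<^sub>T D ?Y ?X ?p = lie_bracket \<A> \<Omega> ?X ?Y ?p"
      using D(2) const_VF p(1) unfolding torsion_free_def by blast
    then have "vcomp c (D ?X ?Y ?p) - vcomp c (D ?Y ?X ?p) = vcomp c (lie_bracket \<A> \<Omega> ?X ?Y ?p)"
      by (metis vcomp_tadd vcomp_tscale scaleR_minus1_left add_uminus_conv_diff)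
    also have "\<dots> = 0"
      unfolding lie_bracket_patch[OF const_VF const_VF] vcomp_lift[OF p(1)] p(2) pd0 by simp
    finally show "christ D x u w = christ D x w u"
      using DE[of u w] DE[of w u] by (simp add: comps_def)
  next
    fix u w v
    let ?X = "lift (\<lambda>x. u)" and ?Y = "lift (\<lambda>x. w)" and ?Z = "lift (\<lambda>x. v)"
    have "dir_deriv \<A> (?X ?p) (\<lambda>q. fund_tensor L (V q) (?Y q) (?Z q)) =
        fund_tensor L (V ?p) (D ?X ?Y ?p) (?Z ?p) + fund_tensor L (V ?p) (?Y ?p) (D ?X ?Z ?p)
        + 2 * cartan_tensor L (V ?p) (D ?X V ?p) (?Y ?p) (?Z ?p)"
      using D(3) const_VF p(1) unfolding almost_compatible_def by blast
    then have "pd u (\<lambda>x. g x (comps ?Y x) (comps ?Z x)) x =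
        g x (christ D x u w) v + g x w (christ D x u v) + 2 * C x (pd u \<eta> x + christ D x u (\<eta> x)) w v"
      using connection_VF[OF D(1)] const_VF V_VF
      by (simp add: dir_deriv_fund_tensor fund_tensor_patch cartan_tensor_patch p comps_lift[OF x] DE DV)
    \<comment> \<open>The same derivative computed with \<open>\<Gamma>\<close>. Both Cartan terms
      contain \<open>pd u \<eta> x\<close>, which drops out in the comparison, and the algebraic
      equation at the vector \<open>z x\<close> remains.\<close>
    moreover have "pd u (\<lambda>x. g x (comps ?Y x) (comps ?Z x)) x =
        g x (\<Gamma> x u w) v + g x w (\<Gamma> x u v) + 2 * C x w v (pd u \<eta> x + \<Gamma> x u (\<eta> x))"
      using pd_metric_fields[OF smooth_comps[OF const_VF] smooth_comps[OF const_VF] x, of u w v]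
      by (simp add: pd0 comps_lift[OF x])
    moreover have "C x (pd u \<eta> x + christ D x u (\<eta> x)) w v = C x w v (pd u \<eta> x + christ D x u (\<eta> x))"
      using C_sym1 C_sym2 by metis
    ultimately show "d x u w v = g x (christ D x u w) v + g x w (christ D x u v)
        + 2 * C x w v (christ D x u (snd (z x)))"
      using loc.chern_of_compatible[OF z_U[OF x], of u w v] by (simp add: C_lin)
  qed
qed

lemma nabla_eq: "nabla \<A> L \<Omega> V = conn"
  unfolding nabla_def
proof (rule the_equality)
  show "affine_connection \<A> \<Omega> conn \<and> torsion_free \<A> \<Omega> conn \<and> almost_compatible \<A> L \<Omega> V conn"
    using affine_connection_conn torsion_free_conn almost_compatible_conn by blast
  fix D assume "affine_connection \<A> \<Omega> D \<and> torsion_free \<A> \<Omega> D \<and> almost_compatible \<A> L \<Omega> V D"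
  then have D: "affine_connection \<A> \<Omega> D" "torsion_free \<A> \<Omega> D" "almost_compatible \<A> L \<Omega> V D" by auto
  have eq: "D X Y = conn X Y" if "X \<in> VF" "Y \<in> VF" for X Y
    by (rule VF_eqI[OF connection_VF[OF D(1) that] conn_VF[OF that]])
      (simp add: affine_connection_coords[OF D(1) that] comps_conn[OF that] cov_def christ_eq[OF D])
  have ext: "D \<in> VF \<rightarrow>\<^sub>E VF \<rightarrow>\<^sub>E VF" "conn \<in> VF \<rightarrow>\<^sub>E VF \<rightarrow>\<^sub>E VF"
    using D(1) affine_connection_conn unfolding affine_connection_def by simp_all
  show "D = conn"
  proof (rule PiE_ext[OF ext])
    fix X assume X: "X \<in> VF"
    show "D X = conn X"
      by (rule PiE_ext[OF PiE_mem[OF ext(1) X] PiE_mem[OF ext(2) X]]) (rule eq[OF X])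
  qed
qed

text \<open>\<open>V\<close> and \<open>X\<close> enter through their values at \<open>p\<close>
  alone. This gives the independence of the extension and reduces the law of change to the
  derivative of \<open>Y\<close>.\<close>

lemma vcomp_nabla:
  assumes "X \<in> VF" "Y \<in> VF" "p \<in> \<Omega>"
  shows "vcomp c (nabla \<A> L \<Omega> V X Y p) = pd (vcomp c (X p)) (comps Y) (cmap c p)
    + chern_of (F c) (cmap c p, vcomp c (V p)) (vcomp c (X p)) (vcomp c (Y p))"
proof -
  have x: "cmap c p \<in> B" using assms(3) by blast
  show ?thesis
    using comps_conn[OF assms(1,2) x] z_V[OF assms(3)]
    by (simp add: nabla_eq vcomp_comps[OF assms(3)] cov_def del: prod.inject)
qed

lemma christoffel_eq:
  assumes "p \<in> \<Omega>"
  shows "christoffel \<A> L c \<Omega> V k i j p = chern_christoffel \<A> L c k i j (V p)"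
proof -
  have x: "cmap c p \<in> B" using assms by blast
  have "pd h (comps (E j)) (cmap c p) = 0" for h
  proof -
    have "pd h (comps (E j)) (cmap c p) = pd h (\<lambda>x. axis j 1) (cmap c p)"
      by (rule pd_cong[OF open_B x]) (rule comps_lift)
    also have "\<dots> = 0" by (rule pd_eqI) (rule has_derivative_const)
    finally show ?thesis .
  qed
  then show ?thesis
    unfolding christoffel_def coord_field vcomp_nabla[OF const_VF const_VF assms]
    using chern_christoffel_chart[OF c V_A[OF assms]] base_VF[OF V_VF assms] patch_cdom[OF assms]
    by (simp add: vcomp_lift[OF assms])
qed

end

section \<open>Christoffel symbols as functions on the bundle\<close>

context finsler
begin

lemma finsler_patchI:
  assumes "c \<in> \<A>" "open \<Omega>" "\<Omega> \<subseteq> cdom c" "V \<in> admissible_fields \<A> A \<Omega>"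
  shows "finsler_patch \<A> A L c \<Omega> V"
  using assms by unfold_locales

text \<open>The components of \<open>v\<close> are kept constant, and the patch is shrunk to the
  points where the resulting vector stays in \<open>A\<close>; this is an open set because
  \<open>U c\<close> is open.\<close>

lemma local_extension:
  assumes c: "c \<in> \<A>" and v: "v \<in> A" and T: "open T" "base v \<in> T" "T \<subseteq> cdom c"
  shows "\<exists>\<Omega> V. open \<Omega> \<and> base v \<in> \<Omega> \<and> \<Omega> \<subseteq> T \<and> V \<in> admissible_fields \<A> A \<Omega> \<and> V (base v) = v"
proof -
  let ?y = "vcomp c v"
  let ?\<Omega> = "T \<inter> (\<lambda>p. (cmap c p, ?y)) -` U c"
  have "continuous_on (cdom c) (cmap c)"
    using chart_homeomorphism[OF c] by (simp add: homeomorphism_def)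
  then have "continuous_on T (\<lambda>p. (cmap c p, ?y))"
    using continuous_on_subset[OF _ T(3)] by (intro continuous_intros) auto
  then have o: "open ?\<Omega>"
    by (rule continuous_open_preimage[OF _ T(1) open_U[OF c]])
  interpret coord_patch \<A> c ?\<Omega>
    using c o T by unfold_locales auto
  have "lift (\<lambda>x. ?y) \<in> VF"
    by (simp add: lift_in_VF uB)
  moreover have "lift (\<lambda>x. ?y) p \<in> A" if "p \<in> ?\<Omega>" for p
    using that coord_vec_in_A[OF c, of p ?y] T by (auto simp: lift_def)
  moreover have "base v \<in> ?\<Omega>"
    using coords_in_U[OF v, of c] T by auto
  moreover from this have "lift (\<lambda>x. ?y) (base v) = v"
    using coord_vec_vcomp[OF A_tangent[OF v] c] T by (auto simp: lift_def)
  ultimately show ?thesis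
    using o unfolding admissible_fields_def by blast
qed

text \<open>\<open>local_extension\<close> supplies a witness for the definite description, and
  \<open>christoffel_eq\<close> gives the same value for every other one.\<close>

lemma Gam_eq:
  assumes c: "c \<in> \<A>" and v: "v \<in> A" "base v \<in> cdom c"
  shows "Gam \<A> A L c k i j v = chern_christoffel \<A> L c k i j v"
  unfolding Gam_def
proof (rule the_equality)
  obtain \<Omega> V where \<Omega>: "open \<Omega>" "base v \<in> \<Omega>" "\<Omega> \<subseteq> cdom c" "V \<in> admissible_fields \<A> A \<Omega>" "V (base v) = v"
    using local_extension[OF c v(1) open_cdom[OF c] v(2)] by blast
  moreover have "christoffel \<A> L c \<Omega> V k i j (base v) = chern_christoffel \<A> L c k i j v"
    using finsler_patch.christoffel_eq[OF finsler_patchI[OF c \<Omega>(1,3,4)] \<Omega>(2)] \<Omega>(5) by simp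
  ultimately show "\<exists>\<Omega> V. open \<Omega> \<and> base v \<in> \<Omega> \<and> \<Omega> \<subseteq> cdom c \<and>
     V \<in> admissible_fields \<A> A \<Omega> \<and> V (base v) = v \<and>
     chern_christoffel \<A> L c k i j v = christoffel \<A> L c \<Omega> V k i j (base v)"
    by metis
next
  fix r
  assume "\<exists>\<Omega> V. open \<Omega> \<and> base v \<in> \<Omega> \<and> \<Omega> \<subseteq> cdom c \<and>
     V \<in> admissible_fields \<A> A \<Omega> \<and> V (base v) = v \<and> r = christoffel \<A> L c \<Omega> V k i j (base v)"
  then obtain \<Omega> V where \<Omega>: "open \<Omega>" "base v \<in> \<Omega>" "\<Omega> \<subseteq> cdom c" "V \<in> admissible_fields \<A> A \<Omega>"
    "V (base v) = v" "r = christoffel \<A> L c \<Omega> V k i j (base v)"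
    by blast
  show "r = chern_christoffel \<A> L c k i j v"
    using finsler_patch.christoffel_eq[OF finsler_patchI[OF c \<Omega>(1,3,4)] \<Omega>(2)] \<Omega>(5,6) by simp
qed

text \<open>
  Both sides are the components in \<open>c'\<close> of \<open>\<nabla>\<close> applied to two fields that are constant in the
  chart \<open>c\<close>.
\<close>

lemma chern_of_change:
  assumes c: "c \<in> \<A>" "c' \<in> \<A>" and v: "v \<in> A" "base v = p" "p \<in> cdom c" "p \<in> cdom c'"
  shows "jac c c' p (chern_of (F c) (cmap c p, vcomp c v) u w) =
    pd u (pd w (cmap c' \<circ> cinv c)) (cmap c p)
    + chern_of (F c') (cmap c' p, vcomp c' v) (jac c c' p u) (jac c c' p w)"
proof -
  let ?\<tau> = "cmap c' \<circ> cinv c"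
  obtain \<Omega> V where \<Omega>: "open \<Omega>" "p \<in> \<Omega>" "\<Omega> \<subseteq> cdom c \<inter> cdom c'"
    "V \<in> admissible_fields \<A> A \<Omega>" "V p = v"
    using local_extension[OF c(1) v(1) open_Int[OF open_cdom[OF c(1)] open_cdom[OF c(2)]]] v by auto
  have sub: "\<Omega> \<subseteq> cdom c" "\<Omega> \<subseteq> cdom c'" using \<Omega>(3) by auto
  interpret P: finsler_patch \<A> A L c \<Omega> V by (rule finsler_patchI[OF c(1) \<Omega>(1) sub(1) \<Omega>(4)])
  interpret Q: finsler_patch \<A> A L c' \<Omega> V by (rule finsler_patchI[OF c(2) \<Omega>(1) sub(2) \<Omega>(4)])
  let ?X = "P.lift (\<lambda>x. u)" and ?Y = "P.lift (\<lambda>x. w)"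
  let ?Z = "nabla \<A> L \<Omega> V ?X ?Y p"
  have XY: "?X \<in> P.VF" "?Y \<in> P.VF" by (rule P.const_VF)+
  have x: "cmap c p \<in> P.B" and x': "cmap c' p \<in> Q.B" using \<Omega>(2) by auto
  have "?Z \<in> tangent_space \<A> p"
    using P.VF_tangent[OF P.conn_VF[OF XY] \<Omega>(2)] by (simp add: P.nabla_eq)
  then have change: "vcomp c' ?Z = jac c c' p (vcomp c ?Z)"
    using vcomp_change[of ?Z c c'] c v by (simp add: tangent_space_def)
  have "pd h (P.comps ?Y) (cmap c p) = 0" for h
    using pd_cong[OF P.open_B x, of "P.comps ?Y" "\<lambda>x. w" h] P.comps_lift
      pd_eqI[OF has_derivative_const] by simp
  then have Z: "vcomp c ?Z = chern_of (F c) (cmap c p, vcomp c v) u w"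
    using P.vcomp_nabla[OF XY \<Omega>(2)] by (simp add: P.vcomp_lift[OF \<Omega>(2)] \<Omega>(5))
  have comp': "vcomp c' (P.lift (\<lambda>x. h) q) = jac c c' q h" if "q \<in> \<Omega>" for h q
    using that \<Omega>(3) c by (auto simp: P.lift_def vcomp_coord_vec)
  \<comment> \<open>The components of \<open>?Y\<close> in \<open>c'\<close> are
    \<open>pd w ?\<tau>\<close> after the inverse coordinate change. That change carries the
    direction \<open>jac c c' p u\<close> back to \<open>u\<close>, so one second derivative of
    \<open>?\<tau>\<close> remains.\<close>
  have "pd (jac c c' p u) (Q.comps ?Y) (cmap c' p) = pd u (pd w ?\<tau>) (cmap c p)"
  proof -
    have "(pd w ?\<tau> has_derivative (\<lambda>h. pd h (pd w ?\<tau>) (cmap c p))) (at (cmap c p))"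
      by (rule smooth_on_has_pd[OF smooth_on_pd[OF smooth_trans open_overlap] open_overlap])
        (use c v in auto)
    then have "(pd w ?\<tau> \<circ> (cmap c \<circ> cinv c') has_derivative
        (\<lambda>h. pd h (pd w ?\<tau>) (cmap c p)) \<circ> jac c' c p) (at (cmap c' p))"
      using diff_chain_at[OF trans_has_derivative[OF c(2,1) v(4,3)]]
      by (simp add: cinv_cmap[OF c(2) v(4)])
    then have "(Q.comps ?Y has_derivative (\<lambda>h. pd h (pd w ?\<tau>) (cmap c p)) \<circ> jac c' c p) (at (cmap c' p))"
    proof (rule has_derivative_transform_within_open[OF _ Q.open_B x'])
      fix y assume y: "y \<in> Q.B"
      show "(pd w ?\<tau> \<circ> (cmap c \<circ> cinv c')) y = Q.comps ?Y y"
        using comp'[OF Q.cinv_B(1)[OF y]] by (simp add: Q.comps_def jac_def pd_def)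
    qed
    from pd_eqI[OF this] show ?thesis
      using jac_jac[OF c c(1) v(3,4,3)] jac_refl[OF c(1) v(3)] by simp
  qed
  then have Z': "vcomp c' ?Z = pd u (pd w ?\<tau>) (cmap c p)
      + chern_of (F c') (cmap c' p, vcomp c' v) (jac c c' p u) (jac c c' p w)"
    using Q.vcomp_nabla[OF XY \<Omega>(2)] comp'[OF \<Omega>(2)] by (simp add: \<Omega>(5))
  show ?thesis
    using change unfolding Z Z' by simp
qed

end

section \<open>Covariant derivatives along curves\<close>

lemma at_within_openin_eq:
  fixes S T :: "'a::topological_space set"
  assumes "openin (top_of_set T) S" "t \<in> S"
  shows "at t within S = at t within T"
proof -
  obtain Q where Q: "open Q" "S = T \<inter> Q"
    using assms(1) by (auto simp: openin_open)
  show ?thesis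
    by (rule at_within_nhd[of t Q]) (use Q assms(2) in auto)
qed

text \<open>Velocities are taken within \<open>{a..b}\<close>, smoothness in a chart within the
  relatively open set of parameters that it covers; the two filters at \<open>t\<close>
  coincide.\<close>

lemma vector_derivative_eqI:
  fixes f :: "real \<Rightarrow> 'a::real_normed_vector"
  assumes "a < b" "openin (top_of_set {a..b}) S" "t \<in> S" "(f has_derivative f') (at t within S)"
  shows "vector_derivative f (at t within {a..b}) = f' 1"
proof -
  have "f' h = h *\<^sub>R f' 1" for h
    using linear_scale[OF has_derivative_linear[OF assms(4)], of h 1] by simp
  then have "(f has_vector_derivative f' 1) (at t within {a..b})"
    using has_derivative_eq_rhs[OF assms(4), of "\<lambda>h. h *\<^sub>R f' 1"]
    unfolding has_vector_derivative_def at_within_openin_eq[OF assms(2,3)] by blast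
  moreover have "t \<in> cbox a b"
    using openin_imp_subset[OF assms(2)] assms(3) by auto
  ultimately show ?thesis
    using vector_derivative_within_cbox[OF assms(1), of t f "f' 1"] by simp
qed

lemma smooth_on_has_vector_derivative:
  fixes f :: "real \<Rightarrow> 'a::real_normed_vector"
  assumes "openin (top_of_set {a..b}) S" "t \<in> S" "smooth_on S f"
  shows "(f has_derivative (\<lambda>h. h *\<^sub>R vector_derivative f (at t within {a..b}))) (at t within S)"
proof -
  have "f differentiable (at t within S)"
    using smooth_on_differentiable[OF assms(3)] assms(2) by (simp add: differentiable_on_def)
  then show ?thesis
    unfolding vector_derivative_works has_vector_derivative_def at_within_openin_eq[OF assms(1,2)] .
qed

lemma smooth_on_vector_derivative:
  fixes f :: "real \<Rightarrow> 'a::real_normed_vector"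
  assumes "a < b" "openin (top_of_set {a..b}) S" "smooth_on S f"
  shows "smooth_on S (\<lambda>t. vector_derivative f (at t within {a..b}))"
proof (rule smooth_on_eq[OF smooth_on_deriv_within[OF assms(3), of 1]])
  fix t assume "t \<in> S"
  from frechet_derivative_eqI[OF unique_deriv_interval[OF assms(1,2)] this
      smooth_on_has_vector_derivative[OF assms(2) this assms(3)]]
  show "vector_derivative f (at t within {a..b}) = frechet_derivative f (at t within S) 1"
    by simp
qed

text \<open>The strict inequality \<open>a < b\<close> keeps derivatives within
  \<open>{a..b}\<close> unique; on a single point they would be arbitrary.\<close>

locale finsler_curve = finsler \<A> A L
  for \<A> :: "('m::{t2_space, second_countable_topology}, 'n::finite) chart set" and A L +
  fixes a b :: real and \<gamma> :: "real \<Rightarrow> 'm" and W :: "real \<Rightarrow> ('m, 'n) tvec"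
  assumes ab: "a < b" and curve: "smooth_curve \<A> a b \<gamma>"
    and W: "W \<in> fields_along \<A> a b \<gamma>" and W_A: "t \<in> {a..b} \<Longrightarrow> W t \<in> A"
begin

definition S :: "('m, 'n) chart \<Rightarrow> real set" where
  "S c = {t \<in> {a..b}. \<gamma> t \<in> cdom c}"

definition \<xi> :: "('m, 'n) chart \<Rightarrow> real \<Rightarrow> real ^ 'n" where
  "\<xi> c t = cmap c (\<gamma> t)"

abbreviation vd :: "(real \<Rightarrow> real ^ 'n) \<Rightarrow> real \<Rightarrow> real ^ 'n" where
  "vd f t \<equiv> vector_derivative f (at t within {a..b})"

abbreviation FA :: "(real \<Rightarrow> ('m, 'n) tvec) set" where
  "FA \<equiv> fields_along \<A> a b \<gamma>"

definition cov :: "('m, 'n) chart \<Rightarrow> (real \<Rightarrow> ('m, 'n) tvec) \<Rightarrow> real \<Rightarrow> real ^ 'n" where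
  "cov c X t = vd (\<lambda>s. vcomp c (X s)) t
     + chern_of (F c) (\<xi> c t, vcomp c (W t)) (vd (\<xi> c) t) (vcomp c (X t))"

lemma openin_S: "c \<in> \<A> \<Longrightarrow> openin (top_of_set {a..b}) (S c)"
  using continuous_openin_preimage_gen[of "{a..b}" \<gamma> "cdom c"] curve open_cdom
  by (auto simp: S_def smooth_curve_def vimage_def Int_def)

lemma openin_S2: "c \<in> \<A> \<Longrightarrow> c' \<in> \<A> \<Longrightarrow> openin (top_of_set {a..b}) (S c \<inter> S c')"
  by (intro openin_Int openin_S)

lemma uS: "c \<in> \<A> \<Longrightarrow> unique_deriv (S c)"
  by (rule unique_deriv_interval[OF ab openin_S])

lemma chart_at: "\<exists>c\<in>\<A>. \<gamma> t \<in> cdom c"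
  using manifold unfolding smooth_manifold_def by blast

lemma smooth_\<xi>: "c \<in> \<A> \<Longrightarrow> smooth_on (S c) (\<xi> c)"
  using curve by (simp add: smooth_curve_def S_def \<xi>_def[abs_def])

lemma FA_tangent: "X \<in> FA \<Longrightarrow> t \<in> {a..b} \<Longrightarrow> X t \<in> tangent_space \<A> (\<gamma> t)"
  by (auto simp: fields_along_def)

lemma smooth_FA: "X \<in> FA \<Longrightarrow> c \<in> \<A> \<Longrightarrow> smooth_on (S c) (\<lambda>t. vcomp c (X t))"
  by (simp add: fields_along_def S_def)

lemma base_W: "t \<in> {a..b} \<Longrightarrow> base (W t) = \<gamma> t"
  using FA_tangent[OF W] tangent_spaceD by blast

lemma W_in_U: "t \<in> S c \<Longrightarrow> (\<xi> c t, vcomp c (W t)) \<in> U c"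
  using coords_in_U[OF W_A, of t c] by (simp add: S_def \<xi>_def base_W)

text \<open>\<open>cov_expr\<close> gives the first lower index to \<open>X\<close>, whereas
  \<open>cov\<close> gives the first argument to the velocity; the symmetry of
  \<open>chern_of\<close> reconciles them.\<close>

lemma cov_expr_eq:
  assumes c: "c \<in> \<A>" and t: "t \<in> S c"
  shows "cov_expr \<A> A L a b \<gamma> W X c t = coord_vec \<A> c (\<gamma> t) (cov c X t)"
proof -
  let ?\<Gamma> = "chern_of (F c) (\<xi> c t, vcomp c (W t))"
  have t': "t \<in> {a..b}" "\<gamma> t \<in> cdom c" using t by (auto simp: S_def)
  have Gam: "Gam \<A> A L c k i j (W t) = ?\<Gamma> (axis i 1) (axis j 1) $ k" for k i j
    using Gam_eq[OF c W_A[OF t'(1)]] chern_christoffel_chart[OF c W_A[OF t'(1)]] t'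
    by (simp add: base_W \<xi>_def)
  have vel: "vcomp c (velocity \<A> a b \<gamma> t) = vd (\<xi> c) t"
    using c t' by (simp add: velocity_def \<xi>_def[abs_def])
  have "(\<chi> k. vd (\<lambda>s. vcomp c (X s)) t $ k
       + (\<Sum>i\<in>UNIV. \<Sum>j\<in>UNIV.
            vcomp c (X t) $ i * vcomp c (velocity \<A> a b \<gamma> t) $ j * Gam \<A> A L c k i j (W t))) = cov c X t"
    unfolding vec_eq_iff cov_def Gam vel
      local_metric.chern_of_sym[OF local_metric[OF c] W_in_U[OF t], of "vd (\<xi> c) t"]
    by (simp add: local_metric.chern_of_expansion[OF local_metric[OF c] W_in_U[OF t], of "vcomp c (X t)"])
  then show ?thesis
    by (simp add: cov_expr_def)
qed

text \<open>Differentiating the transformed components of \<open>X\<close> produces a second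
  derivative of the coordinate change. The law of change of \<open>chern_of\<close> contains the
  same term, so the sum transforms like a vector.\<close>

lemma cov_change:
  assumes c: "c \<in> \<A>" "c' \<in> \<A>" and t: "t \<in> S c" "t \<in> S c'" and X: "X \<in> FA"
  shows "cov c' X t = jac c c' (\<gamma> t) (cov c X t)"
proof -
  let ?\<tau> = "cmap c' \<circ> cinv c" and ?R = "S c \<inter> S c'" and ?x = "\<xi> c t"
  let ?O = "cmap c ` (cdom c \<inter> cdom c')"
  have t': "t \<in> {a..b}" "\<gamma> t \<in> cdom c" "\<gamma> t \<in> cdom c'" using t by (auto simp: S_def)
  have R: "t \<in> ?R" using t by blast
  have jac: "jac c c' (\<gamma> s) h = pd h ?\<tau> (\<xi> c s)" for s h
    by (simp add: jac_def pd_def \<xi>_def)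
  have x: "?x \<in> ?O" using t' by (auto simp: \<xi>_def)
  have sub: "\<xi> c ` ?R \<subseteq> ?O" by (auto simp: S_def \<xi>_def)
  have \<xi>': "(\<xi> c has_derivative (\<lambda>h. h *\<^sub>R vd (\<xi> c) t)) (at t within ?R)"
    by (rule has_derivative_subset[OF smooth_on_has_vector_derivative[OF openin_S[OF c(1)] t(1) smooth_\<xi>[OF c(1)]]])
      blast
  have X': "((\<lambda>s. vcomp c (X s)) has_derivative (\<lambda>h. h *\<^sub>R vd (\<lambda>s. vcomp c (X s)) t)) (at t within ?R)"
    by (rule has_derivative_subset[OF smooth_on_has_vector_derivative[OF openin_S[OF c(1)] t(1) smooth_FA[OF X c(1)]]])
      blast
  note \<tau>' = smooth_on_has_pd[OF smooth_trans[OF c] open_overlap[OF c] x]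
  have "(?\<tau> \<circ> \<xi> c has_derivative (\<lambda>h. pd h ?\<tau> ?x) \<circ> (\<lambda>h. h *\<^sub>R vd (\<xi> c) t)) (at t within ?R)"
    by (rule diff_chain_within[OF \<xi>' has_derivative_at_withinI[OF \<tau>']])
  then have "(\<xi> c' has_derivative (\<lambda>h. pd h ?\<tau> ?x) \<circ> (\<lambda>h. h *\<^sub>R vd (\<xi> c) t)) (at t within ?R)"
    by (rule has_derivative_transform[OF R, rotated])
      (use c in \<open>auto simp: S_def \<xi>_def cinv_cmap\<close>)
  from vector_derivative_eqI[OF ab openin_S2[OF c] R this]
  have vel: "vd (\<xi> c') t = jac c c' (\<gamma> t) (vd (\<xi> c) t)"
    by (simp add: jac)
  have comp: "vcomp c' (X s) = jac c c' (\<gamma> s) (vcomp c (X s))" if "s \<in> ?R" for s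
    using that FA_tangent[OF X, of s] vcomp_change[of "X s" c c'] c by (auto simp: S_def tangent_space_def)
  have "((\<lambda>s. pd (vcomp c (X s)) ?\<tau> (\<xi> c s)) has_derivative
      (\<lambda>h. pd (h *\<^sub>R vd (\<xi> c) t) (pd (vcomp c (X t)) ?\<tau>) ?x
        + pd (h *\<^sub>R vd (\<lambda>s. vcomp c (X s)) t) ?\<tau> ?x)) (at t within ?R)"
    by (rule has_derivative_pd_field[OF smooth_trans[OF c] open_overlap[OF c] sub R \<xi>' X'])
  then have "((\<lambda>s. vcomp c' (X s)) has_derivative
      (\<lambda>h. pd (h *\<^sub>R vd (\<xi> c) t) (pd (vcomp c (X t)) ?\<tau>) ?x
        + pd (h *\<^sub>R vd (\<lambda>s. vcomp c (X s)) t) ?\<tau> ?x)) (at t within ?R)"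
    by (rule has_derivative_transform[OF R, rotated]) (simp only: comp jac)
  from vector_derivative_eqI[OF ab openin_S2[OF c] R this]
  have vX: "vd (\<lambda>s. vcomp c' (X s)) t = pd (vd (\<xi> c) t) (pd (vcomp c (X t)) ?\<tau>) ?x
      + jac c c' (\<gamma> t) (vd (\<lambda>s. vcomp c (X s)) t)"
    by (simp add: jac)
  have "jac c c' (\<gamma> t) (chern_of (F c) (?x, vcomp c (W t)) u w) =
      pd u (pd w ?\<tau>) ?x
      + chern_of (F c') (\<xi> c' t, vcomp c' (W t)) (jac c c' (\<gamma> t) u) (jac c c' (\<gamma> t) w)" for u w
    unfolding \<xi>_def by (rule chern_of_change[OF c W_A[OF t'(1)] base_W[OF t'(1)] t'(2,3)])
  then show ?thesis
    unfolding cov_def linear_add[OF jac_linear[OF c t'(2,3)]] vX vel comp[OF R] by simp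
qed

lemma cov_expr_chart_independent:
  assumes c: "c \<in> \<A>" "c' \<in> \<A>" and t: "t \<in> {a..b}" "\<gamma> t \<in> cdom c" "\<gamma> t \<in> cdom c'" and X: "X \<in> FA"
  shows "cov_expr \<A> A L a b \<gamma> W X c t = cov_expr \<A> A L a b \<gamma> W X c' t"
proof -
  have S: "t \<in> S c" "t \<in> S c'" using t by (auto simp: S_def)
  show ?thesis
    unfolding cov_expr_eq[OF c(1) S(1)] cov_expr_eq[OF c(2) S(2)]
    by (rule tangent_eqI[OF coord_vec_in_tangent_space[OF c(1) t(2)]
          coord_vec_in_tangent_space[OF c(2) t(3)] c(2) t(3)])
      (simp add: jac_refl[OF c(2) t(3)] vcomp_coord_vec[OF c(2) t(3)] cov_change[OF c S X])
qed

lemma smooth_cov: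
  assumes c: "c \<in> \<A>" and X: "X \<in> FA"
  shows "smooth_on (S c) (cov c X)"
  unfolding cov_def
  by (intro smooth_on_add uS c smooth_on_vector_derivative[OF ab openin_S] smooth_FA X smooth_\<xi>
      local_metric.smooth_chern_field[OF local_metric[OF c]] smooth_on_Pair W)
    (use W_in_U[of _ c] in auto)

lemma ex1_cov_deriv:
  assumes X: "X \<in> FA"
  shows "\<exists>!D. is_cov_deriv \<A> A L a b \<gamma> W X D"
proof (rule ex_ex1I)
  \<comment> \<open>The chosen chart may vary with \<open>t\<close> without any regularity.
    Smoothness in a fixed chart holds because all charts give the same value.\<close>
  define D where "D = (\<lambda>t\<in>{a..b}. cov_expr \<A> A L a b \<gamma> W X (SOME c. c \<in> \<A> \<and> \<gamma> t \<in> cdom c) t)"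
  have D: "D t = cov_expr \<A> A L a b \<gamma> W X c t" if "c \<in> \<A>" "t \<in> {a..b}" "\<gamma> t \<in> cdom c" for c t
  proof -
    have "(SOME c. c \<in> \<A> \<and> \<gamma> t \<in> cdom c) \<in> \<A> \<and> \<gamma> t \<in> cdom (SOME c. c \<in> \<A> \<and> \<gamma> t \<in> cdom c)"
      by (rule someI[of _ c]) (use that in blast)
    then show ?thesis
      using cov_expr_chart_independent[OF _ that(1,2) _ that(3) X] that(2) by (simp add: D_def)
  qed
  have "D t \<in> tangent_space \<A> (\<gamma> t)" if t: "t \<in> {a..b}" for t
  proof -
    obtain c where c: "c \<in> \<A>" "\<gamma> t \<in> cdom c" using chart_at by blast
    show ?thesis
      unfolding D[OF c(1) t c(2)] cov_expr_def by (rule coord_vec_in_tangent_space[OF c])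
  qed
  moreover have "smooth_on {t \<in> {a..b}. \<gamma> t \<in> cdom c} (\<lambda>t. vcomp c (D t))" if c: "c \<in> \<A>" for c
  proof -
    have "vcomp c (D t) = cov c X t" if "t \<in> S c" for t
      using D[OF c, of t] cov_expr_eq[OF c that] that by (simp add: S_def vcomp_coord_vec_same[OF c])
    then show ?thesis
      using smooth_on_eq[OF smooth_cov[OF c X], of "\<lambda>t. vcomp c (D t)"] unfolding S_def by blast
  qed
  ultimately have "is_cov_deriv \<A> A L a b \<gamma> W X D"
    using D unfolding is_cov_deriv_def fields_along_def by (auto simp: D_def)
  then show "\<exists>D. is_cov_deriv \<A> A L a b \<gamma> W X D"
    by blast
next
  fix D D' assume *: "is_cov_deriv \<A> A L a b \<gamma> W X D" "is_cov_deriv \<A> A L a b \<gamma> W X D'"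
  show "D = D'"
  proof (rule extensionalityI)
    show "D \<in> extensional {a..b}" "D' \<in> extensional {a..b}"
      using * by (auto simp: is_cov_deriv_def fields_along_def)
    show "D t = D' t" if "t \<in> {a..b}" for t
      using * chart_at[of t] that unfolding is_cov_deriv_def by metis
  qed
qed

lemma cov_deriv:
  assumes "X \<in> FA"
  shows "cov_deriv \<A> A L a b \<gamma> W X \<in> FA"
    and "c \<in> \<A> \<Longrightarrow> t \<in> S c \<Longrightarrow> vcomp c (cov_deriv \<A> A L a b \<gamma> W X t) = cov c X t"
proof -
  have *: "is_cov_deriv \<A> A L a b \<gamma> W X (cov_deriv \<A> A L a b \<gamma> W X)"
    unfolding cov_deriv_def by (rule theI'[OF ex1_cov_deriv[OF assms]])
  then show "cov_deriv \<A> A L a b \<gamma> W X \<in> FA"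
    by (simp add: is_cov_deriv_def)
  assume "c \<in> \<A>" "t \<in> S c"
  then show "vcomp c (cov_deriv \<A> A L a b \<gamma> W X t) = cov c X t"
    using * cov_expr_eq[of c t X] by (simp add: is_cov_deriv_def S_def vcomp_coord_vec_same)
qed

lemma cov_deriv_compatible:
  assumes X: "X \<in> FA" and Y: "Y \<in> FA" and t: "t \<in> {a..b}"
  shows "((\<lambda>s. fund_tensor L (W s) (X s) (Y s)) has_real_derivative
      (fund_tensor L (W t) (cov_deriv \<A> A L a b \<gamma> W X t) (Y t)
       + fund_tensor L (W t) (X t) (cov_deriv \<A> A L a b \<gamma> W Y t)
       + 2 * cartan_tensor L (W t) (cov_deriv \<A> A L a b \<gamma> W W t) (X t) (Y t)))
     (at t within {a..b})"
proof -
  obtain c where c: "c \<in> \<A>" "\<gamma> t \<in> cdom c" using chart_at by blast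
  have tS: "t \<in> S c" using c t by (simp add: S_def)
  interpret local_metric "F c" "U c" by (rule local_metric[OF c(1)])
  let ?z = "(\<xi> c t, vcomp c (W t))"
  interpret chern_data "g ?z" "C ?z" "d ?z" "snd ?z" by (rule chern_data[OF W_in_U[OF tS]])
  let ?c = "\<lambda>X s. vcomp c (X s)"
  define D where "D = (\<lambda>k. g ?z (k *\<^sub>R vd (?c X) t + \<Gamma> ?z (k *\<^sub>R vd (\<xi> c) t) (?c X t)) (?c Y t)
      + g ?z (?c X t) (k *\<^sub>R vd (?c Y) t + \<Gamma> ?z (k *\<^sub>R vd (\<xi> c) t) (?c Y t))
      + 2 * C ?z (?c X t) (?c Y t) (k *\<^sub>R vd (?c W) t + \<Gamma> ?z (k *\<^sub>R vd (\<xi> c) t) (?c W t)))"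
  have deriv: "(?c X has_derivative (\<lambda>h. h *\<^sub>R vd (?c X) t)) (at t within S c)" if "X \<in> FA" for X
    by (rule smooth_on_has_vector_derivative[OF openin_S[OF c(1)] tS smooth_FA[OF that c(1)]])
  have "((\<lambda>s. g (\<xi> c s, ?c W s) (?c X s) (?c Y s)) has_derivative D) (at t within S c)"
    unfolding D_def
    by (rule metric_has_derivative[OF W_in_U tS
          smooth_on_has_vector_derivative[OF openin_S[OF c(1)] tS smooth_\<xi>[OF c(1)]] deriv[OF W] deriv[OF X] deriv[OF Y]])
  then have "((\<lambda>s. fund_tensor L (W s) (X s) (Y s)) has_derivative D) (at t within S c)"
  proof (rule has_derivative_transform[OF tS, rotated])
    fix s assume "s \<in> S c"
    then have "s \<in> {a..b}" "\<gamma> s \<in> cdom c" by (auto simp: S_def)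
    then show "fund_tensor L (W s) (X s) (Y s) = g (\<xi> c s, ?c W s) (?c X s) (?c Y s)"
      using fund_tensor_chart[OF c(1) _ W_A base_W FA_tangent[OF X] FA_tangent[OF Y]] by (simp add: \<xi>_def)
  qed
  then have D: "((\<lambda>s. fund_tensor L (W s) (X s) (Y s)) has_derivative D) (at t within {a..b})"
    unfolding at_within_openin_eq[OF openin_S[OF c(1)] tS] .
  \<comment> \<open>A linear map of the real line is multiplication by its value at
    \<open>1\<close>, which is where the covariant derivatives appear.\<close>
  have "k * D 1 = D k" for k
    using linear_scale[OF has_derivative_linear[OF D], of k 1] by simp
  then have "((\<lambda>s. fund_tensor L (W s) (X s) (Y s)) has_real_derivative D 1) (at t within {a..b})"
    by (rule has_derivative_imp_has_field_derivative[OF D])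
  moreover have "C ?z (cov c W t) u w = C ?z u w (cov c W t)" for u w
    using C_sym1[of "cov c W t" u w] C_sym2[of u "cov c W t" w] by simp
  then have "D 1 = fund_tensor L (W t) (cov_deriv \<A> A L a b \<gamma> W X t) (Y t)
       + fund_tensor L (W t) (X t) (cov_deriv \<A> A L a b \<gamma> W Y t)
       + 2 * cartan_tensor L (W t) (cov_deriv \<A> A L a b \<gamma> W W t) (X t) (Y t)"
    using fund_tensor_chart[OF c W_A[OF t] base_W[OF t] FA_tangent[OF cov_deriv(1)[OF X] t] FA_tangent[OF Y t]]
      fund_tensor_chart[OF c W_A[OF t] base_W[OF t] FA_tangent[OF X t] FA_tangent[OF cov_deriv(1)[OF Y] t]]
      cartan_tensor_chart[OF c W_A[OF t] base_W[OF t] FA_tangent[OF cov_deriv(1)[OF W] t]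
        FA_tangent[OF X t] FA_tangent[OF Y t]]
    by (simp add: D_def cov_deriv(2)[OF X c(1) tS] cov_deriv(2)[OF Y c(1) tS] cov_deriv(2)[OF W c(1) tS]
        cov_def[symmetric] \<xi>_def[symmetric])
  ultimately show ?thesis by simp
qed

end

theorem proposition2p6:
  fixes \<A> :: "('m::{t2_space, second_countable_topology}, 'n::finite) chart set"
    and A :: "('m, 'n) tvec set"
    and L :: "('m, 'n) tvec \<Rightarrow> real"
  assumes finsler: "pseudo_finsler \<A> A L"
  shows
    "(\<forall>\<Omega> \<phi>. (\<Omega>, \<phi>) \<in> \<A> \<longrightarrow>
        (\<forall>\<Omega>\<^sub>1 \<Omega>\<^sub>2 V\<^sub>1 V\<^sub>2 x k i j.
           open \<Omega>\<^sub>1 \<and> \<Omega>\<^sub>1 \<subseteq> \<Omega> \<and> V\<^sub>1 \<in> admissible_fields \<A> A \<Omega>\<^sub>1 \<and>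
           open \<Omega>\<^sub>2 \<and> \<Omega>\<^sub>2 \<subseteq> \<Omega> \<and> V\<^sub>2 \<in> admissible_fields \<A> A \<Omega>\<^sub>2 \<and>
           x \<in> \<Omega>\<^sub>1 \<inter> \<Omega>\<^sub>2 \<and> V\<^sub>1 x = V\<^sub>2 x \<longrightarrow>
             christoffel \<A> L (\<Omega>, \<phi>) \<Omega>\<^sub>1 V\<^sub>1 k i j x = christoffel \<A> L (\<Omega>, \<phi>) \<Omega>\<^sub>2 V\<^sub>2 k i j x) \<and>
        (\<forall>V\<in>admissible_fields \<A> A \<Omega>. \<forall>x\<in>\<Omega>. \<forall>k i j.
           christoffel \<A> L (\<Omega>, \<phi>) \<Omega> V k i j x = Gam \<A> A L (\<Omega>, \<phi>) k i j (V x)) \<and>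
        (\<forall>v\<in>A. base v \<in> \<Omega> \<longrightarrow> (\<forall>s j i.
           Gam \<A> A L (\<Omega>, \<phi>) s j i v = chern_christoffel \<A> L (\<Omega>, \<phi>) s j i v)))
     \<and>
     (\<forall>a b \<gamma>. \<forall>W\<in>fields_along \<A> a b \<gamma>.
        a < b \<and> smooth_curve \<A> a b \<gamma> \<and> (\<forall>t\<in>{a..b}. W t \<in> A) \<longrightarrow>
          (\<forall>X\<in>fields_along \<A> a b \<gamma>.
             (\<forall>c\<in>\<A>. \<forall>c'\<in>\<A>. \<forall>t\<in>{a..b}. \<gamma> t \<in> cdom c \<inter> cdom c' \<longrightarrow>
                cov_expr \<A> A L a b \<gamma> W X c t = cov_expr \<A> A L a b \<gamma> W X c' t) \<and>
             (\<exists>!D. is_cov_deriv \<A> A L a b \<gamma> W X D)) \<and>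
          (\<forall>X\<in>fields_along \<A> a b \<gamma>. \<forall>Y\<in>fields_along \<A> a b \<gamma>. \<forall>t\<in>{a..b}.
             ((\<lambda>s. fund_tensor L (W s) (X s) (Y s)) has_real_derivative
                (fund_tensor L (W t) (cov_deriv \<A> A L a b \<gamma> W X t) (Y t)
                 + fund_tensor L (W t) (X t) (cov_deriv \<A> A L a b \<gamma> W Y t)
                 + 2 * cartan_tensor L (W t) (cov_deriv \<A> A L a b \<gamma> W W t) (X t) (Y t)))
               (at t within {a..b})))"
proof -
  interpret finsler \<A> A L
    using finsler by unfold_locales (auto simp: pseudo_finsler_def)
  have adm: "V x \<in> A \<and> base (V x) = x" if "V \<in> admissible_fields \<A> A \<Omega>" "x \<in> \<Omega>" for V x \<Omega>
    using that by (auto simp: admissible_fields_def vector_fields_def tangent_space_def)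
  show ?thesis (is "?P \<and> ?Q")
  proof
    show ?P
    proof (intro allI impI conjI ballI)
      fix \<Omega> \<phi> assume c: "(\<Omega>, \<phi>) \<in> \<A>"
      \<comment> \<open>The extension enters this value only through \<open>V x\<close>, whatever
        the open subset on which it is defined.\<close>
      have eq: "christoffel \<A> L (\<Omega>, \<phi>) \<Omega>' V k i j x = chern_christoffel \<A> L (\<Omega>, \<phi>) k i j (V x)"
        if "open \<Omega>'" "\<Omega>' \<subseteq> \<Omega>" "V \<in> admissible_fields \<A> A \<Omega>'" "x \<in> \<Omega>'" for \<Omega>' V x k i j
        using that by (intro finsler_patch.christoffel_eq[OF finsler_patchI[OF c]]) auto
      show "christoffel \<A> L (\<Omega>, \<phi>) \<Omega>\<^sub>1 V\<^sub>1 k i j x = christoffel \<A> L (\<Omega>, \<phi>) \<Omega>\<^sub>2 V\<^sub>2 k i j x"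
        if "open \<Omega>\<^sub>1 \<and> \<Omega>\<^sub>1 \<subseteq> \<Omega> \<and> V\<^sub>1 \<in> admissible_fields \<A> A \<Omega>\<^sub>1 \<and>
           open \<Omega>\<^sub>2 \<and> \<Omega>\<^sub>2 \<subseteq> \<Omega> \<and> V\<^sub>2 \<in> admissible_fields \<A> A \<Omega>\<^sub>2 \<and>
           x \<in> \<Omega>\<^sub>1 \<inter> \<Omega>\<^sub>2 \<and> V\<^sub>1 x = V\<^sub>2 x" for \<Omega>\<^sub>1 \<Omega>\<^sub>2 V\<^sub>1 V\<^sub>2 x k i j
        using eq[of \<Omega>\<^sub>1 V\<^sub>1 x k i j] eq[of \<Omega>\<^sub>2 V\<^sub>2 x k i j] that by auto
      show "christoffel \<A> L (\<Omega>, \<phi>) \<Omega> V k i j x = Gam \<A> A L (\<Omega>, \<phi>) k i j (V x)"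
        if "V \<in> admissible_fields \<A> A \<Omega>" "x \<in> \<Omega>" for V x k i j
        using eq[OF _ subset_refl that] open_cdom[OF c] Gam_eq[OF c] adm[OF that] that(2) by simp
      show "Gam \<A> A L (\<Omega>, \<phi>) s j i v = chern_christoffel \<A> L (\<Omega>, \<phi>) s j i v"
        if "v \<in> A" "base v \<in> \<Omega>" for v s j i
        using Gam_eq[OF c that(1)] that(2) by simp
    qed
    show ?Q
    proof (intro allI ballI impI)
      fix a b \<gamma> W
      assume W: "W \<in> fields_along \<A> a b \<gamma>"
        and *: "a < b \<and> smooth_curve \<A> a b \<gamma> \<and> (\<forall>t\<in>{a..b}. W t \<in> A)"
      interpret finsler_curve \<A> A L a b \<gamma> W
        by (intro finsler_curve.intro finsler_curve_axioms.intro finsler_axioms W) (use * in simp_all)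
      show "(\<forall>X\<in>FA.
             (\<forall>c\<in>\<A>. \<forall>c'\<in>\<A>. \<forall>t\<in>{a..b}. \<gamma> t \<in> cdom c \<inter> cdom c' \<longrightarrow>
                cov_expr \<A> A L a b \<gamma> W X c t = cov_expr \<A> A L a b \<gamma> W X c' t) \<and>
             (\<exists>!D. is_cov_deriv \<A> A L a b \<gamma> W X D)) \<and>
          (\<forall>X\<in>FA. \<forall>Y\<in>FA. \<forall>t\<in>{a..b}.
             ((\<lambda>s. fund_tensor L (W s) (X s) (Y s)) has_real_derivative
                (fund_tensor L (W t) (cov_deriv \<A> A L a b \<gamma> W X t) (Y t)
                 + fund_tensor L (W t) (X t) (cov_deriv \<A> A L a b \<gamma> W Y t)
                 + 2 * cartan_tensor L (W t) (cov_deriv \<A> A L a b \<gamma> W W t) (X t) (Y t)))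
               (at t within {a..b}))"
        by (intro conjI ballI impI cov_expr_chart_independent ex1_cov_deriv cov_deriv_compatible) simp_all
    qed
  qed
qed

end
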